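(* Let $(\mathfrak{g},\bullet)$ be a (finite dimensional real) left symmetric algebra with commutator Lie bracket $[u,v]=u\bullet v-v\bullet u$, let $G$ be a connected Lie group with Lie algebra $(\mathfrak{g},[\;,\;])$, and let $\nabla$ be the right invariant flat torsion-free connection on $G$ given by $\nabla_{u^-}v^-=-(u\bullet v)^-$. Let $r\in\mathfrak{g}\otimes\mathfrak{g}$ be symmetric and $r^-$ the associated right invariant symmetric bivector field on $G$. Then $(G,\nabla,r^-)$ is a contravariant pseudo-Hessian manifold if and only if, for all $\alpha,\beta,\gamma\in\mathfrak{g}^*$, $$[[r,r]](\alpha,\beta,\gamma):=\langle\gamma,\,r_\#([\alpha,\beta]_r)-[r_\#(\alpha),r_\#(\beta)]\rangle=0,$$ where $$[\alpha,\beta]_r=\mathrm{L}^*_{r_\#(\alpha)}\beta-\mathrm{L}^*_{r_\#(\beta)}\alpha\quad\text{and}\quad\langle\mathrm{L}_u^*\alpha,v\rangle=-\langle\alpha,u\bullet v\rangle.$$ In this case, the product on $\mathfrak{g}^*$ given by $\alpha.\beta=\mathrm{L}^*_{r_\#(\alpha)}\beta$ is left symmetric, $[\;,\;]_r$ is a Lie bracket on $\mathfrak{g}^*$, and $r_\#:(\mathfrak{g}^*,[\;,\;]_r)\to(\mathfrak{g},[\;,\;])$ is a morphism of Lie algebras.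
   Context: A left symmetric algebra is an algebra with $\mathrm{ass}(u,v,w)=\mathrm{ass}(v,u,w)$, where $\mathrm{ass}(u,v,w)=(u\bullet v)\bullet w-u\bullet(v\bullet w)$. For $u\in\mathfrak{g}$, $u^-$ is the right invariant vector field on $G$ with value $u$ at the identity; the Lie algebra of $G$ is defined by left invariant vector fields, so $[u^-,v^-]=-[u,v]^-$. For $r$ symmetric, viewed as a symmetric bilinear form on $\mathfrak{g}^*$, $r_\#:\mathfrak{g}^*\to\mathfrak{g}$ is defined by $\langle\beta,r_\#(\alpha)\rangle=r(\alpha,\beta)$. A triple $(M,\nabla,h)$, with $\nabla$ a torsion-free connection of vanishing curvature and $h$ a symmetric bivector field, is a contravariant pseudo-Hessian manifold if $(\nabla_{h_\#(\alpha)}h)(\beta,\gamma)=(\nabla_{h_\#(\beta)}h)(\alpha,\gamma)$ for all $\alpha,\beta,\gamma\in\Omega^1(M)$, where $\beta(h_\#(\alpha))=h(\alpha,\beta)$. *)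

theory Defs
  imports "HOL-Analysis.Analysis" "HOL-Library.Function_Algebras"
begin

section \<open>Functions as a real vector space\<close>

instantiation "fun" :: (type, scaleR) scaleR
begin

definition scaleR_fun :: "real \<Rightarrow> ('a \<Rightarrow> 'b) \<Rightarrow> 'a \<Rightarrow> 'b" where
  "scaleR_fun c f = (\<lambda>x. c *\<^sub>R f x)"

instance ..

end

instance "fun" :: (type, real_vector) real_vector
  by standard (auto simp: scaleR_fun_def fun_eq_iff scaleR_add_right scaleR_add_left)


section \<open>Algebras on a subspace of a real vector space\<close>

definition algebra_on :: "'v::real_vector set \<Rightarrow> ('v \<Rightarrow> 'v \<Rightarrow> 'v) \<Rightarrow> bool" where
  "algebra_on S m \<longleftrightarrow> subspace S \<and>
     (\<forall>x\<in>S. \<forall>y\<in>S. m x y \<in> S) \<and>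
     (\<forall>x\<in>S. \<forall>y\<in>S. \<forall>z\<in>S. m (x + y) z = m x z + m y z \<and> m z (x + y) = m z x + m z y) \<and>
     (\<forall>c. \<forall>x\<in>S. \<forall>y\<in>S. m (c *\<^sub>R x) y = c *\<^sub>R m x y \<and> m x (c *\<^sub>R y) = c *\<^sub>R m x y)"

definition associator :: "('v::real_vector \<Rightarrow> 'v \<Rightarrow> 'v) \<Rightarrow> 'v \<Rightarrow> 'v \<Rightarrow> 'v \<Rightarrow> 'v" where
  "associator m u v w = m (m u v) w - m u (m v w)"

definition left_symmetric_algebra_on :: "'v::real_vector set \<Rightarrow> ('v \<Rightarrow> 'v \<Rightarrow> 'v) \<Rightarrow> bool" where
  "left_symmetric_algebra_on S m \<longleftrightarrow> algebra_on S m \<and>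
     (\<forall>u\<in>S. \<forall>v\<in>S. \<forall>w\<in>S. associator m u v w = associator m v u w)"

definition lie_algebra_on :: "'v::real_vector set \<Rightarrow> ('v \<Rightarrow> 'v \<Rightarrow> 'v) \<Rightarrow> bool" where
  "lie_algebra_on S br \<longleftrightarrow> algebra_on S br \<and>
     (\<forall>x\<in>S. br x x = 0) \<and>
     (\<forall>x\<in>S. \<forall>y\<in>S. \<forall>z\<in>S. br x (br y z) + br y (br z x) + br z (br x y) = 0)"

definition lie_morphism_on ::
  "'v::real_vector set \<Rightarrow> ('v \<Rightarrow> 'v \<Rightarrow> 'v) \<Rightarrow> 'w::real_vector set \<Rightarrow> ('w \<Rightarrow> 'w \<Rightarrow> 'w) \<Rightarrow> ('v \<Rightarrow> 'w) \<Rightarrow> bool"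
  where
  "lie_morphism_on S br T br' F \<longleftrightarrow>
     (\<forall>x\<in>S. F x \<in> T) \<and>
     (\<forall>x\<in>S. \<forall>y\<in>S. F (x + y) = F x + F y) \<and> (\<forall>c. \<forall>x\<in>S. F (c *\<^sub>R x) = c *\<^sub>R F x) \<and>
     (\<forall>x\<in>S. \<forall>y\<in>S. F (br x y) = br' (F x) (F y))"

definition commutator :: "('v::real_vector \<Rightarrow> 'v \<Rightarrow> 'v) \<Rightarrow> 'v \<Rightarrow> 'v \<Rightarrow> 'v" where
  "commutator m u v = m u v - m v u"


section \<open>Smooth manifolds\<close>

text \<open>\<open>ck_on k S f\<close> says that \<open>f\<close> is of class \<open>C\<^sup>k\<close> on the open set \<open>S\<close> of a finite-dimensional
  space: there, continuity of the derivative amounts to continuity of all directional derivatives.\<close>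

primrec ck_on :: "nat \<Rightarrow> 'e::real_normed_vector set \<Rightarrow> ('e \<Rightarrow> 'f::real_normed_vector) \<Rightarrow> bool" where
  "ck_on 0 S f \<longleftrightarrow> continuous_on S f"
| "ck_on (Suc k) S f \<longleftrightarrow> (\<forall>x\<in>S. f differentiable (at x)) \<and>
     (\<forall>v. ck_on k S (\<lambda>x. frechet_derivative f (at x) v))"

definition smooth_on :: "'e::real_normed_vector set \<Rightarrow> ('e \<Rightarrow> 'f::real_normed_vector) \<Rightarrow> bool" where
  "smooth_on S f \<longleftrightarrow> (\<forall>k. ck_on k S f)"

text \<open>A chart \<open>(U, \<phi>)\<close> has domain \<open>U\<close> and only the values of \<open>\<phi>\<close> on \<open>U\<close> matter. The model space is
  a finite-dimensional inner product space rather than a \<^class>\<open>euclidean_space\<close>, so that dimension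
  zero is allowed.\<close>

type_synonym ('g, 'e) atlas = "('g set \<times> ('g \<Rightarrow> 'e)) set"

definition smooth_manifold ::
  "('g::{t2_space,second_countable_topology}, 'e::real_inner) atlas \<Rightarrow> bool" where
  "smooth_manifold A \<longleftrightarrow>
     (\<exists>B::'e set. finite B \<and> span B = UNIV) \<and>
     (\<forall>(U, \<phi>)\<in>A. open U \<and> open (\<phi> ` U) \<and> homeomorphism U (\<phi> ` U) \<phi> (inv_into U \<phi>)) \<and>
     (\<forall>p. \<exists>(U, \<phi>)\<in>A. p \<in> U) \<and>
     (\<forall>(U, \<phi>)\<in>A. \<forall>(V, \<psi>)\<in>A. smooth_on (\<phi> ` (U \<inter> V)) (\<psi> \<circ> inv_into U \<phi>))"

definition product_atlas :: "('g, 'e) atlas \<Rightarrow> ('h, 'f) atlas \<Rightarrow> ('g \<times> 'h, 'e \<times> 'f) atlas" where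
  "product_atlas A B = {(U \<times> V, map_prod \<phi> \<psi>) | U V \<phi> \<psi>. (U, \<phi>) \<in> A \<and> (V, \<psi>) \<in> B}"

definition smooth_map ::
  "('g::topological_space, 'e::real_inner) atlas \<Rightarrow> ('h::topological_space, 'f::real_inner) atlas
    \<Rightarrow> ('g \<Rightarrow> 'h) \<Rightarrow> bool" where
  "smooth_map A B F \<longleftrightarrow> continuous_on UNIV F \<and>
     (\<forall>(U, \<phi>)\<in>A. \<forall>(V, \<psi>)\<in>B. smooth_on (\<phi> ` (U \<inter> F -` V)) (\<psi> \<circ> F \<circ> inv_into U \<phi>))"

definition smooth_fun_on ::
  "('g::topological_space, 'e::real_inner) atlas \<Rightarrow> 'g set \<Rightarrow> ('g \<Rightarrow> real) \<Rightarrow> bool" where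
  "smooth_fun_on A W f \<longleftrightarrow> (\<forall>(U, \<phi>)\<in>A. smooth_on (\<phi> ` (U \<inter> W)) (f \<circ> inv_into U \<phi>))"

definition smooth_near ::
  "('g::topological_space, 'e::real_inner) atlas \<Rightarrow> 'g \<Rightarrow> ('g \<Rightarrow> real) \<Rightarrow> bool" where
  "smooth_near A p f \<longleftrightarrow> (\<exists>W. open W \<and> p \<in> W \<and> smooth_fun_on A W f)"

definition smooth_funs :: "('g::topological_space, 'e::real_inner) atlas \<Rightarrow> ('g \<Rightarrow> real) set" where
  "smooth_funs A = {f. smooth_fun_on A UNIV f}"


section \<open>Vector fields and differential forms\<close>

text \<open>A tangent vector at \<open>p\<close> is the directional derivative at \<open>p\<close> along some vector \<open>w\<close> in some chart,
  acting on the functions that are smooth near \<open>p\<close>. Its value on all other functions is set to zero,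
  so that equal tangent vectors are equal as HOL functions.\<close>

type_synonym 'g tangent_vector = "('g \<Rightarrow> real) \<Rightarrow> real"

definition tangent_space ::
  "('g::topological_space, 'e::real_inner) atlas \<Rightarrow> 'g \<Rightarrow> 'g tangent_vector set" where
  "tangent_space A p = {v. \<exists>(U, \<phi>)\<in>A. p \<in> U \<and>
     (\<exists>w. v = (\<lambda>f. if smooth_near A p f
                   then frechet_derivative (f \<circ> inv_into U \<phi>) (at (\<phi> p)) w else 0))}"

type_synonym 'g vfield = "'g \<Rightarrow> 'g tangent_vector"

definition deriv_along :: "'g vfield \<Rightarrow> ('g \<Rightarrow> real) \<Rightarrow> 'g \<Rightarrow> real" where
  "deriv_along X f = (\<lambda>p. X p f)"

definition vector_fields :: "('g::topological_space, 'e::real_inner) atlas \<Rightarrow> 'g vfield set" where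
  "vector_fields A = {X. (\<forall>p. X p \<in> tangent_space A p) \<and>
     (\<forall>W f. open W \<longrightarrow> smooth_fun_on A W f \<longrightarrow> smooth_fun_on A W (deriv_along X f))}"

definition vf_scale :: "('g \<Rightarrow> real) \<Rightarrow> 'g vfield \<Rightarrow> 'g vfield" where
  "vf_scale f X = (\<lambda>p. f p *\<^sub>R X p)"

definition vf_bracket ::
  "('g::topological_space, 'e::real_inner) atlas \<Rightarrow> 'g vfield \<Rightarrow> 'g vfield \<Rightarrow> 'g vfield" where
  "vf_bracket A X Y = (\<lambda>p f. if smooth_near A p f
     then X p (deriv_along Y f) - Y p (deriv_along X f) else 0)"

text \<open>Differential 1-forms are the \<open>C\<^sup>\<infinity>(M)\<close>-linear maps from vector fields to smooth functions, set to
  zero on arguments that are not vector fields. Multiplication of real functions is pointwise.\<close>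

type_synonym 'g form = "'g vfield \<Rightarrow> 'g \<Rightarrow> real"

definition one_forms :: "('g::topological_space, 'e::real_inner) atlas \<Rightarrow> 'g form set" where
  "one_forms A = {\<alpha>.
     (\<forall>X\<in>vector_fields A. \<alpha> X \<in> smooth_funs A) \<and>
     (\<forall>X\<in>vector_fields A. \<forall>Y\<in>vector_fields A. \<alpha> (X + Y) = \<alpha> X + \<alpha> Y) \<and>
     (\<forall>f\<in>smooth_funs A. \<forall>X\<in>vector_fields A. \<alpha> (vf_scale f X) = f * \<alpha> X) \<and>
     (\<forall>X. X \<notin> vector_fields A \<longrightarrow> \<alpha> X = 0)}"

text \<open>Symmetric bivector fields are the symmetric \<open>C\<^sup>\<infinity>(M)\<close>-bilinear maps on 1-forms; linearity in the
  second argument follows from symmetry.\<close>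

definition symmetric_bivector_field ::
  "('g::topological_space, 'e::real_inner) atlas \<Rightarrow> ('g form \<Rightarrow> 'g form \<Rightarrow> 'g \<Rightarrow> real) \<Rightarrow> bool" where
  "symmetric_bivector_field A h \<longleftrightarrow>
     (\<forall>\<alpha>\<in>one_forms A. \<forall>\<beta>\<in>one_forms A. h \<alpha> \<beta> \<in> smooth_funs A \<and> h \<alpha> \<beta> = h \<beta> \<alpha>) \<and>
     (\<forall>\<alpha>\<in>one_forms A. \<forall>\<alpha>'\<in>one_forms A. \<forall>\<beta>\<in>one_forms A. h (\<alpha> + \<alpha>') \<beta> = h \<alpha> \<beta> + h \<alpha>' \<beta>) \<and>
     (\<forall>f\<in>smooth_funs A. \<forall>\<alpha>\<in>one_forms A. \<forall>\<beta>\<in>one_forms A. h (\<lambda>X. f * \<alpha> X) \<beta> = f * h \<alpha> \<beta>)"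

definition bivector_sharp ::
  "('g::topological_space, 'e::real_inner) atlas \<Rightarrow> ('g form \<Rightarrow> 'g form \<Rightarrow> 'g \<Rightarrow> real)
    \<Rightarrow> 'g form \<Rightarrow> 'g vfield" where
  "bivector_sharp A h \<alpha> = (THE X. X \<in> vector_fields A \<and> (\<forall>\<beta>\<in>one_forms A. \<beta> X = h \<alpha> \<beta>))"


section \<open>Connections and contravariant pseudo-Hessian manifolds\<close>

definition connection ::
  "('g::topological_space, 'e::real_inner) atlas \<Rightarrow> ('g vfield \<Rightarrow> 'g vfield \<Rightarrow> 'g vfield) \<Rightarrow> bool"
  where
  "connection A D \<longleftrightarrow>
     (\<forall>X\<in>vector_fields A. \<forall>Y\<in>vector_fields A. D X Y \<in> vector_fields A) \<and>
     (\<forall>X\<in>vector_fields A. \<forall>X'\<in>vector_fields A. \<forall>Y\<in>vector_fields A.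
        D (X + X') Y = D X Y + D X' Y) \<and>
     (\<forall>f\<in>smooth_funs A. \<forall>X\<in>vector_fields A. \<forall>Y\<in>vector_fields A.
        D (vf_scale f X) Y = vf_scale f (D X Y)) \<and>
     (\<forall>X\<in>vector_fields A. \<forall>Y\<in>vector_fields A. \<forall>Y'\<in>vector_fields A.
        D X (Y + Y') = D X Y + D X Y') \<and>
     (\<forall>f\<in>smooth_funs A. \<forall>X\<in>vector_fields A. \<forall>Y\<in>vector_fields A.
        D X (vf_scale f Y) = vf_scale (deriv_along X f) Y + vf_scale f (D X Y))"

definition torsion_free ::
  "('g::topological_space, 'e::real_inner) atlas \<Rightarrow> ('g vfield \<Rightarrow> 'g vfield \<Rightarrow> 'g vfield) \<Rightarrow> bool"
  where
  "torsion_free A D \<longleftrightarrow>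
     (\<forall>X\<in>vector_fields A. \<forall>Y\<in>vector_fields A. D X Y - D Y X = vf_bracket A X Y)"

definition flat ::
  "('g::topological_space, 'e::real_inner) atlas \<Rightarrow> ('g vfield \<Rightarrow> 'g vfield \<Rightarrow> 'g vfield) \<Rightarrow> bool"
  where
  "flat A D \<longleftrightarrow> (\<forall>X\<in>vector_fields A. \<forall>Y\<in>vector_fields A. \<forall>Z\<in>vector_fields A.
     D X (D Y Z) - D Y (D X Z) - D (vf_bracket A X Y) Z = 0)"

definition nabla_form ::
  "('g::topological_space, 'e::real_inner) atlas \<Rightarrow> ('g vfield \<Rightarrow> 'g vfield \<Rightarrow> 'g vfield)
    \<Rightarrow> 'g vfield \<Rightarrow> 'g form \<Rightarrow> 'g form" where
  "nabla_form A D X \<beta> = (\<lambda>Y. if Y \<in> vector_fields A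
     then deriv_along X (\<beta> Y) - \<beta> (D X Y) else 0)"

definition nabla_bivector ::
  "('g::topological_space, 'e::real_inner) atlas \<Rightarrow> ('g vfield \<Rightarrow> 'g vfield \<Rightarrow> 'g vfield)
    \<Rightarrow> 'g vfield \<Rightarrow> ('g form \<Rightarrow> 'g form \<Rightarrow> 'g \<Rightarrow> real) \<Rightarrow> 'g form \<Rightarrow> 'g form \<Rightarrow> 'g \<Rightarrow> real" where
  "nabla_bivector A D X h \<beta> \<gamma> =
     deriv_along X (h \<beta> \<gamma>) - h (nabla_form A D X \<beta>) \<gamma> - h \<beta> (nabla_form A D X \<gamma>)"

definition contravariant_pseudo_hessian ::
  "('g::{t2_space,second_countable_topology}, 'e::real_inner) atlas
    \<Rightarrow> ('g vfield \<Rightarrow> 'g vfield \<Rightarrow> 'g vfield) \<Rightarrow> ('g form \<Rightarrow> 'g form \<Rightarrow> 'g \<Rightarrow> real) \<Rightarrow> bool" where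
  "contravariant_pseudo_hessian A D h \<longleftrightarrow>
     smooth_manifold A \<and> connection A D \<and> torsion_free A D \<and> flat A D \<and>
     symmetric_bivector_field A h \<and>
     (\<forall>\<alpha>\<in>one_forms A. \<forall>\<beta>\<in>one_forms A. \<forall>\<gamma>\<in>one_forms A.
        nabla_bivector A D (bivector_sharp A h \<alpha>) h \<beta> \<gamma> =
        nabla_bivector A D (bivector_sharp A h \<beta>) h \<alpha> \<gamma>)"


section \<open>Lie groups\<close>

definition lie_group ::
  "('g::{t2_space,second_countable_topology}, 'e::real_inner) atlas
    \<Rightarrow> ('g \<Rightarrow> 'g \<Rightarrow> 'g) \<Rightarrow> 'g \<Rightarrow> ('g \<Rightarrow> 'g) \<Rightarrow> bool" where
  "lie_group A mul e ginv \<longleftrightarrow> smooth_manifold A \<and> group mul e ginv \<and>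
     smooth_map (product_atlas A A) A (\<lambda>(x, y). mul x y) \<and> smooth_map A A ginv"

text \<open>The push-forwards of a tangent vector \<open>w\<close> at the identity under \<open>q \<mapsto> p q\<close> and \<open>q \<mapsto> q p\<close>. Since
  translations are diffeomorphisms, \<open>f\<close> composed with one of them is smooth near the identity iff
  \<open>f\<close> is smooth near \<open>p\<close>, so the convention on non-smooth functions is preserved.\<close>

definition left_invariant_field :: "('g \<Rightarrow> 'g \<Rightarrow> 'g) \<Rightarrow> 'g tangent_vector \<Rightarrow> 'g vfield" where
  "left_invariant_field mul w = (\<lambda>p f. w (\<lambda>q. f (mul p q)))"

definition right_invariant_field :: "('g \<Rightarrow> 'g \<Rightarrow> 'g) \<Rightarrow> 'g tangent_vector \<Rightarrow> 'g vfield" where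
  "right_invariant_field mul w = (\<lambda>p f. w (\<lambda>q. f (mul q p)))"

text \<open>\<open>\<theta>\<close> identifies a Lie algebra with the tangent space at the identity, equipped with the
  bracket of left invariant vector fields.\<close>

definition lie_algebra_identification ::
  "('g::topological_space, 'e::real_inner) atlas \<Rightarrow> ('g \<Rightarrow> 'g \<Rightarrow> 'g) \<Rightarrow> 'g
    \<Rightarrow> ('a::real_vector \<Rightarrow> 'a \<Rightarrow> 'a) \<Rightarrow> ('a \<Rightarrow> 'g tangent_vector) \<Rightarrow> bool" where
  "lie_algebra_identification A mul e br \<theta> \<longleftrightarrow>
     linear \<theta> \<and> bij_betw \<theta> UNIV (tangent_space A e) \<and>
     (\<forall>u v. vf_bracket A (left_invariant_field mul (\<theta> u)) (left_invariant_field mul (\<theta> v)) =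
            left_invariant_field mul (\<theta> (br u v)))"


section \<open>Symmetric tensors on a left symmetric algebra\<close>

definition dual_space :: "('a::real_vector \<Rightarrow> real) set" where
  "dual_space = {\<alpha>. linear \<alpha>}"

text \<open>Symmetric elements of \<open>\<gg> \<otimes> \<gg>\<close>, for \<open>\<gg>\<close> finite dimensional, as symmetric bilinear forms on the
  dual space.\<close>

definition symmetric_tensor :: "(('a::real_vector \<Rightarrow> real) \<Rightarrow> ('a \<Rightarrow> real) \<Rightarrow> real) \<Rightarrow> bool" where
  "symmetric_tensor r \<longleftrightarrow>
     (\<forall>\<alpha>\<in>dual_space. \<forall>\<beta>\<in>dual_space. r \<alpha> \<beta> = r \<beta> \<alpha>) \<and>
     (\<forall>\<alpha>\<in>dual_space. \<forall>\<alpha>'\<in>dual_space. \<forall>\<beta>\<in>dual_space. r (\<alpha> + \<alpha>') \<beta> = r \<alpha> \<beta> + r \<alpha>' \<beta>) \<and>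
     (\<forall>c. \<forall>\<alpha>\<in>dual_space. \<forall>\<beta>\<in>dual_space. r (c *\<^sub>R \<alpha>) \<beta> = c * r \<alpha> \<beta>)"

definition tensor_sharp ::
  "(('a::real_vector \<Rightarrow> real) \<Rightarrow> ('a \<Rightarrow> real) \<Rightarrow> real) \<Rightarrow> ('a \<Rightarrow> real) \<Rightarrow> 'a" where
  "tensor_sharp r \<alpha> = (THE u. \<forall>\<beta>\<in>dual_space. \<beta> u = r \<alpha> \<beta>)"

text \<open>The right invariant bivector field with value \<open>r\<close> at the identity: at \<open>p\<close> it applies \<open>r\<close> to the
  pull-backs of \<open>\<alpha>\<close> and \<open>\<beta>\<close> along the right translation by \<open>p\<close>.\<close>

definition right_invariant_bivector ::
  "('g \<Rightarrow> 'g \<Rightarrow> 'g) \<Rightarrow> ('a::real_vector \<Rightarrow> 'g tangent_vector)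
    \<Rightarrow> (('a \<Rightarrow> real) \<Rightarrow> ('a \<Rightarrow> real) \<Rightarrow> real) \<Rightarrow> 'g form \<Rightarrow> 'g form \<Rightarrow> 'g \<Rightarrow> real" where
  "right_invariant_bivector mul \<theta> r \<alpha> \<beta> = (\<lambda>p.
     r (\<lambda>u. \<alpha> (right_invariant_field mul (\<theta> u)) p)
       (\<lambda>u. \<beta> (right_invariant_field mul (\<theta> u)) p))"

definition L_star :: "('a::real_vector \<Rightarrow> 'a \<Rightarrow> 'a) \<Rightarrow> 'a \<Rightarrow> ('a \<Rightarrow> real) \<Rightarrow> 'a \<Rightarrow> real" where
  "L_star m u \<alpha> = (\<lambda>v. - \<alpha> (m u v))"

definition dual_product ::
  "('a::real_vector \<Rightarrow> 'a \<Rightarrow> 'a) \<Rightarrow> (('a \<Rightarrow> real) \<Rightarrow> ('a \<Rightarrow> real) \<Rightarrow> real)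
    \<Rightarrow> ('a \<Rightarrow> real) \<Rightarrow> ('a \<Rightarrow> real) \<Rightarrow> 'a \<Rightarrow> real" where
  "dual_product m r \<alpha> \<beta> = L_star m (tensor_sharp r \<alpha>) \<beta>"

definition dual_bracket ::
  "('a::real_vector \<Rightarrow> 'a \<Rightarrow> 'a) \<Rightarrow> (('a \<Rightarrow> real) \<Rightarrow> ('a \<Rightarrow> real) \<Rightarrow> real)
    \<Rightarrow> ('a \<Rightarrow> real) \<Rightarrow> ('a \<Rightarrow> real) \<Rightarrow> 'a \<Rightarrow> real" where
  "dual_bracket m r \<alpha> \<beta> = L_star m (tensor_sharp r \<alpha>) \<beta> - L_star m (tensor_sharp r \<beta>) \<alpha>"

definition double_bracket ::
  "('a::real_vector \<Rightarrow> 'a \<Rightarrow> 'a) \<Rightarrow> (('a \<Rightarrow> real) \<Rightarrow> ('a \<Rightarrow> real) \<Rightarrow> real)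
    \<Rightarrow> ('a \<Rightarrow> real) \<Rightarrow> ('a \<Rightarrow> real) \<Rightarrow> ('a \<Rightarrow> real) \<Rightarrow> real" where
  "double_bracket m r \<alpha> \<beta> \<gamma> =
     \<gamma> (tensor_sharp r (dual_bracket m r \<alpha> \<beta>) -
        commutator m (tensor_sharp r \<alpha>) (tensor_sharp r \<beta>))"

end

(* The right invariant fields u^- trivialise the tangent bundle: every vector field is
   p |-> (x p)^- p for a unique smooth g-valued function x, namely the image of X_p under the right
   translation by p^-1. Hence torsion, curvature and the covariant derivative of r^-, being tensorial,
   are determined by right invariant fields. Torsion and curvature vanish there because left symmetry
   makes u |-> L_u a representation of the commutator bracket and because [u^-, v^-] = -[u, v]^-.
   The latter is symmetry of mixed partial derivatives for (x, y) |-> f (x y).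
   If alpha, beta, gamma in g* are the values of 1-forms at a point, transported to the identity, then
   (nabla_X r^-)(beta, gamma) = r(L*_u beta, gamma) + r(beta, L*_u gamma) with u the transported value
   of X, and the defining symmetry of a contravariant pseudo-Hessian structure becomes
   [[r, r]](alpha, beta, gamma) = 0. *)
theory Submission
  imports Defs
begin

text \<open>Smoothness is treated as a property of germs (\<open>smooth_at\<close>,
  \<open>smooth_near\<close>) that can be tested in any one chart. Statements about the group then
  become statements about smooth functions of two variables on a product manifold, such as (x, y)
  |-> f (x y), where a vector or a field acts in one variable and the other is a parameter. This is
  how right invariant fields, and the components of arbitrary fields with respect to them, are seen
  to be smooth. Tangent vectors are total on real functions, with default 0 on functions not smooth
  near the point, so identities between them must also respect this default. Fields and forms are
  objects on the whole manifold. That a tensor at p depends only on its arguments at p usually takes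
  cut-off functions; here it follows from the global frame, whose coefficients are smooth on all of
  G, so that linearity over smooth functions applies directly (\<open>vector_field_induct\<close>).
  In the final equivalence the difference of the two sides of the defining symmetry is the double
  bracket itself at each point, and invariant forms realise every triple of functionals.\<close>

section \<open>Differential calculus of iterated derivatives\<close>

text \<open>A substitute for orthonormal bases: the model spaces need not be Euclidean spaces, and frames,
  unlike bases, may contain 0, so the union of frames of two factors is a frame of the product.\<close>

definition parseval_frame :: "'e::real_inner set \<Rightarrow> bool" where
  "parseval_frame C \<longleftrightarrow> finite C \<and> (\<forall>v. v = (\<Sum>c\<in>C. (v \<bullet> c) *\<^sub>R c))"

text \<open>Orthogonalise a finite spanning set, drop 0 and normalise. The error of the expansion of
  v is orthogonal to the resulting set, hence to its span, which is the whole space, hence to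
  itself.\<close>

lemma parseval_frame_exists:
  assumes "finite B" and "span B = (UNIV :: 'e::real_inner set)"
  shows "\<exists>C::'e set. parseval_frame C"
proof -
  obtain C :: "'e set" where C: "finite C" "span C = UNIV" "pairwise orthogonal C"
    using basis_orthogonal[OF assms(1)] unfolding assms(2) by blast
  define N where "N = (\<lambda>c. c /\<^sub>R norm c) ` (C - {0})"
  have finN: "finite N" using C by (simp add: N_def)
  have spN: "span N = UNIV"
  proof -
    have "c \<in> span N" if "c \<in> C" for c
    proof (cases "c = 0")
      case False
      then have "c /\<^sub>R norm c \<in> span N" using that by (auto simp: N_def intro: span_base)
      then have "norm c *\<^sub>R (c /\<^sub>R norm c) \<in> span N" by (rule span_scale)
      then show ?thesis using False by simp
    qed (simp add: span_zero)
    then have "span C \<subseteq> span N" by (meson span_minimal subsetI subspace_span)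
    then show ?thesis using C by auto
  qed
  have orth: "a \<bullet> b = (if a = b then 1 else 0)" if N: "a \<in> N" "b \<in> N" for a b
  proof -
    obtain a' b' where ab: "a = a' /\<^sub>R norm a'" "b = b' /\<^sub>R norm b'" "a' \<in> C" "b' \<in> C" "a' \<noteq> 0" "b' \<noteq> 0"
      using N unfolding N_def by blast
    show ?thesis
    proof (cases "a' = b'")
      case True
      then show ?thesis using ab by (simp add: dot_square_norm power2_eq_square divide_simps)
    next
      case False
      then have "a' \<bullet> b' = 0" using C(3) ab by (auto simp: pairwise_def orthogonal_def)
      then have z: "a \<bullet> b = 0" using ab by simp
      have "a \<noteq> b"
      proof
        assume "a = b"
        then have "a = 0" using z by simp
        then show False using ab by simp
      qed
      then show ?thesis using z by simp
    qed
  qed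
  have "v = (\<Sum>c\<in>N. (v \<bullet> c) *\<^sub>R c)" for v
  proof -
    define w where "w = v - (\<Sum>c\<in>N. (v \<bullet> c) *\<^sub>R c)"
    have "w \<bullet> a = 0" if "a \<in> N" for a
    proof -
      have "(\<Sum>c\<in>N. (v \<bullet> c) *\<^sub>R c) \<bullet> a = (\<Sum>c\<in>N. if c = a then v \<bullet> c else 0)"
        unfolding inner_sum_left using that by (intro sum.cong) (auto simp: orth)
      then show ?thesis using that finN by (simp add: w_def inner_diff_left)
    qed
    moreover have "w \<in> span N" using spN by simp
    ultimately have "w \<bullet> w = 0"
      by (metis (mono_tags, lifting) orthogonal_def orthogonal_to_span)
    then show ?thesis by (simp add: w_def)
  qed
  then show ?thesis using finN by (auto simp: parseval_frame_def)
qed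

lemma parseval_frame_prod:
  assumes "parseval_frame C" "parseval_frame D"
  shows "parseval_frame (C \<times> {0} \<union> {0} \<times> D)"
proof -
  have fin: "finite C" "finite D" using assms by (auto simp: parseval_frame_def)
  have "v = (\<Sum>c\<in>C \<times> {0} \<union> {0} \<times> D. (v \<bullet> c) *\<^sub>R c)" for v :: "'a \<times> 'b"
  proof -
    \<comment> \<open>The two parts can meet only in (0, 0), whose term is zero, so the sum splits
      even when they overlap.\<close>
    have "(\<Sum>c\<in>C \<times> {0} \<union> {0} \<times> D. (v \<bullet> c) *\<^sub>R c) =
       (\<Sum>c\<in>C \<times> {0}. (v \<bullet> c) *\<^sub>R c) + (\<Sum>c\<in>{0} \<times> D. (v \<bullet> c) *\<^sub>R c)"
      by (rule sum.union_inter_neutral) (use fin in \<open>auto simp: inner_prod_def\<close>)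
    also have "(\<Sum>c\<in>C \<times> {0::'b}. (v \<bullet> c) *\<^sub>R c) = (\<Sum>c\<in>C. ((fst v \<bullet> c) *\<^sub>R c, 0))"
      by (subst sum.cartesian_product[symmetric, where g="\<lambda>a b. (v \<bullet> (a,b)) *\<^sub>R (a,b)", simplified case_prod_unfold, simplified])
         (simp add: inner_prod_def)
    also have "(\<Sum>c\<in>{0::'a} \<times> D. (v \<bullet> c) *\<^sub>R c) = (\<Sum>c\<in>D. (0, (snd v \<bullet> c) *\<^sub>R c))"
      by (subst sum.cartesian_product[symmetric, where g="\<lambda>a b. (v \<bullet> (a,b)) *\<^sub>R (a,b)", simplified case_prod_unfold, simplified])
         (simp add: inner_prod_def)
    also have "(\<Sum>c\<in>C. ((fst v \<bullet> c) *\<^sub>R c, 0::'b)) = (fst v, 0)"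
      using assms(1) by (simp add: prod_eq_iff fst_sum snd_sum parseval_frame_def)
    also have "(\<Sum>c\<in>D. (0::'a, (snd v \<bullet> c) *\<^sub>R c)) = (0, snd v)"
      using assms(2) by (simp add: prod_eq_iff fst_sum snd_sum parseval_frame_def)
    finally show ?thesis by simp
  qed
  then show ?thesis using fin by (auto simp: parseval_frame_def)
qed

lemma linear_parseval_frame:
  assumes "parseval_frame C" "linear L"
  shows "L v = (\<Sum>c\<in>C. (v \<bullet> c) *\<^sub>R L c)"
proof -
  have "L v = L (\<Sum>c\<in>C. (v \<bullet> c) *\<^sub>R c)" using assms by (simp add: parseval_frame_def)
  then show ?thesis using assms(2) by (simp add: linear_sum linear_scale)
qed

text \<open>A frame is finite, so L is a finite sum of bounded maps: this is the automatic
  continuity of linear maps in finite dimension.\<close>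

lemma bounded_linear_parseval_frame:
  fixes L :: "'e::real_inner \<Rightarrow> 'f::real_normed_vector"
  assumes "parseval_frame (C::'e set)" "linear L"
  shows "bounded_linear L"
proof -
  have "bounded_linear (\<lambda>v. \<Sum>c\<in>C. (v \<bullet> c) *\<^sub>R L c)"
    by (intro bounded_linear_sum bounded_linear_scaleR_const bounded_linear_inner_left)
  moreover have "L = (\<lambda>v. \<Sum>c\<in>C. (v \<bullet> c) *\<^sub>R L c)"
    using linear_parseval_frame[OF assms] by (rule ext)
  ultimately show ?thesis by metis
qed

section \<open>Closure properties of C^k maps on open sets\<close>

lemma ck_on_subset: "ck_on k S f \<Longrightarrow> T \<subseteq> S \<Longrightarrow> ck_on k T f"
  by (induction k arbitrary: f) (auto intro: continuous_on_subset)

lemma frechet_derivative_cong_open: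
  assumes "open S" "x \<in> S" "\<And>y. y \<in> S \<Longrightarrow> f y = g y"
  shows "frechet_derivative f (at x) = frechet_derivative g (at x)"
proof -
  have "(f has_derivative f') (at x) \<longleftrightarrow> (g has_derivative f') (at x)" for f'
    using has_derivative_transform_within_open[OF _ assms(1,2)] assms(3) by metis
  then show ?thesis by (simp add: frechet_derivative_def)
qed

lemma differentiable_cong_open:
  assumes "f differentiable (at x)" "open S" "x \<in> S" "\<And>y. y \<in> S \<Longrightarrow> f y = g y"
  shows "g differentiable (at x)"
  using assms has_derivative_transform_within_open unfolding differentiable_def by metis

text \<open>A derivative at x sees only values near x; on an open set the agreement therefore passes
  to directional derivatives, and by induction to all orders.\<close>

lemma ck_on_cong:
  assumes "open S" "\<And>x. x \<in> S \<Longrightarrow> f x = g x"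
  shows "ck_on k S f \<longleftrightarrow> ck_on k S g"
  using assms(2)
proof (induction k arbitrary: f g)
  case 0
  then show ?case by (auto cong: continuous_on_cong)
next
  case (Suc k)
  have "frechet_derivative f (at x) v = frechet_derivative g (at x) v" if "x \<in> S" for x v
    using frechet_derivative_cong_open[OF assms(1) that] Suc.prems by metis
  then have "ck_on k S (\<lambda>x. frechet_derivative f (at x) v) \<longleftrightarrow> ck_on k S (\<lambda>x. frechet_derivative g (at x) v)" for v
    by (intro Suc.IH)
  moreover have "f differentiable (at x) \<longleftrightarrow> g differentiable (at x)" if "x \<in> S" for x
    using differentiable_cong_open[OF _ assms(1) that] Suc.prems by metis
  ultimately show ?case by auto
qed

text \<open>Continuity and differentiability at a point are local, and the local hypothesis is
  inherited by every directional derivative.\<close>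

lemma ck_on_open_local:
  assumes "\<And>x. x \<in> S \<Longrightarrow> \<exists>T. open T \<and> x \<in> T \<and> ck_on k T f"
  shows "ck_on k S f"
  using assms
proof (induction k arbitrary: f)
  case 0
  have "isCont f x" if "x \<in> S" for x
    using 0[OF that] continuous_on_eq_continuous_at by auto
  then show ?case by (auto intro: continuous_at_imp_continuous_on)
next
  case (Suc k)
  have "f differentiable (at x)" if "x \<in> S" for x
    using Suc.prems[OF that] by auto
  moreover have "ck_on k S (\<lambda>x. frechet_derivative f (at x) v)" for v
    by (rule Suc.IH) (use Suc.prems in fastforce)
  ultimately show ?case by simp
qed

lemma ck_on_Suc_imp: "ck_on (Suc k) S f \<Longrightarrow> ck_on k S f"
proof (induction k arbitrary: f)
  case 0
  then have "\<forall>x\<in>S. f differentiable (at x)" by simp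
  then have "\<forall>x\<in>S. isCont f x" using differentiable_imp_continuous_within by blast
  then show ?case by (simp add: continuous_at_imp_continuous_on)
next
  case (Suc k)
  from Suc.prems have "\<forall>x\<in>S. f differentiable (at x)"
    and "\<forall>v. ck_on (Suc k) S (\<lambda>x. frechet_derivative f (at x) v)" by auto
  then show ?case using Suc.IH by (subst ck_on.simps) blast
qed

lemma ck_on_const: "ck_on k S (\<lambda>x. c)"
  by (induction k arbitrary: c) auto

lemma ck_on_add:
  assumes "open S" "ck_on k S f" "ck_on k S g"
  shows "ck_on k S (\<lambda>x. f x + g x)"
  using assms(2,3)
proof (induction k arbitrary: f g)
  case (Suc k)
  have "ck_on k S (\<lambda>x. frechet_derivative (\<lambda>x. f x + g x) (at x) v)" for v
  proof (subst ck_on_cong[OF assms(1)])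
    show "frechet_derivative (\<lambda>x. f x + g x) (at x) v
      = frechet_derivative f (at x) v + frechet_derivative g (at x) v" if "x \<in> S" for x
      using Suc.prems that
      by (subst frechet_derivative_at[symmetric, OF has_derivative_add])
         (auto simp: frechet_derivative_works)
  qed (use Suc in auto)
  then show ?case using Suc.prems by auto
qed (auto intro: continuous_intros)

lemma ck_on_bounded_linear:
  assumes "open S" "bounded_linear L" "ck_on k S f"
  shows "ck_on k S (\<lambda>x. L (f x))"
  using assms(3)
proof (induction k arbitrary: f)
  case 0
  then show ?case using assms(2) by (auto intro: bounded_linear.continuous_on)
next
  case (Suc k)
  have d: "((\<lambda>x. L (f x)) has_derivative (\<lambda>v. L (frechet_derivative f (at x) v))) (at x)" if "x \<in> S" for x
    using Suc.prems that by (intro bounded_linear.has_derivative[OF assms(2)]) (auto simp: frechet_derivative_works)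
  have "ck_on k S (\<lambda>x. frechet_derivative (\<lambda>x. L (f x)) (at x) v)" for v
  proof (subst ck_on_cong[OF assms(1)])
    show "frechet_derivative (\<lambda>x. L (f x)) (at x) v = L (frechet_derivative f (at x) v)" if "x \<in> S" for x
      using frechet_derivative_at[OF d[OF that]] by metis
    show "ck_on k S (\<lambda>x. L (frechet_derivative f (at x) v))"
      using Suc.prems by (intro Suc.IH) simp
  qed
  then show ?case using d by (auto simp: differentiable_def)
qed

lemma ck_on_id: "ck_on k S (\<lambda>x. x)"
  by (cases k) (auto intro: continuous_intros ck_on_const)

lemma ck_on_scaleR:
  assumes "open S" "ck_on k S f" "ck_on k S g"
  shows "ck_on k S (\<lambda>x. f x *\<^sub>R g x)"
  using assms(2,3)
proof (induction k arbitrary: f g)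
  case (Suc k)
  have d: "((\<lambda>x. f x *\<^sub>R g x) has_derivative
       (\<lambda>v. f x *\<^sub>R frechet_derivative g (at x) v + frechet_derivative f (at x) v *\<^sub>R g x)) (at x)" if "x \<in> S" for x
    using Suc.prems that by (intro has_derivative_scaleR) (auto simp: frechet_derivative_works)
  \<comment> \<open>In each summand of the product rule one factor is not differentiated; it is
    lowered from order k + 1 to order k to meet the induction hypothesis.\<close>
  have "ck_on k S (\<lambda>x. f x *\<^sub>R frechet_derivative g (at x) v + frechet_derivative f (at x) v *\<^sub>R g x)" for v
    using Suc.prems Suc.prems[THEN ck_on_Suc_imp] by (intro ck_on_add Suc.IH assms(1)) simp_all
  moreover have "frechet_derivative (\<lambda>x. f x *\<^sub>R g x) (at x) v =
      f x *\<^sub>R frechet_derivative g (at x) v + frechet_derivative f (at x) v *\<^sub>R g x" if "x \<in> S" for x v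
    using frechet_derivative_at[OF d[OF that]] by metis
  ultimately have "ck_on k S (\<lambda>x. frechet_derivative (\<lambda>x. f x *\<^sub>R g x) (at x) v)" for v
    using ck_on_cong[OF assms(1)] by (metis (no_types, lifting))
  then show ?case using d by (auto simp: differentiable_def)
qed (auto intro: continuous_intros)

lemma ck_on_sum:
  assumes "open S" "finite I" "\<And>i. i \<in> I \<Longrightarrow> ck_on k S (f i)"
  shows "ck_on k S (\<lambda>x. \<Sum>i\<in>I. f i x)"
  using assms(2,3) by (induction I) (auto intro!: ck_on_const ck_on_add assms(1))

text \<open>By the chain rule g is differentiated in the direction Df(x) v, which moves with x,
  whereas \<open>ck_on\<close> controls fixed directions only. Expanding that direction in the frame
  gives a finite sum of products of C^k maps.\<close>

lemma ck_on_compose: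
  fixes f :: "'d::real_normed_vector \<Rightarrow> 'e::real_inner" and g :: "'e \<Rightarrow> 'f::real_normed_vector"
  assumes "parseval_frame (C::'e set)" "open S" "open T" "f ` S \<subseteq> T" "ck_on k S f" "ck_on k T g"
  shows "ck_on k S (\<lambda>x. g (f x))"
  using assms(5,6)
proof (induction k arbitrary: g)
  case 0
  then show ?case using assms(4) by (simp add: continuous_on_compose2)
next
  case (Suc k)
  have d: "((\<lambda>x. g (f x)) has_derivative
      (\<lambda>v. frechet_derivative g (at (f x)) (frechet_derivative f (at x) v))) (at x)" if "x \<in> S" for x
  proof -
    have "(f has_derivative frechet_derivative f (at x)) (at x)"
      using Suc.prems(1) that by (simp add: frechet_derivative_works)
    moreover have "f x \<in> T" using assms(4) that by blast
    then have "(g has_derivative frechet_derivative g (at (f x))) (at (f x))"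
      using Suc.prems(2) by (simp add: frechet_derivative_works)
    ultimately show ?thesis by (rule has_derivative_compose)
  qed
  have e: "frechet_derivative (\<lambda>x. g (f x)) (at x) v =
     (\<Sum>c\<in>C. (frechet_derivative f (at x) v \<bullet> c) *\<^sub>R frechet_derivative g (at (f x)) c)" if "x \<in> S" for x v
  proof -
    have "linear (frechet_derivative g (at (f x)))"
      using Suc.prems that assms(4) by (intro linear_frechet_derivative) auto
    from linear_parseval_frame[OF assms(1) this] show ?thesis
      using frechet_derivative_at[OF d[OF that]] by metis
  qed
  have "ck_on k S (\<lambda>x. \<Sum>c\<in>C. (frechet_derivative f (at x) v \<bullet> c) *\<^sub>R frechet_derivative g (at (f x)) c)" for v
  proof (intro ck_on_sum ck_on_scaleR assms(2))
    show "finite C" using assms(1) by (simp add: parseval_frame_def)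
    show "ck_on k S (\<lambda>x. frechet_derivative f (at x) v \<bullet> c)" for c
      using Suc.prems by (intro ck_on_bounded_linear[OF assms(2) bounded_linear_inner_left]) auto
    show "ck_on k S (\<lambda>x. frechet_derivative g (at (f x)) c)" for c
      using Suc.prems Suc.prems[THEN ck_on_Suc_imp] by (intro Suc.IH) simp_all
  qed
  then have "ck_on k S (\<lambda>x. frechet_derivative (\<lambda>x. g (f x)) (at x) v)" for v
    by (subst ck_on_cong[OF assms(2) e])
  then show ?case using d by (auto simp: differentiable_def)
qed

section \<open>Symmetry of mixed partial derivatives\<close>

lemma has_field_derivative_along_line:
  fixes f :: "'e::real_normed_vector \<Rightarrow> real"
  assumes "f differentiable (at (a + s *\<^sub>R v))"
  shows "((\<lambda>s. f (a + s *\<^sub>R v)) has_field_derivative frechet_derivative f (at (a + s *\<^sub>R v)) v) (at s)"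
proof (rule has_derivative_imp_has_field_derivative)
  have 1: "((\<lambda>s. a + s *\<^sub>R v) has_derivative (\<lambda>r. r *\<^sub>R v)) (at s)"
    by (auto intro!: derivative_eq_intros)
  have 2: "(f has_derivative frechet_derivative f (at (a + s *\<^sub>R v))) (at (a + s *\<^sub>R v))"
    using assms by (simp add: frechet_derivative_works)
  show "((\<lambda>s. f (a + s *\<^sub>R v)) has_derivative
      (\<lambda>r. frechet_derivative f (at (a + s *\<^sub>R v)) (r *\<^sub>R v))) (at s)"
    by (rule has_derivative_compose[OF 1 2])
  show "r * frechet_derivative f (at (a + s *\<^sub>R v)) v = frechet_derivative f (at (a + s *\<^sub>R v)) (r *\<^sub>R v)" for r
    using linear_frechet_derivative[OF assms] by (simp add: linear_scale)
qed

text \<open>Two applications of the mean value theorem: along v to the difference of f on two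
  parallel sides of the parallelogram, then along w to the derivative of f in direction v.\<close>

lemma second_difference_mean_value:
  fixes f :: "'e::real_normed_vector \<Rightarrow> real"
  assumes "ck_on (Suc (Suc 0)) S f" "h > 0"
    and S: "\<And>s t. 0 \<le> s \<Longrightarrow> s \<le> h \<Longrightarrow> 0 \<le> t \<Longrightarrow> t \<le> h \<Longrightarrow> x + s *\<^sub>R v + t *\<^sub>R w \<in> S"
  obtains s t where "0 \<le> s" "s \<le> h" "0 \<le> t" "t \<le> h"
    "f (x + h *\<^sub>R v + h *\<^sub>R w) - f (x + h *\<^sub>R v) - f (x + h *\<^sub>R w) + f x =
     h * (h * frechet_derivative (\<lambda>y. frechet_derivative f (at y) v) (at (x + s *\<^sub>R v + t *\<^sub>R w)) w)"
proof -
  define Df where "Df = (\<lambda>y. frechet_derivative f (at y) v)"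
  have d1: "f differentiable (at y)" if "y \<in> S" for y using assms(1) that by simp
  have d2: "Df differentiable (at y)" if "y \<in> S" for y using assms(1) that by (simp add: Df_def)
  have "\<exists>s>0. s < h \<and> (f ((x + h *\<^sub>R w) + h *\<^sub>R v) - f (x + h *\<^sub>R v)) - (f ((x + h *\<^sub>R w) + 0 *\<^sub>R v) - f (x + 0 *\<^sub>R v))
     = (h - 0) * (Df ((x + h *\<^sub>R w) + s *\<^sub>R v) - Df (x + s *\<^sub>R v))"
  proof (rule MVT2[OF assms(2)])
    fix s assume s: "0 \<le> s" "s \<le> h"
    have m: "x + h *\<^sub>R w + s *\<^sub>R v \<in> S" "x + s *\<^sub>R v \<in> S"
      using S[OF s, of h] S[OF s, of 0] assms(2) by (auto simp: ac_simps)
    show "((\<lambda>s. f (x + h *\<^sub>R w + s *\<^sub>R v) - f (x + s *\<^sub>R v)) has_real_derivative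
       Df (x + h *\<^sub>R w + s *\<^sub>R v) - Df (x + s *\<^sub>R v)) (at s)"
      unfolding Df_def by (intro DERIV_diff has_field_derivative_along_line d1 m)
  qed
  then obtain s where s: "0 < s" "s < h"
    and e1: "f ((x + h *\<^sub>R w) + h *\<^sub>R v) - f (x + h *\<^sub>R v) - (f (x + h *\<^sub>R w) - f x)
     = h * (Df ((x + h *\<^sub>R w) + s *\<^sub>R v) - Df (x + s *\<^sub>R v))" by auto
  have "\<exists>t>0. t < h \<and> Df (x + s *\<^sub>R v + h *\<^sub>R w) - Df (x + s *\<^sub>R v + 0 *\<^sub>R w) =
     (h - 0) * frechet_derivative Df (at (x + s *\<^sub>R v + t *\<^sub>R w)) w"
    using S[of s] s by (intro MVT2[OF assms(2)] has_field_derivative_along_line d2) auto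
  then obtain t where t: "0 < t" "t < h"
    and e2: "Df (x + s *\<^sub>R v + h *\<^sub>R w) - Df (x + s *\<^sub>R v) =
     h * frechet_derivative Df (at (x + s *\<^sub>R v + t *\<^sub>R w)) w" by auto
  have "f (x + h *\<^sub>R v + h *\<^sub>R w) - f (x + h *\<^sub>R v) - f (x + h *\<^sub>R w) + f x =
     h * (h * frechet_derivative Df (at (x + s *\<^sub>R v + t *\<^sub>R w)) w)"
    using e1 unfolding e2[symmetric] by (simp add: ac_simps)
  with s t show ?thesis unfolding Df_def by (intro that[of s t]) auto
qed

text \<open>The second difference is symmetric in v and w. Evaluating it in both orders makes a
  value of P near x equal to a value of Q near x, and continuity of both then forbids P x and Q x to
  differ.\<close>

lemma frechet_derivative_commute:
  fixes f :: "'e::real_normed_vector \<Rightarrow> real"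
  assumes "ck_on (Suc (Suc 0)) S f" "open S" "x \<in> S"
  shows "frechet_derivative (\<lambda>y. frechet_derivative f (at y) v) (at x) w =
         frechet_derivative (\<lambda>y. frechet_derivative f (at y) w) (at x) v"
proof (rule ccontr)
  define P where "P = (\<lambda>x. frechet_derivative (\<lambda>y. frechet_derivative f (at y) v) (at x) w)"
  define Q where "Q = (\<lambda>x. frechet_derivative (\<lambda>y. frechet_derivative f (at y) w) (at x) v)"
  assume "\<not> ?thesis"
  then have ne: "\<bar>P x - Q x\<bar> > 0" by (simp add: P_def Q_def)
  \<comment> \<open>Half of the supposed gap: two errors smaller than this cannot close it.\<close>
  define e where "e = \<bar>P x - Q x\<bar> / 2"
  have e: "e > 0" using ne by (simp add: e_def)
  have "continuous_on S P" "continuous_on S Q" using assms(1) by (auto simp: P_def Q_def)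
  then have "isCont P x" "isCont Q x" using assms continuous_on_eq_continuous_at by blast+
  then obtain d1 d2 where d: "d1 > 0" "\<And>y. dist y x < d1 \<Longrightarrow> dist (P y) (P x) < e"
    "d2 > 0" "\<And>y. dist y x < d2 \<Longrightarrow> dist (Q y) (Q x) < e"
    using e unfolding continuous_at_eps_delta by metis
  obtain d3 where d3: "d3 > 0" "ball x d3 \<subseteq> S" using assms open_contains_ball by blast
  define d where "d = Min {d1,d2,d3}"
  have dpos: "d > 0" using d d3 by (simp add: d_def)
  \<comment> \<open>The summand 1 keeps N positive when v = w = 0. With h = d / (2 N), a
    parallelogram with sides h v and h w at x stays within distance d of x.\<close>
  define N where "N = norm v + norm w + 1"
  define h where "h = d / (2 * N)"
  have den: "N > 0" by (simp add: N_def add_nonneg_pos)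
  have h: "h > 0" using dpos den by (simp add: h_def)
  have "h * N = d / 2" using den by (simp add: h_def)
  then have "h * norm v + h * norm w + h = d / 2" by (simp add: N_def distrib_left)
  then have hh: "h * norm v + h * norm w < d" using h dpos by linarith
  have near: "dist (x + s *\<^sub>R v + t *\<^sub>R w) x < d" if "0 \<le> s" "s \<le> h" "0 \<le> t" "t \<le> h" for s t
  proof -
    have "dist (x + s *\<^sub>R v + t *\<^sub>R w) x \<le> s * norm v + t * norm w"
      using norm_triangle_ineq[of "s *\<^sub>R v" "t *\<^sub>R w"] that by (simp add: dist_norm add.assoc)
    also have "\<dots> \<le> h * norm v + h * norm w" using that by (intro add_mono mult_right_mono) auto
    finally show ?thesis using hh by simp
  qed
  then have inS: "x + s *\<^sub>R v + t *\<^sub>R w \<in> S" if "0 \<le> s" "s \<le> h" "0 \<le> t" "t \<le> h" for s t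
    using that d3 by (force simp: d_def dist_commute)
  obtain s t where st: "0 \<le> s" "s \<le> h" "0 \<le> t" "t \<le> h"
    "f (x + h *\<^sub>R v + h *\<^sub>R w) - f (x + h *\<^sub>R v) - f (x + h *\<^sub>R w) + f x = h * (h * P (x + s *\<^sub>R v + t *\<^sub>R w))"
    unfolding P_def by (rule second_difference_mean_value[OF assms(1) h inS]) blast+
  have inS': "x + s *\<^sub>R w + t *\<^sub>R v \<in> S" if "0 \<le> s" "s \<le> h" "0 \<le> t" "t \<le> h" for s t
    using inS[of t s] that by (simp add: ac_simps)
  obtain t' s' where st': "0 \<le> s'" "s' \<le> h" "0 \<le> t'" "t' \<le> h"
    "f (x + h *\<^sub>R w + h *\<^sub>R v) - f (x + h *\<^sub>R w) - f (x + h *\<^sub>R v) + f x = h * (h * Q (x + t' *\<^sub>R w + s' *\<^sub>R v))"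
    unfolding Q_def by (rule second_difference_mean_value[OF assms(1) h inS']) blast+
  have "h * (h * P (x + s *\<^sub>R v + t *\<^sub>R w)) = h * (h * Q (x + s' *\<^sub>R v + t' *\<^sub>R w))"
  proof -
    have "x + h *\<^sub>R w + h *\<^sub>R v = x + h *\<^sub>R v + h *\<^sub>R w"
      "x + t' *\<^sub>R w + s' *\<^sub>R v = x + s' *\<^sub>R v + t' *\<^sub>R w" by simp_all
    note eqs = this
    show ?thesis using st(5) st'(5) unfolding eqs by linarith
  qed
  then have "P (x + s *\<^sub>R v + t *\<^sub>R w) = Q (x + s' *\<^sub>R v + t' *\<^sub>R w)" using h by simp
  moreover have "dist (P (x + s *\<^sub>R v + t *\<^sub>R w)) (P x) < e"
    using near[OF st(1-4)] by (intro d) (simp add: d_def)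
  moreover have "dist (Q (x + s' *\<^sub>R v + t' *\<^sub>R w)) (Q x) < e"
    using near[OF st'(1-4)] by (intro d) (simp add: d_def)
  ultimately show False using ne unfolding e_def dist_real_def by (smt (verit) field_sum_of_halves)
qed

section \<open>Smoothness at a point\<close>

definition smooth_at :: "('e::real_normed_vector \<Rightarrow> 'f::real_normed_vector) \<Rightarrow> 'e \<Rightarrow> bool" where
  "smooth_at f x \<longleftrightarrow> (\<exists>S. open S \<and> x \<in> S \<and> smooth_on S f)"

lemma smooth_on_subset: "smooth_on S f \<Longrightarrow> T \<subseteq> S \<Longrightarrow> smooth_on T f"
  by (auto simp: smooth_on_def intro: ck_on_subset)

lemma smooth_on_iff_smooth_at:
  assumes "open S"
  shows "smooth_on S f \<longleftrightarrow> (\<forall>x\<in>S. smooth_at f x)"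
proof
  assume *: "\<forall>x\<in>S. smooth_at f x"
  show "smooth_on S f" unfolding smooth_on_def
  proof (intro allI ck_on_open_local)
    show "\<exists>T. open T \<and> x \<in> T \<and> ck_on k T f" if "x \<in> S" for x k
      using * that unfolding smooth_at_def smooth_on_def by fast
  qed
qed (use assms in \<open>auto simp: smooth_at_def\<close>)

lemma smooth_at_open_nhd:
  assumes "smooth_at f x"
  obtains S where "open S" "x \<in> S" "\<And>y. y \<in> S \<Longrightarrow> smooth_at f y"
proof -
  obtain S where "open S" "x \<in> S" "smooth_on S f" using assms smooth_at_def by blast
  then show ?thesis using that[of S] smooth_at_def by blast
qed

lemma smooth_at_cong_imp:
  assumes "smooth_at f x" "open S" "x \<in> S" "\<And>y. y \<in> S \<Longrightarrow> f y = g y"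
  shows "smooth_at g x"
proof -
  obtain T where T: "open T" "x \<in> T" "smooth_on T f" using assms(1) smooth_at_def by blast
  have "smooth_on (S \<inter> T) f" using T(3) by (rule smooth_on_subset) auto
  then have "smooth_on (S \<inter> T) g"
    unfolding smooth_on_def using ck_on_cong[of "S \<inter> T" f g] T(1) assms by auto
  then show ?thesis using T assms smooth_at_def by (metis IntI open_Int)
qed

lemma smooth_at_imp_differentiable: "smooth_at f x \<Longrightarrow> f differentiable (at x)"
  unfolding smooth_at_def smooth_on_def using ck_on.simps(2)[of 0] by blast

lemma smooth_at_has_derivative: "smooth_at f x \<Longrightarrow> (f has_derivative frechet_derivative f (at x)) (at x)"
  using smooth_at_imp_differentiable frechet_derivative_works by blast

lemma smooth_at_const [simp]: "smooth_at (\<lambda>x. c) x"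
  unfolding smooth_at_def smooth_on_def using ck_on_const by blast

lemma smooth_at_id [simp]: "smooth_at (\<lambda>x. x) x"
  unfolding smooth_at_def smooth_on_def using ck_on_id by blast

text \<open>Passes a closure rule for C^k maps on open sets to germs by intersecting the two
  neighbourhoods. Unary rules are the case f = g.\<close>

lemma smooth_at_binop:
  assumes "\<And>S k. open S \<Longrightarrow> ck_on k S f \<Longrightarrow> ck_on k S g \<Longrightarrow> ck_on k S h"
    and "smooth_at f x" "smooth_at g x"
  shows "smooth_at h x"
proof -
  obtain S T where "open S" "x \<in> S" "smooth_on S f" "open T" "x \<in> T" "smooth_on T g"
    using assms(2,3) smooth_at_def by metis
  then have "smooth_on (S \<inter> T) h"
    unfolding smooth_on_def by (metis assms(1) ck_on_subset inf_le1 inf_le2 open_Int)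
  then show ?thesis using \<open>open S\<close> \<open>x \<in> S\<close> \<open>open T\<close> \<open>x \<in> T\<close> smooth_at_def by (metis IntI open_Int)
qed

lemma smooth_at_add: "smooth_at f x \<Longrightarrow> smooth_at g x \<Longrightarrow> smooth_at (\<lambda>x. f x + g x) x"
  by (rule smooth_at_binop[of f g]) (auto intro: ck_on_add)

lemma smooth_at_scaleR: "smooth_at f x \<Longrightarrow> smooth_at g x \<Longrightarrow> smooth_at (\<lambda>x. f x *\<^sub>R g x) x"
  by (rule smooth_at_binop[of f g]) (auto intro: ck_on_scaleR)

lemma smooth_at_bounded_linear: "bounded_linear L \<Longrightarrow> smooth_at f x \<Longrightarrow> smooth_at (\<lambda>x. L (f x)) x"
  by (rule smooth_at_binop[of f f]) (rule ck_on_bounded_linear)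

lemma smooth_at_sum:
  "finite I \<Longrightarrow> (\<And>i. i \<in> I \<Longrightarrow> smooth_at (f i) x) \<Longrightarrow> smooth_at (\<lambda>x. \<Sum>i\<in>I. f i x) x"
  by (induction I rule: finite_induct) (auto intro!: smooth_at_add)

text \<open>The pair is the sum of (f, 0) and (0, g), two images under bounded linear maps.\<close>

lemma smooth_at_Pair:
  assumes "smooth_at f x" "smooth_at g x"
  shows "smooth_at (\<lambda>x. (f x, g x)) x"
proof -
  have 1: "bounded_linear (\<lambda>a::'b. (a, 0::'c))" and 2: "bounded_linear (\<lambda>a::'c. (0::'b, a))"
    by (rule bounded_linear_Pair bounded_linear_ident bounded_linear_zero)+
  have "smooth_at (\<lambda>x. (f x, 0) + (0, g x)) x"
    using smooth_at_add[OF smooth_at_bounded_linear[OF 1 assms(1)] smooth_at_bounded_linear[OF 2 assms(2)]] .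
  then show ?thesis by simp
qed

lemma smooth_at_compose:
  fixes f :: "'d::real_normed_vector \<Rightarrow> 'e::real_inner" and g :: "'e \<Rightarrow> 'f::real_normed_vector"
  assumes "parseval_frame (C::'e set)" "smooth_at f x" "smooth_at g (f x)"
  shows "smooth_at (\<lambda>x. g (f x)) x"
proof -
  obtain S T where S: "open S" "x \<in> S" "smooth_on S f" and T: "open T" "f x \<in> T" "smooth_on T g"
    using assms(2,3) smooth_at_def by metis
  have "continuous_on S f" using S(3) unfolding smooth_on_def by (metis ck_on.simps(1))
  then have o: "open (S \<inter> f -` T)" using S T continuous_on_open_vimage by (metis inf_commute)
  have "smooth_on (S \<inter> f -` T) f" using S(3) by (rule smooth_on_subset) auto
  then have "smooth_on (S \<inter> f -` T) (\<lambda>x. g (f x))"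
    using T unfolding smooth_on_def by (auto intro: ck_on_compose[OF assms(1) o T(1)])
  then show ?thesis using o S T by (auto simp: smooth_at_def)
qed

text \<open>In \<open>smooth_at\<close> one neighbourhood serves all orders, so shifting the order
  by one stays on the same neighbourhood.\<close>

lemma smooth_at_frechet_derivative_const:
  assumes "smooth_at f x"
  shows "smooth_at (\<lambda>x. frechet_derivative f (at x) v) x"
proof -
  obtain S where S: "open S" "x \<in> S" "\<And>k. ck_on (Suc k) S f"
    using assms unfolding smooth_at_def smooth_on_def by blast
  then have "\<And>k. ck_on k S (\<lambda>x. frechet_derivative f (at x) v)" by simp
  with S show ?thesis unfolding smooth_at_def smooth_on_def by blast
qed

text \<open>The direction may vary with the point, as it does for a vector field in a chart; its
  frame coordinates reduce this to fixed directions.\<close>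

lemma smooth_at_frechet_derivative:
  fixes f :: "'e::real_inner \<Rightarrow> 'f::real_normed_vector"
  assumes C: "parseval_frame (C::'e set)" and f: "smooth_at f x" and w: "smooth_at w x"
  shows "smooth_at (\<lambda>x. frechet_derivative f (at x) (w x)) x"
proof -
  obtain S where S: "open S" "x \<in> S" "\<And>y. y \<in> S \<Longrightarrow> smooth_at f y"
    using smooth_at_open_nhd[OF f] by blast
  have "smooth_at (\<lambda>x. \<Sum>c\<in>C. (w x \<bullet> c) *\<^sub>R frechet_derivative f (at x) c) x"
    using C by (intro smooth_at_sum smooth_at_scaleR smooth_at_frechet_derivative_const f
      smooth_at_bounded_linear[OF bounded_linear_inner_left w]) (simp add: parseval_frame_def)
  then show ?thesis
  proof (rule smooth_at_cong_imp[OF _ S(1,2)])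
    fix y assume "y \<in> S"
    then have "linear (frechet_derivative f (at y))"
      using S(3) smooth_at_imp_differentiable linear_frechet_derivative by blast
    then show "(\<Sum>c\<in>C. (w y \<bullet> c) *\<^sub>R frechet_derivative f (at y) c) = frechet_derivative f (at y) (w y)"
      by (rule linear_parseval_frame[OF C, symmetric])
  qed
qed

lemma frechet_derivative_commute_smooth_at:
  fixes f :: "'e::real_normed_vector \<Rightarrow> real"
  assumes "smooth_at f x"
  shows "frechet_derivative (\<lambda>y. frechet_derivative f (at y) v) (at x) w =
         frechet_derivative (\<lambda>y. frechet_derivative f (at y) w) (at x) v"
proof -
  obtain S where "open S" "x \<in> S" "ck_on (Suc (Suc 0)) S f"
    using assms unfolding smooth_at_def smooth_on_def by blast
  then show ?thesis using frechet_derivative_commute by blast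
qed

section \<open>Smooth functions and maps in charts\<close>

lemma parseval_frame_span: "parseval_frame C \<Longrightarrow> span C = UNIV"
proof -
  assume C: "parseval_frame C"
  have "(\<Sum>c\<in>C. (v \<bullet> c) *\<^sub>R c) \<in> span C" for v
    by (intro span_sum span_scale span_base)
  then show ?thesis using C unfolding parseval_frame_def by (metis UNIV_eq_I)
qed

lemma smooth_manifold_frame:
  fixes A :: "('g::{t2_space,second_countable_topology}, 'e::real_inner) atlas"
  assumes "smooth_manifold A"
  obtains C :: "'e set" where "parseval_frame C"
proof -
  obtain B :: "'e set" where "finite B" "span B = UNIV"
    using assms unfolding smooth_manifold_def by blast
  then show ?thesis using parseval_frame_exists[of B] that by blast
qed

lemma smooth_manifold_chart:
  fixes A :: "('g::{t2_space,second_countable_topology}, 'e::real_inner) atlas"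
  assumes "smooth_manifold A" "(U, \<phi>) \<in> A"
  shows "open U" "open (\<phi> ` U)" "continuous_on U \<phi>" "continuous_on (\<phi> ` U) (inv_into U \<phi>)"
    "p \<in> U \<Longrightarrow> inv_into U \<phi> (\<phi> p) = p" "inj_on \<phi> U"
proof -
  have *: "open U" "open (\<phi> ` U)" "homeomorphism U (\<phi> ` U) \<phi> (inv_into U \<phi>)"
    using assms unfolding smooth_manifold_def by auto
  then show "open U" "open (\<phi> ` U)" "continuous_on U \<phi>" "continuous_on (\<phi> ` U) (inv_into U \<phi>)"
    "p \<in> U \<Longrightarrow> inv_into U \<phi> (\<phi> p) = p"
    by (simp_all add: homeomorphism_def)
  show "inj_on \<phi> U" by (rule inj_on_inverseI[where g="inv_into U \<phi>"]) (use *(3) in \<open>simp add: homeomorphism_def\<close>)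
qed

lemma smooth_manifold_chart_at:
  assumes "smooth_manifold A"
  obtains U \<phi> where "(U, \<phi>) \<in> A" "p \<in> U"
proof -
  have "\<exists>(U, \<phi>)\<in>A. p \<in> U" using assms unfolding smooth_manifold_def by blast
  then show ?thesis using that by blast
qed

lemma open_chart_image:
  assumes "smooth_manifold A" "(U, \<phi>) \<in> A" "open W"
  shows "open (\<phi> ` (U \<inter> W))"
proof -
  note c = smooth_manifold_chart[OF assms(1,2)]
  have "\<phi> ` (U \<inter> W) = inv_into U \<phi> -` W \<inter> \<phi> ` U"
    using c(5) by auto
  then show ?thesis using c assms(3) by (simp add: continuous_on_open_vimage)
qed

lemma open_chart_vimage:
  assumes "smooth_manifold A" "(U, \<phi>) \<in> A" "open S"
  shows "open (U \<inter> \<phi> -` S)"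
  using smooth_manifold_chart[OF assms(1,2)] assms(3) by (metis continuous_on_open_vimage inf_commute)

lemma smooth_manifold_transition:
  assumes "smooth_manifold A" "(U, \<phi>) \<in> A" "(V, \<psi>) \<in> A" "p \<in> U" "p \<in> V"
  shows "smooth_at (\<psi> \<circ> inv_into U \<phi>) (\<phi> p)"
proof -
  have "smooth_on (\<phi> ` (U \<inter> V)) (\<psi> \<circ> inv_into U \<phi>)"
    using assms(1-3) unfolding smooth_manifold_def by fast
  moreover have "open (\<phi> ` (U \<inter> V))"
    using open_chart_image[OF assms(1,2)] smooth_manifold_chart(1)[OF assms(1,3)] .
  ultimately show ?thesis using assms(4,5) unfolding smooth_at_def by blast
qed

text \<open>Transition maps are smooth, so a representative that is smooth in one chart is smooth in
  all others over a common neighbourhood. This reduces every later smoothness question to a single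
  chart.\<close>

lemma smooth_near_chart:
  fixes A :: "('g::{t2_space,second_countable_topology}, 'e::real_inner) atlas"
  assumes M: "smooth_manifold A" and c: "(U, \<phi>) \<in> A" "p \<in> U"
  shows "smooth_near A p f \<longleftrightarrow> smooth_at (f \<circ> inv_into U \<phi>) (\<phi> p)"
proof
  assume "smooth_near A p f"
  then obtain W where W: "open W" "p \<in> W" "smooth_fun_on A W f" unfolding smooth_near_def by blast
  then have "smooth_on (\<phi> ` (U \<inter> W)) (f \<circ> inv_into U \<phi>)"
    using c(1) unfolding smooth_fun_on_def by blast
  then show "smooth_at (f \<circ> inv_into U \<phi>) (\<phi> p)"
    using open_chart_image[OF M c(1) W(1)] c(2) W(2) unfolding smooth_at_def by blast
next
  assume "smooth_at (f \<circ> inv_into U \<phi>) (\<phi> p)"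
  then obtain S where S: "open S" "\<phi> p \<in> S" "\<And>y. y \<in> S \<Longrightarrow> smooth_at (f \<circ> inv_into U \<phi>) y"
    using smooth_at_open_nhd by blast
  obtain C :: "'e set" where C: "parseval_frame C" using smooth_manifold_frame[OF M] .
  \<comment> \<open>The part of the manifold that the chart sends into S; each of its points has a
    smooth representative in the chart U.\<close>
  define W where "W = U \<inter> \<phi> -` S"
  have oW: "open W" unfolding W_def by (rule open_chart_vimage[OF M c(1) S(1)])
  have "smooth_fun_on A W f"
    unfolding smooth_fun_on_def
  proof clarify
    fix V \<psi> assume V: "(V, \<psi>) \<in> A"
    note cV = smooth_manifold_chart[OF M V]
    have o: "open (\<psi> ` (V \<inter> W))" by (rule open_chart_image[OF M V oW])
    have "smooth_at (f \<circ> inv_into V \<psi>) y" if y: "y \<in> \<psi> ` (V \<inter> W)" for y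
    proof -
      obtain q where q: "q \<in> V" "q \<in> U" "\<phi> q \<in> S" "y = \<psi> q" using y unfolding W_def by blast
      have 1: "smooth_at (\<phi> \<circ> inv_into V \<psi>) (\<psi> q)"
        by (rule smooth_manifold_transition[OF M V c(1) q(1,2)])
      have 2: "smooth_at (f \<circ> inv_into U \<phi>) ((\<phi> \<circ> inv_into V \<psi>) (\<psi> q))"
        using S(3) q cV(5) by simp
      have "smooth_at (\<lambda>x. (f \<circ> inv_into U \<phi>) ((\<phi> \<circ> inv_into V \<psi>) x)) (\<psi> q)"
        by (rule smooth_at_compose[OF C 1 2])
      then have "smooth_at (f \<circ> inv_into V \<psi>) (\<psi> q)"
      proof (rule smooth_at_cong_imp[OF _ o])
        show "\<psi> q \<in> \<psi> ` (V \<inter> W)" using y q by simp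
        fix z assume "z \<in> \<psi> ` (V \<inter> W)"
        then obtain r where "r \<in> V" "r \<in> U" "z = \<psi> r" unfolding W_def by blast
        then show "(f \<circ> inv_into U \<phi>) ((\<phi> \<circ> inv_into V \<psi>) z) = (f \<circ> inv_into V \<psi>) z"
          using cV(5) smooth_manifold_chart(5)[OF M c(1)] by simp
      qed
      then show ?thesis using q by simp
    qed
    then show "smooth_on (\<psi> ` (V \<inter> W)) (f \<circ> inv_into V \<psi>)"
      using smooth_on_iff_smooth_at[OF o] by blast
  qed
  then show "smooth_near A p f" unfolding smooth_near_def using oW c(2) S(2) W_def by blast
qed

lemma smooth_fun_on_imp_smooth_near: "open W \<Longrightarrow> smooth_fun_on A W f \<Longrightarrow> p \<in> W \<Longrightarrow> smooth_near A p f"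
  unfolding smooth_near_def by blast

lemma smooth_fun_on_iff_smooth_near:
  assumes M: "smooth_manifold A" and W: "open W"
  shows "smooth_fun_on A W f \<longleftrightarrow> (\<forall>p\<in>W. smooth_near A p f)"
proof
  assume n: "\<forall>p\<in>W. smooth_near A p f"
  show "smooth_fun_on A W f" unfolding smooth_fun_on_def
  proof clarify
    fix U \<phi> assume U: "(U, \<phi>) \<in> A"
    have "smooth_at (f \<circ> inv_into U \<phi>) (\<phi> p)" if "p \<in> U" "p \<in> W" for p
      using n that smooth_near_chart[OF M U] by blast
    then show "smooth_on (\<phi> ` (U \<inter> W)) (f \<circ> inv_into U \<phi>)"
      using smooth_on_iff_smooth_at[OF open_chart_image[OF M U W]] by blast
  qed
qed (use W smooth_fun_on_imp_smooth_near in blast)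

lemma smooth_funs_iff_smooth_near:
  "smooth_manifold A \<Longrightarrow> f \<in> smooth_funs A \<longleftrightarrow> (\<forall>p. smooth_near A p f)"
  by (simp add: smooth_funs_def smooth_fun_on_iff_smooth_near)

lemma smooth_near_open_nhd:
  assumes "smooth_near A p f"
  obtains W where "open W" "p \<in> W" "\<And>q. q \<in> W \<Longrightarrow> smooth_near A q f"
proof -
  obtain W where "open W" "p \<in> W" "smooth_fun_on A W f" using assms unfolding smooth_near_def by blast
  then show ?thesis using that[of W] smooth_fun_on_imp_smooth_near by blast
qed

lemma smooth_near_cong_imp:
  assumes M: "smooth_manifold A" and f: "smooth_near A p f" and W: "open W" "p \<in> W"
    and eq: "\<And>q. q \<in> W \<Longrightarrow> f q = g q"
  shows "smooth_near A p g"
proof -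
  obtain U \<phi> where c: "(U, \<phi>) \<in> A" "p \<in> U" using smooth_manifold_chart_at[OF M] .
  note cU = smooth_manifold_chart[OF M c(1)]
  have "smooth_at (f \<circ> inv_into U \<phi>) (\<phi> p)" using f smooth_near_chart[OF M c] by blast
  then have "smooth_at (g \<circ> inv_into U \<phi>) (\<phi> p)"
  proof (rule smooth_at_cong_imp[OF _ open_chart_image[OF M c(1) W(1)]])
    show "\<phi> p \<in> \<phi> ` (U \<inter> W)" using c W by blast
    show "(f \<circ> inv_into U \<phi>) y = (g \<circ> inv_into U \<phi>) y" if y: "y \<in> \<phi> ` (U \<inter> W)" for y
      using y eq cU(5) by auto
  qed
  then show ?thesis using smooth_near_chart[OF M c] by blast
qed

lemma smooth_near_const: "smooth_manifold A \<Longrightarrow> smooth_near A p (\<lambda>x. k)"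
  by (rule smooth_manifold_chart_at[of A p], assumption) (simp add: smooth_near_chart o_def)

lemma smooth_near_add:
  assumes M: "smooth_manifold A" and "smooth_near A p f" "smooth_near A p g"
  shows "smooth_near A p (\<lambda>x. f x + g x)"
proof -
  obtain U \<phi> where c: "(U, \<phi>) \<in> A" "p \<in> U" using smooth_manifold_chart_at[OF M] .
  show ?thesis using assms smooth_at_add unfolding smooth_near_chart[OF M c] o_def by blast
qed

lemma smooth_near_mult:
  assumes M: "smooth_manifold A" and "smooth_near A p f" "smooth_near A p g"
  shows "smooth_near A p (\<lambda>x. f x * g x)"
proof -
  obtain U \<phi> where c: "(U, \<phi>) \<in> A" "p \<in> U" using smooth_manifold_chart_at[OF M] .
  show ?thesis using assms smooth_at_scaleR[where 'b=real]
    unfolding smooth_near_chart[OF M c] o_def real_scaleR_def by blast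
qed

lemma smooth_near_sum:
  assumes M: "smooth_manifold A" and "finite I" and "\<And>i. i \<in> I \<Longrightarrow> smooth_near A p (f i)"
  shows "smooth_near A p (\<lambda>x. \<Sum>i\<in>I. f i x)"
  using assms(2,3)
  by (induction I rule: finite_induct) (simp_all add: smooth_near_const[OF M] smooth_near_add[OF M])

text \<open>Chart coordinates serve as test functions. The values of \<open>\<phi>\<close> outside U
  are arbitrary, but smoothness near p looks only inside the open set U.\<close>

lemma smooth_near_coordinate:
  assumes M: "smooth_manifold A" and c: "(U, \<phi>) \<in> A" "p \<in> U" and L: "bounded_linear (L :: _ \<Rightarrow> real)"
  shows "smooth_near A p (\<lambda>q. L (\<phi> q))"
proof -
  have "smooth_at (\<lambda>x. L x) (\<phi> p)" by (rule smooth_at_bounded_linear[OF L smooth_at_id])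
  then have "smooth_at ((\<lambda>q. L (\<phi> q)) \<circ> inv_into U \<phi>) (\<phi> p)"
    by (rule smooth_at_cong_imp[OF _ smooth_manifold_chart(2)[OF M c(1)]])
      (use c smooth_manifold_chart(5)[OF M c(1)] in auto)
  then show ?thesis using smooth_near_chart[OF M c] by blast
qed

definition smooth_map_at ::
  "('g::t2_space, 'e::real_inner) atlas \<Rightarrow> ('h::t2_space, 'f::real_inner) atlas
    \<Rightarrow> ('g \<Rightarrow> 'h) \<Rightarrow> 'g \<Rightarrow> bool" where
  "smooth_map_at A B F p \<longleftrightarrow> isCont F p \<and> (\<forall>f. smooth_near B (F p) f \<longrightarrow> smooth_near A p (\<lambda>q. f (F q)))"

lemma smooth_map_atD: "smooth_map_at A B F p \<Longrightarrow> smooth_near B (F p) f \<Longrightarrow> smooth_near A p (\<lambda>q. f (F q))"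
  unfolding smooth_map_at_def by blast

text \<open>Immediate because \<open>smooth_map_at\<close> is encoded by pulling back smooth
  functions, without charts. The passage to and from chart expressions is made in
  \<open>smooth_map_at_chart\<close> and \<open>smooth_map_at_chartI\<close>.\<close>

lemma smooth_map_at_compose:
  "smooth_map_at A B F p \<Longrightarrow> smooth_map_at B C G (F p) \<Longrightarrow> smooth_map_at A C (\<lambda>q. G (F q)) p"
  unfolding smooth_map_at_def using isCont_o2 by blast

lemma smooth_map_at_id: "smooth_map_at A A (\<lambda>q. q) p"
  by (simp add: smooth_map_at_def)

lemma smooth_map_at_const: "smooth_manifold A \<Longrightarrow> smooth_map_at A B (\<lambda>q. k) p"
  by (simp add: smooth_map_at_def smooth_near_const)

lemma isCont_open_nhd:
  assumes "isCont F p" "open W" "F p \<in> W"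
  obtains V where "open V" "p \<in> V" "\<And>q. q \<in> V \<Longrightarrow> F q \<in> W"
proof -
  obtain V where "open V" "p \<in> V" "\<forall>q\<in>V. F q \<in> W"
    using assms continuous_at_open[of p F] by metis
  then show ?thesis using that[of V] by blast
qed

text \<open>Each frame coordinate of the chart expression is the pull-back of a coordinate function
  on the target, and the expression is rebuilt from these finitely many coordinates.\<close>

lemma smooth_map_at_chart:
  fixes A :: "('g::{t2_space,second_countable_topology}, 'e::real_inner) atlas"
    and B :: "('h::{t2_space,second_countable_topology}, 'f::real_inner) atlas"
  assumes M: "smooth_manifold A" and N: "smooth_manifold B" and F: "smooth_map_at A B F p"
    and c: "(U, \<phi>) \<in> A" "p \<in> U" and d: "(V, \<psi>) \<in> B" "F p \<in> V"
  shows "smooth_at (\<lambda>x. \<psi> (F (inv_into U \<phi> x))) (\<phi> p)"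
proof -
  obtain C :: "'f set" where C: "parseval_frame C" using smooth_manifold_frame[OF N] .
  have "smooth_at (\<lambda>x. \<Sum>c\<in>C. (\<psi> (F (inv_into U \<phi> x)) \<bullet> c) *\<^sub>R c) (\<phi> p)"
  proof (intro smooth_at_sum smooth_at_scaleR smooth_at_const)
    show "finite C" using C by (simp add: parseval_frame_def)
    fix c
    have "smooth_near A p (\<lambda>q. \<psi> (F q) \<bullet> c)"
      by (rule smooth_map_atD[OF F smooth_near_coordinate[OF N d bounded_linear_inner_left]])
    then show "smooth_at (\<lambda>x. \<psi> (F (inv_into U \<phi> x)) \<bullet> c) (\<phi> p)"
      unfolding smooth_near_chart[OF M c] o_def .
  qed
  moreover have "(\<Sum>c\<in>C. (v \<bullet> c) *\<^sub>R c) = v" for v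
    using C unfolding parseval_frame_def by simp
  ultimately show ?thesis by simp
qed

text \<open>One pair of charts suffices: a test function on the target is composed, in those charts,
  with the smooth expression of F, after shrinking to a neighbourhood that F maps into V.\<close>

lemma smooth_map_at_chartI:
  fixes A :: "('g::{t2_space,second_countable_topology}, 'e::real_inner) atlas"
    and B :: "('h::{t2_space,second_countable_topology}, 'f::real_inner) atlas"
  assumes M: "smooth_manifold A" and N: "smooth_manifold B" and F: "isCont F p"
    and c: "(U, \<phi>) \<in> A" "p \<in> U" and d: "(V, \<psi>) \<in> B" "F p \<in> V"
    and s: "smooth_at (\<lambda>x. \<psi> (F (inv_into U \<phi> x))) (\<phi> p)"
  shows "smooth_map_at A B F p"
  unfolding smooth_map_at_def
proof (intro conjI allI impI F)
  fix f assume f: "smooth_near B (F p) f"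
  obtain C :: "'f set" where C: "parseval_frame C" using smooth_manifold_frame[OF N] .
  obtain W where W: "open W" "p \<in> W" "\<And>q. q \<in> W \<Longrightarrow> F q \<in> V"
    using isCont_open_nhd[OF F smooth_manifold_chart(1)[OF N d(1)] d(2)] by blast
  have "smooth_at (f \<circ> inv_into V \<psi>) (\<psi> (F (inv_into U \<phi> (\<phi> p))))"
    using f smooth_near_chart[OF N d] smooth_manifold_chart(5)[OF M c] by simp
  then have "smooth_at (\<lambda>x. (f \<circ> inv_into V \<psi>) (\<psi> (F (inv_into U \<phi> x)))) (\<phi> p)"
    by (rule smooth_at_compose[OF C s])
  then have "smooth_at ((\<lambda>q. f (F q)) \<circ> inv_into U \<phi>) (\<phi> p)"
  proof (rule smooth_at_cong_imp[OF _ open_chart_image[OF M c(1) W(1)]])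
    show "\<phi> p \<in> \<phi> ` (U \<inter> W)" using c W by blast
    fix y assume "y \<in> \<phi> ` (U \<inter> W)"
    then obtain q where "q \<in> U" "q \<in> W" "y = \<phi> q" by blast
    then show "(f \<circ> inv_into V \<psi>) (\<psi> (F (inv_into U \<phi> y))) = ((\<lambda>q. f (F q)) \<circ> inv_into U \<phi>) y"
      using W(3) smooth_manifold_chart(5)[OF M c(1)] smooth_manifold_chart(5)[OF N d(1)] by simp
  qed
  then show "smooth_near A p (\<lambda>q. f (F q))" using smooth_near_chart[OF M c] by blast
qed

lemma smooth_map_imp_smooth_map_at:
  assumes M: "smooth_manifold A" and N: "smooth_manifold B" and F: "smooth_map A B F"
  shows "smooth_map_at A B F p"
proof -
  have cont: "isCont F p" using F unfolding smooth_map_def by (simp add: continuous_on_eq_continuous_at)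
  obtain U \<phi> where c: "(U, \<phi>) \<in> A" "p \<in> U" using smooth_manifold_chart_at[OF M] .
  obtain V \<psi> where d: "(V, \<psi>) \<in> B" "F p \<in> V" using smooth_manifold_chart_at[OF N] .
  have "open (F -` V)"
    using F smooth_manifold_chart(1)[OF N d(1)] unfolding smooth_map_def
    by (simp add: continuous_on_open_vimage[OF open_UNIV])
  then have "open (\<phi> ` (U \<inter> F -` V))" by (rule open_chart_image[OF M c(1)])
  moreover have "smooth_on (\<phi> ` (U \<inter> F -` V)) (\<psi> \<circ> F \<circ> inv_into U \<phi>)"
    using F c(1) d(1) unfolding smooth_map_def by fast
  moreover have "\<phi> p \<in> \<phi> ` (U \<inter> F -` V)" using c d by blast
  ultimately have "smooth_at (\<psi> \<circ> F \<circ> inv_into U \<phi>) (\<phi> p)" unfolding smooth_at_def by blast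
  then show ?thesis by (intro smooth_map_at_chartI[OF M N cont c d]) (simp add: o_def)
qed

lemma inv_into_map_prod:
  assumes "inj_on \<phi> U" "inj_on \<psi> V" "p \<in> U" "q \<in> V"
  shows "inv_into (U \<times> V) (map_prod \<phi> \<psi>) (\<phi> p, \<psi> q) = (p, q)"
proof -
  have "inj_on (map_prod \<phi> \<psi>) (U \<times> V)" using assms(1,2) by (rule map_prod_inj_on)
  from inv_into_f_f[OF this, of "(p, q)"] show ?thesis using assms by simp
qed

text \<open>Puts functions of two group variables, in particular f (x y), under the same calculus.
  Charts, inverses and transition maps all split into factors.\<close>

lemma smooth_manifold_product:
  fixes A :: "('g::{t2_space,second_countable_topology}, 'e::real_inner) atlas"
    and B :: "('h::{t2_space,second_countable_topology}, 'f::real_inner) atlas"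
  assumes M: "smooth_manifold A" and N: "smooth_manifold B"
  shows "smooth_manifold (product_atlas A B)"
proof -
  obtain C :: "'e set" where C: "parseval_frame C" using smooth_manifold_frame[OF M] .
  obtain D :: "'f set" where D: "parseval_frame D" using smooth_manifold_frame[OF N] .
  have fr: "parseval_frame (C \<times> {0} \<union> {0} \<times> D)" using parseval_frame_prod[OF C D] .
  have basis: "\<exists>B::('e \<times> 'f) set. finite B \<and> span B = UNIV"
    using fr parseval_frame_span[OF fr] unfolding parseval_frame_def by blast
  have charts: "open (U \<times> V)" "open (map_prod \<phi> \<psi> ` (U \<times> V))"
    "homeomorphism (U \<times> V) (map_prod \<phi> \<psi> ` (U \<times> V)) (map_prod \<phi> \<psi>) (inv_into (U \<times> V) (map_prod \<phi> \<psi>))"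
    if c: "(U, \<phi>) \<in> A" and d: "(V, \<psi>) \<in> B" for U V \<phi> \<psi>
  proof -
    note cU = smooth_manifold_chart[OF M c] and cV = smooth_manifold_chart[OF N d]
    have im: "map_prod \<phi> \<psi> ` (U \<times> V) = \<phi> ` U \<times> \<psi> ` V" by auto
    show "open (U \<times> V)" "open (map_prod \<phi> \<psi> ` (U \<times> V))"
      unfolding im using cU cV by (simp_all add: open_Times)
    have eq: "inv_into (U \<times> V) (map_prod \<phi> \<psi>) z = (inv_into U \<phi> (fst z), inv_into V \<psi> (snd z))"
      if z: "z \<in> \<phi> ` U \<times> \<psi> ` V" for z
    proof -
      obtain a b where "z = (\<phi> a, \<psi> b)" "a \<in> U" "b \<in> V" using z by blast
      then show ?thesis using inv_into_map_prod[OF cU(6) cV(6)] cU(5) cV(5) by simp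
    qed
    show "homeomorphism (U \<times> V) (map_prod \<phi> \<psi> ` (U \<times> V)) (map_prod \<phi> \<psi>) (inv_into (U \<times> V) (map_prod \<phi> \<psi>))"
    proof
      have "continuous_on (U \<times> V) (\<lambda>z. (\<phi> (fst z), \<psi> (snd z)))"
        by (intro continuous_on_Pair continuous_on_compose2[OF cU(3)] continuous_on_compose2[OF cV(3)]
          continuous_on_fst continuous_on_snd continuous_on_id) auto
      then show "continuous_on (U \<times> V) (map_prod \<phi> \<psi>)" by (simp add: map_prod_def case_prod_unfold)
      have "continuous_on (\<phi> ` U \<times> \<psi> ` V) (\<lambda>z. (inv_into U \<phi> (fst z), inv_into V \<psi> (snd z)))"
        by (intro continuous_on_Pair continuous_on_compose2[OF cU(4)] continuous_on_compose2[OF cV(4)]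
          continuous_on_fst continuous_on_snd continuous_on_id) auto
      then show "continuous_on (map_prod \<phi> \<psi> ` (U \<times> V)) (inv_into (U \<times> V) (map_prod \<phi> \<psi>))"
        unfolding im using eq by (simp cong: continuous_on_cong)
      show "inv_into (U \<times> V) (map_prod \<phi> \<psi>) ` map_prod \<phi> \<psi> ` (U \<times> V) \<subseteq> U \<times> V"
        by (auto simp: inv_into_map_prod[OF cU(6) cV(6)])
    qed (auto simp: inv_into_map_prod[OF cU(6) cV(6)])
  qed
  have cover: "\<exists>U V \<phi> \<psi>. (U, \<phi>) \<in> A \<and> (V, \<psi>) \<in> B \<and> p \<in> U \<times> V" for p
    using smooth_manifold_chart_at[OF M, of "fst p"] smooth_manifold_chart_at[OF N, of "snd p"]
    by (metis mem_Times_iff)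
  have trans: "smooth_on (map_prod \<phi> \<psi> ` (U \<times> V \<inter> U' \<times> V'))
      (map_prod \<phi>' \<psi>' \<circ> inv_into (U \<times> V) (map_prod \<phi> \<psi>))"
    if c: "(U, \<phi>) \<in> A" "(V, \<psi>) \<in> B" and d: "(U', \<phi>') \<in> A" "(V', \<psi>') \<in> B" for U V \<phi> \<psi> U' V' \<phi>' \<psi>'
  proof -
    note cU = smooth_manifold_chart[OF M c(1)] and cV = smooth_manifold_chart[OF N c(2)]
    have im: "map_prod \<phi> \<psi> ` (U \<times> V \<inter> U' \<times> V') = \<phi> ` (U \<inter> U') \<times> \<psi> ` (V \<inter> V')" by auto
    have o: "open (\<phi> ` (U \<inter> U') \<times> \<psi> ` (V \<inter> V'))"
      using open_chart_image[OF M c(1) smooth_manifold_chart(1)[OF M d(1)]]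
        open_chart_image[OF N c(2) smooth_manifold_chart(1)[OF N d(2)]] by (rule open_Times)
    have "smooth_at (map_prod \<phi>' \<psi>' \<circ> inv_into (U \<times> V) (map_prod \<phi> \<psi>)) (\<phi> p, \<psi> q)"
      if p: "p \<in> U" "p \<in> U'" and q: "q \<in> V" "q \<in> V'" for p q
    proof -
      have 1: "smooth_at (\<phi>' \<circ> inv_into U \<phi>) (fst (\<phi> p, \<psi> q))"
        using smooth_manifold_transition[OF M c(1) d(1) p] by simp
      have 2: "smooth_at (\<psi>' \<circ> inv_into V \<psi>) (snd (\<phi> p, \<psi> q))"
        using smooth_manifold_transition[OF N c(2) d(2) q] by simp
      have f: "smooth_at fst (\<phi> p, \<psi> q)" "smooth_at snd (\<phi> p, \<psi> q)"
        using smooth_at_bounded_linear[OF bounded_linear_fst smooth_at_id]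
          smooth_at_bounded_linear[OF bounded_linear_snd smooth_at_id] by auto
      have "smooth_at (\<lambda>z. ((\<phi>' \<circ> inv_into U \<phi>) (fst z), (\<psi>' \<circ> inv_into V \<psi>) (snd z))) (\<phi> p, \<psi> q)"
        by (rule smooth_at_Pair[OF smooth_at_compose[OF C f(1) 1] smooth_at_compose[OF D f(2) 2]])
      then show ?thesis
      proof (rule smooth_at_cong_imp[OF _ o])
        show "(\<phi> p, \<psi> q) \<in> \<phi> ` (U \<inter> U') \<times> \<psi> ` (V \<inter> V')" using p q by blast
        fix z assume "z \<in> \<phi> ` (U \<inter> U') \<times> \<psi> ` (V \<inter> V')"
        then obtain a b where ab: "z = (\<phi> a, \<psi> b)" "a \<in> U" "b \<in> V" by blast
        then show "((\<phi>' \<circ> inv_into U \<phi>) (fst z), (\<psi>' \<circ> inv_into V \<psi>) (snd z)) =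
          (map_prod \<phi>' \<psi>' \<circ> inv_into (U \<times> V) (map_prod \<phi> \<psi>)) z"
          using cU(5) cV(5) inv_into_map_prod[OF cU(6) cV(6) ab(2,3)] by simp
      qed
    qed
    then show ?thesis unfolding im smooth_on_iff_smooth_at[OF o] by blast
  qed
  show ?thesis unfolding smooth_manifold_def
  proof (intro conjI)
    show "\<forall>(W, \<xi>)\<in>product_atlas A B. open W \<and> open (\<xi> ` W) \<and> homeomorphism W (\<xi> ` W) \<xi> (inv_into W \<xi>)"
      unfolding product_atlas_def by clarify (intro conjI charts)
    show "\<forall>p. \<exists>(W, \<xi>)\<in>product_atlas A B. p \<in> W"
    proof
      fix p
      obtain U V \<phi> \<psi> where "(U, \<phi>) \<in> A" "(V, \<psi>) \<in> B" "p \<in> U \<times> V" using cover[of p] by metis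
      then show "\<exists>(W, \<xi>)\<in>product_atlas A B. p \<in> W"
        unfolding product_atlas_def by (intro bexI[of _ "(U \<times> V, map_prod \<phi> \<psi>)"]) auto
    qed
    show "\<forall>(W, \<xi>)\<in>product_atlas A B. \<forall>(W', \<xi>')\<in>product_atlas A B.
        smooth_on (\<xi> ` (W \<inter> W')) (\<xi>' \<circ> inv_into W \<xi>)"
      unfolding product_atlas_def by clarify (rule trans)
  qed (rule basis)
qed

section \<open>Tangent vectors\<close>

text \<open>Product charts turn a tangent vector in one factor into a derivative in a direction (a,
  0) or (0, b).\<close>

lemma product_atlas_chart: "(U, \<phi>) \<in> A \<Longrightarrow> (V, \<psi>) \<in> B \<Longrightarrow> (U \<times> V, map_prod \<phi> \<psi>) \<in> product_atlas A B"
  unfolding product_atlas_def by blast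

lemma smooth_map_at_Pair:
  fixes A :: "('g::{t2_space,second_countable_topology}, 'e::real_inner) atlas"
    and B :: "('h::{t2_space,second_countable_topology}, 'f::real_inner) atlas"
    and C :: "('k::{t2_space,second_countable_topology}, 'd::real_inner) atlas"
  assumes M: "smooth_manifold A" and N: "smooth_manifold B" and K: "smooth_manifold C"
    and F: "smooth_map_at A B F p" and G: "smooth_map_at A C G p"
  shows "smooth_map_at A (product_atlas B C) (\<lambda>q. (F q, G q)) p"
proof -
  obtain U \<phi> where c: "(U, \<phi>) \<in> A" "p \<in> U" using smooth_manifold_chart_at[OF M] .
  obtain V \<psi> where d: "(V, \<psi>) \<in> B" "F p \<in> V" using smooth_manifold_chart_at[OF N] .
  obtain W \<xi> where e: "(W, \<xi>) \<in> C" "G p \<in> W" using smooth_manifold_chart_at[OF K] .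
  show ?thesis
  proof (rule smooth_map_at_chartI[OF M smooth_manifold_product[OF N K] _ c product_atlas_chart[OF d(1) e(1)]])
    show "isCont (\<lambda>q. (F q, G q)) p"
      using F G unfolding smooth_map_at_def by (simp add: isCont_Pair)
    show "smooth_at (\<lambda>x. map_prod \<psi> \<xi> (F (inv_into U \<phi> x), G (inv_into U \<phi> x))) (\<phi> p)"
      using smooth_at_Pair[OF smooth_map_at_chart[OF M N F c d] smooth_map_at_chart[OF M K G c e]] by simp
  qed (use d e in simp)
qed

lemma smooth_map_at_fst:
  fixes A :: "('g::{t2_space,second_countable_topology}, 'e::real_inner) atlas"
    and B :: "('h::{t2_space,second_countable_topology}, 'f::real_inner) atlas"
  assumes M: "smooth_manifold A" and N: "smooth_manifold B"
  shows "smooth_map_at (product_atlas A B) A fst z"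
proof -
  obtain U \<phi> where c: "(U, \<phi>) \<in> A" "fst z \<in> U" using smooth_manifold_chart_at[OF M] .
  obtain V \<psi> where d: "(V, \<psi>) \<in> B" "snd z \<in> V" using smooth_manifold_chart_at[OF N] .
  note P = smooth_manifold_product[OF M N] and ch = product_atlas_chart[OF c(1) d(1)]
  have z: "z \<in> U \<times> V" using c d by (simp add: mem_Times_iff)
  have "smooth_at (\<lambda>x. fst x) (map_prod \<phi> \<psi> z)"
    using smooth_at_bounded_linear[OF bounded_linear_fst smooth_at_id] .
  then have "smooth_at (\<lambda>x. \<phi> (fst (inv_into (U \<times> V) (map_prod \<phi> \<psi>) x))) (map_prod \<phi> \<psi> z)"
  proof (rule smooth_at_cong_imp[OF _ smooth_manifold_chart(2)[OF P ch]])
    fix y assume "y \<in> map_prod \<phi> \<psi> ` (U \<times> V)"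
    then obtain x where "y = map_prod \<phi> \<psi> x" "x \<in> U \<times> V" by (rule imageE)
    then show "fst y = \<phi> (fst (inv_into (U \<times> V) (map_prod \<phi> \<psi>) y))"
      using smooth_manifold_chart(5)[OF P ch] by simp
  qed (use z in blast)
  then show ?thesis
    by (intro smooth_map_at_chartI[OF P M isCont_fst[OF continuous_ident] ch z c])
qed

lemma smooth_map_at_snd:
  fixes A :: "('g::{t2_space,second_countable_topology}, 'e::real_inner) atlas"
    and B :: "('h::{t2_space,second_countable_topology}, 'f::real_inner) atlas"
  assumes M: "smooth_manifold A" and N: "smooth_manifold B"
  shows "smooth_map_at (product_atlas A B) B snd z"
proof -
  obtain U \<phi> where c: "(U, \<phi>) \<in> A" "fst z \<in> U" using smooth_manifold_chart_at[OF M] .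
  obtain V \<psi> where d: "(V, \<psi>) \<in> B" "snd z \<in> V" using smooth_manifold_chart_at[OF N] .
  note P = smooth_manifold_product[OF M N] and ch = product_atlas_chart[OF c(1) d(1)]
  have z: "z \<in> U \<times> V" using c d by (simp add: mem_Times_iff)
  have "smooth_at (\<lambda>x. snd x) (map_prod \<phi> \<psi> z)"
    using smooth_at_bounded_linear[OF bounded_linear_snd smooth_at_id] .
  then have "smooth_at (\<lambda>x. \<psi> (snd (inv_into (U \<times> V) (map_prod \<phi> \<psi>) x))) (map_prod \<phi> \<psi> z)"
  proof (rule smooth_at_cong_imp[OF _ smooth_manifold_chart(2)[OF P ch]])
    fix y assume "y \<in> map_prod \<phi> \<psi> ` (U \<times> V)"
    then obtain x where "y = map_prod \<phi> \<psi> x" "x \<in> U \<times> V" by (rule imageE)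
    then show "snd y = \<psi> (snd (inv_into (U \<times> V) (map_prod \<phi> \<psi>) y))"
      using smooth_manifold_chart(5)[OF P ch] by simp
  qed (use z in blast)
  then show ?thesis
    by (intro smooth_map_at_chartI[OF P N isCont_snd[OF continuous_ident] ch z d])
qed

text \<open>Names the witness in \<open>tangent_space\<close>, so that a tangent vector can be
  handled through its components w in a chosen chart.\<close>

definition chart_vector ::
  "('g::topological_space, 'e::real_inner) atlas \<Rightarrow> 'g set \<Rightarrow> ('g \<Rightarrow> 'e) \<Rightarrow> 'g \<Rightarrow> 'e \<Rightarrow> 'g tangent_vector" where
  "chart_vector A U \<phi> p w = (\<lambda>f. if smooth_near A p f
     then frechet_derivative (f \<circ> inv_into U \<phi>) (at (\<phi> p)) w else 0)"

lemma chart_vector_in_tangent_space: "(U, \<phi>) \<in> A \<Longrightarrow> p \<in> U \<Longrightarrow> chart_vector A U \<phi> p w \<in> tangent_space A p"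
  unfolding tangent_space_def chart_vector_def by blast

lemma chart_vector_has_derivative:
  assumes M: "smooth_manifold A" and c: "(U, \<phi>) \<in> A" "p \<in> U" and f: "smooth_near A p f"
  shows "((f \<circ> inv_into U \<phi>) has_derivative (\<lambda>w. chart_vector A U \<phi> p w f)) (at (\<phi> p))"
  using f smooth_at_has_derivative smooth_near_chart[OF M c] by (fastforce simp: chart_vector_def)

text \<open>Computes a tangent vector from any convenient expression g that agrees near
  \<open>\<phi> p\<close> with f in the chart, by uniqueness of derivatives.\<close>

lemma chart_vector_eqI:
  assumes M: "smooth_manifold A" and c: "(U, \<phi>) \<in> A" "p \<in> U" and f: "smooth_near A p f"
    and W: "open W" "\<phi> p \<in> W" "\<And>x. x \<in> W \<Longrightarrow> x \<in> \<phi> ` U \<Longrightarrow> g x = f (inv_into U \<phi> x)"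
    and g: "(g has_derivative g') (at (\<phi> p))"
  shows "chart_vector A U \<phi> p w f = g' w"
proof -
  have "((f \<circ> inv_into U \<phi>) has_derivative g') (at (\<phi> p))"
    by (rule has_derivative_transform_within_open[OF g, of "W \<inter> \<phi> ` U"])
      (use W c smooth_manifold_chart(2)[OF M c(1)] in \<open>auto simp: open_Int\<close>)
  from has_derivative_unique[OF this chart_vector_has_derivative[OF M c f]] show ?thesis by metis
qed

text \<open>The chain rule: components are transformed by the derivative of the chart expression of
  F. For F the identity this is the change of charts.\<close>

lemma chart_vector_pushforward:
  fixes A :: "('g::{t2_space,second_countable_topology}, 'e::real_inner) atlas"
    and B :: "('h::{t2_space,second_countable_topology}, 'f::real_inner) atlas"
  assumes M: "smooth_manifold A" and N: "smooth_manifold B" and F: "smooth_map_at A B F p"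
    and c: "(U, \<phi>) \<in> A" "p \<in> U" and d: "(V, \<psi>) \<in> B" "F p \<in> V" and f: "smooth_near B (F p) f"
  shows "chart_vector A U \<phi> p w (\<lambda>q. f (F q)) =
    chart_vector B V \<psi> (F p) (frechet_derivative (\<lambda>x. \<psi> (F (inv_into U \<phi> x))) (at (\<phi> p)) w) f"
proof -
  have "isCont F p" using F unfolding smooth_map_at_def by blast
  then obtain W where W: "open W" "p \<in> W" "\<And>q. q \<in> W \<Longrightarrow> F q \<in> V"
    using isCont_open_nhd[where F=F and p=p, OF _ smooth_manifold_chart(1)[OF N d(1)] d(2)] by metis
  have p: "inv_into U \<phi> (\<phi> p) = p" using smooth_manifold_chart(5)[OF M c] .
  show ?thesis
  proof (rule chart_vector_eqI[OF M c smooth_map_atD[OF F f] open_chart_image[OF M c(1) W(1)]])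
    show "\<phi> p \<in> \<phi> ` (U \<inter> W)" using c W by blast
    show "(f \<circ> inv_into V \<psi>) (\<psi> (F (inv_into U \<phi> x))) = f (F (inv_into U \<phi> x))"
      if "x \<in> \<phi> ` (U \<inter> W)" for x
      using that W(3) smooth_manifold_chart(5)[OF M c(1)] smooth_manifold_chart(5)[OF N d(1)] by auto
    show "((\<lambda>x. (f \<circ> inv_into V \<psi>) (\<psi> (F (inv_into U \<phi> x)))) has_derivative
      (\<lambda>w. chart_vector B V \<psi> (F p) (frechet_derivative (\<lambda>x. \<psi> (F (inv_into U \<phi> x))) (at (\<phi> p)) w) f)) (at (\<phi> p))"
      by (rule has_derivative_compose[OF smooth_at_has_derivative[OF smooth_map_at_chart[OF M N F c d]]])
        (use chart_vector_has_derivative[OF N d f] p in \<open>simp add: o_def\<close>)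
  qed
qed

text \<open>\<open>tangent_space\<close> lets each vector come with its own chart; pushing forward
  along the identity rewrites it in a prescribed one. On functions not smooth near p both sides have
  the default 0.\<close>

lemma tangent_space_chart:
  fixes A :: "('g::{t2_space,second_countable_topology}, 'e::real_inner) atlas"
  assumes M: "smooth_manifold A" and v: "v \<in> tangent_space A p" and d: "(V, \<psi>) \<in> A" "p \<in> V"
  obtains w where "v = chart_vector A V \<psi> p w"
proof -
  obtain U \<phi> w where c: "(U, \<phi>) \<in> A" "p \<in> U" and w: "v = chart_vector A U \<phi> p w"
    using v unfolding tangent_space_def chart_vector_def by blast
  have "chart_vector A U \<phi> p w f = chart_vector A V \<psi> p (frechet_derivative (\<lambda>x. \<psi> (inv_into U \<phi> x)) (at (\<phi> p)) w) f" for f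
  proof (cases "smooth_near A p f")
    case True
    from chart_vector_pushforward[OF M M smooth_map_at_id c d this] show ?thesis by simp
  qed (simp add: chart_vector_def)
  then show ?thesis using w that by blast
qed

text \<open>Hypothesis \<open>G\<close> protects the default value: if f is not smooth near F p,
  then its pull-back is not smooth near p, so both vectors give 0.\<close>

lemma tangent_space_pushforward:
  fixes A :: "('g::{t2_space,second_countable_topology}, 'e::real_inner) atlas"
    and B :: "('h::{t2_space,second_countable_topology}, 'f::real_inner) atlas"
  assumes M: "smooth_manifold A" and N: "smooth_manifold B" and F: "smooth_map_at A B F p"
    and G: "\<And>f. smooth_near A p (\<lambda>q. f (F q)) \<Longrightarrow> smooth_near B (F p) f"
    and v: "v \<in> tangent_space A p"
  shows "(\<lambda>f. v (\<lambda>q. f (F q))) \<in> tangent_space B (F p)"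
proof -
  obtain U \<phi> where c: "(U, \<phi>) \<in> A" "p \<in> U" using smooth_manifold_chart_at[OF M] .
  obtain V \<psi> where d: "(V, \<psi>) \<in> B" "F p \<in> V" using smooth_manifold_chart_at[OF N] .
  obtain w where w: "v = chart_vector A U \<phi> p w" using tangent_space_chart[OF M v c] .
  define w' where "w' = frechet_derivative (\<lambda>x. \<psi> (F (inv_into U \<phi> x))) (at (\<phi> p)) w"
  have "v (\<lambda>q. f (F q)) = chart_vector B V \<psi> (F p) w' f" for f
  proof (cases "smooth_near B (F p) f")
    case True
    then show ?thesis using chart_vector_pushforward[OF M N F c d True] w w'_def by simp
  next
    case False
    then have "\<not> smooth_near A p (\<lambda>q. f (F q))" using G by blast
    then show ?thesis using False w by (simp add: chart_vector_def)
  qed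
  then have "(\<lambda>f. v (\<lambda>q. f (F q))) = chart_vector B V \<psi> (F p) w'" by (rule ext)
  then show ?thesis using chart_vector_in_tangent_space[OF d] by simp
qed

lemma chart_vector_linear:
  assumes M: "smooth_manifold A" and c: "(U, \<phi>) \<in> A" "p \<in> U"
  shows "chart_vector A U \<phi> p (a + b) = chart_vector A U \<phi> p a + chart_vector A U \<phi> p b"
    and "chart_vector A U \<phi> p (k *\<^sub>R a) = k *\<^sub>R chart_vector A U \<phi> p a"
proof -
  have l: "linear (\<lambda>w. chart_vector A U \<phi> p w f)" for f
  proof (cases "smooth_near A p f")
    case True
    from has_derivative_bounded_linear[OF chart_vector_has_derivative[OF M c this]]
    show ?thesis by (rule bounded_linear.linear)
  next
    case False
    then show ?thesis by (simp add: chart_vector_def linear_iff)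
  qed
  show "chart_vector A U \<phi> p (a + b) = chart_vector A U \<phi> p a + chart_vector A U \<phi> p b"
    using linear_add[OF l] by (intro ext) simp
  show "chart_vector A U \<phi> p (k *\<^sub>R a) = k *\<^sub>R chart_vector A U \<phi> p a"
    using linear_scale[OF l] by (intro ext) (simp add: scaleR_fun_def)
qed

lemma tangent_space_add:
  assumes M: "smooth_manifold A" and "v \<in> tangent_space A p" "v' \<in> tangent_space A p"
  shows "v + v' \<in> tangent_space A p"
proof -
  obtain U \<phi> where c: "(U, \<phi>) \<in> A" "p \<in> U" using smooth_manifold_chart_at[OF M] .
  obtain w w' where "v = chart_vector A U \<phi> p w" "v' = chart_vector A U \<phi> p w'"
    using tangent_space_chart[OF M assms(2) c] tangent_space_chart[OF M assms(3) c] by metis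
  then have "v + v' = chart_vector A U \<phi> p (w + w')" using chart_vector_linear(1)[OF M c] by simp
  then show ?thesis using chart_vector_in_tangent_space[OF c] by simp
qed

lemma tangent_space_scaleR:
  assumes M: "smooth_manifold A" and "v \<in> tangent_space A p"
  shows "k *\<^sub>R v \<in> tangent_space A p"
proof -
  obtain U \<phi> where c: "(U, \<phi>) \<in> A" "p \<in> U" using smooth_manifold_chart_at[OF M] .
  obtain w where "v = chart_vector A U \<phi> p w" using tangent_space_chart[OF M assms(2) c] .
  then have "k *\<^sub>R v = chart_vector A U \<phi> p (k *\<^sub>R w)" using chart_vector_linear(2)[OF M c] by simp
  then show ?thesis using chart_vector_in_tangent_space[OF c] by simp
qed

lemma tangent_vector_not_smooth: "v \<in> tangent_space A p \<Longrightarrow> \<not> smooth_near A p f \<Longrightarrow> v f = 0"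
  unfolding tangent_space_def by auto

lemma tangent_vector_chart:
  assumes M: "smooth_manifold A" and v: "v \<in> tangent_space A p"
  obtains U \<phi> w where "(U, \<phi>) \<in> A" "p \<in> U" "v = chart_vector A U \<phi> p w"
  using smooth_manifold_chart_at[OF M, of p] tangent_space_chart[OF M v] by metis

lemma tangent_vector_add:
  assumes M: "smooth_manifold A" and v: "v \<in> tangent_space A p"
    and f: "smooth_near A p f" and g: "smooth_near A p g"
  shows "v (\<lambda>x. f x + g x) = v f + v g"
proof -
  obtain U \<phi> w where c: "(U, \<phi>) \<in> A" "p \<in> U" and w: "v = chart_vector A U \<phi> p w"
    using tangent_vector_chart[OF M v] .
  show ?thesis unfolding w
    by (rule chart_vector_eqI[OF M c smooth_near_add[OF M f g] open_UNIV UNIV_I _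
      has_derivative_add[OF chart_vector_has_derivative[OF M c f] chart_vector_has_derivative[OF M c g]]]) simp
qed

lemma tangent_vector_mult:
  assumes M: "smooth_manifold A" and v: "v \<in> tangent_space A p"
    and f: "smooth_near A p f" and g: "smooth_near A p g"
  shows "v (\<lambda>x. f x * g x) = f p * v g + g p * v f"
proof -
  obtain U \<phi> w where c: "(U, \<phi>) \<in> A" "p \<in> U" and w: "v = chart_vector A U \<phi> p w"
    using tangent_vector_chart[OF M v] .
  have "v (\<lambda>x. f x * g x) = (f \<circ> inv_into U \<phi>) (\<phi> p) * v g + v f * (g \<circ> inv_into U \<phi>) (\<phi> p)" unfolding w
    by (rule chart_vector_eqI[OF M c smooth_near_mult[OF M f g] open_UNIV UNIV_I _
      has_derivative_mult[OF chart_vector_has_derivative[OF M c f] chart_vector_has_derivative[OF M c g]]]) simp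
  then show ?thesis using smooth_manifold_chart(5)[OF M c] by simp
qed

lemma tangent_vector_const:
  assumes M: "smooth_manifold A" and v: "v \<in> tangent_space A p"
  shows "v (\<lambda>x. k) = 0"
proof -
  obtain U \<phi> w where c: "(U, \<phi>) \<in> A" "p \<in> U" and w: "v = chart_vector A U \<phi> p w"
    using tangent_vector_chart[OF M v] .
  show ?thesis unfolding w
    by (rule chart_vector_eqI[OF M c smooth_near_const[OF M] open_UNIV UNIV_I _ has_derivative_const]) simp
qed

lemma tangent_vector_sum:
  assumes M: "smooth_manifold A" and v: "v \<in> tangent_space A p" and "finite I"
    and "\<And>i. i \<in> I \<Longrightarrow> smooth_near A p (f i)"
  shows "v (\<lambda>x. \<Sum>i\<in>I. f i x) = (\<Sum>i\<in>I. v (f i))"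
  using assms(3,4)
proof (induction I rule: finite_induct)
  case empty
  then show ?case using tangent_vector_const[OF M v] by simp
next
  case (insert i I)
  have "v (\<lambda>x. f i x + (\<Sum>i\<in>I. f i x)) = v (f i) + v (\<lambda>x. \<Sum>i\<in>I. f i x)"
    using insert by (intro tangent_vector_add[OF M v] smooth_near_sum[OF M]) auto
  then show ?case using insert by simp
qed

text \<open>In the chart the test function is L itself, which is its own derivative. Applied to
  inner products it recovers the components of a tangent vector.\<close>

lemma chart_vector_coordinate:
  assumes M: "smooth_manifold A" and c: "(U, \<phi>) \<in> A" "p \<in> U" and L: "bounded_linear (L :: _ \<Rightarrow> real)"
  shows "chart_vector A U \<phi> p w (\<lambda>q. L (\<phi> q)) = L w"
  by (rule chart_vector_eqI[OF M c smooth_near_coordinate[OF M c L] open_UNIV UNIV_I _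
      bounded_linear_imp_has_derivative[OF L]])
    (use smooth_manifold_chart(5)[OF M c(1)] in auto)

section \<open>Vector fields in charts\<close>

lemma vector_fields_iff:
  assumes M: "smooth_manifold A"
  shows "X \<in> vector_fields A \<longleftrightarrow> (\<forall>p. X p \<in> tangent_space A p) \<and>
    (\<forall>p f. smooth_near A p f \<longrightarrow> smooth_near A p (\<lambda>q. X q f))"
proof -
  have "(\<forall>W f. open W \<longrightarrow> smooth_fun_on A W f \<longrightarrow> smooth_fun_on A W (deriv_along X f)) \<longleftrightarrow>
    (\<forall>p f. smooth_near A p f \<longrightarrow> smooth_near A p (\<lambda>q. X q f))"
  proof (intro iffI allI impI)
    fix p f assume *: "\<forall>W f. open W \<longrightarrow> smooth_fun_on A W f \<longrightarrow> smooth_fun_on A W (deriv_along X f)"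
      and "smooth_near A p f"
    then obtain W where "open W" "p \<in> W" "smooth_fun_on A W f" unfolding smooth_near_def by blast
    with * show "smooth_near A p (\<lambda>q. X q f)"
      unfolding deriv_along_def smooth_near_def by blast
  next
    fix W f assume *: "\<forall>p f. smooth_near A p f \<longrightarrow> smooth_near A p (\<lambda>q. X q f)"
      and "open W" "smooth_fun_on A W f"
    then show "smooth_fun_on A W (deriv_along X f)"
      unfolding smooth_fun_on_iff_smooth_near[OF M \<open>open W\<close>] deriv_along_def by blast
  qed
  then show ?thesis unfolding vector_fields_def by simp
qed

text \<open>The components are found by applying X to the coordinate functions, so they are smooth
  because X preserves smoothness of functions.\<close>

lemma vector_field_chart:
  fixes A :: "('g::{t2_space,second_countable_topology}, 'e::real_inner) atlas"
  assumes M: "smooth_manifold A" and X: "X \<in> vector_fields A" and c: "(U, \<phi>) \<in> A"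
  obtains \<omega> where "\<And>p. p \<in> U \<Longrightarrow> X p = chart_vector A U \<phi> p (\<omega> p)"
    "\<And>p. p \<in> U \<Longrightarrow> smooth_at (\<lambda>x. \<omega> (inv_into U \<phi> x)) (\<phi> p)"
proof -
  obtain C :: "'e set" where C: "parseval_frame C" using smooth_manifold_frame[OF M] .
  define \<omega> where "\<omega> p = (\<Sum>c\<in>C. X p (\<lambda>q. \<phi> q \<bullet> c) *\<^sub>R c)" for p
  have "X p = chart_vector A U \<phi> p (\<omega> p)" if p: "p \<in> U" for p
  proof -
    have "X p \<in> tangent_space A p" using X vector_fields_iff[OF M] by blast
    then obtain w where w: "X p = chart_vector A U \<phi> p w" using tangent_space_chart[OF M _ c p] by blast
    then have "\<omega> p = (\<Sum>c\<in>C. (w \<bullet> c) *\<^sub>R c)"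
      unfolding \<omega>_def using chart_vector_coordinate[OF M c p bounded_linear_inner_left] by simp
    then have "\<omega> p = w" using C by (simp add: parseval_frame_def)
    then show ?thesis using w by simp
  qed
  moreover have "smooth_at (\<lambda>x. \<omega> (inv_into U \<phi> x)) (\<phi> p)" if p: "p \<in> U" for p
    unfolding \<omega>_def
  proof (intro smooth_at_sum smooth_at_scaleR smooth_at_const)
    show "finite C" using C by (simp add: parseval_frame_def)
    fix k
    have "smooth_near A p (\<lambda>q. X q (\<lambda>q. \<phi> q \<bullet> k))"
      using X vector_fields_iff[OF M] smooth_near_coordinate[OF M c p bounded_linear_inner_left] by blast
    then show "smooth_at (\<lambda>x. X (inv_into U \<phi> x) (\<lambda>q. \<phi> q \<bullet> k)) (\<phi> p)"
      unfolding smooth_near_chart[OF M c p] o_def .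
  qed
  ultimately show ?thesis by (rule that)
qed

section \<open>Partial derivatives on product manifolds\<close>

lemma has_derivative_partial_fst:
  assumes "(H has_derivative H') (at (x, y))"
  shows "((\<lambda>x. H (x, y)) has_derivative (\<lambda>a. H' (a, 0))) (at x)"
proof -
  have "((\<lambda>x. (x, y)) has_derivative (\<lambda>a. (a, 0))) (at x)" by (auto intro!: derivative_eq_intros)
  from has_derivative_compose[OF this assms] show ?thesis .
qed

lemma has_derivative_partial_snd:
  assumes "(H has_derivative H') (at (x, y))"
  shows "((\<lambda>y. H (x, y)) has_derivative (\<lambda>a. H' (0, a))) (at y)"
proof -
  have "((\<lambda>y. (x, y)) has_derivative (\<lambda>a. (0, a))) (at y)" by (auto intro!: derivative_eq_intros)
  from has_derivative_compose[OF this assms] show ?thesis .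
qed

lemma smooth_near_partial_fst:
  assumes M: "smooth_manifold A" and N: "smooth_manifold B" and F: "smooth_near (product_atlas A B) (p, q) F"
  shows "smooth_near A p (\<lambda>p'. F (p', q))"
  using smooth_map_atD[OF smooth_map_at_Pair[OF M M N smooth_map_at_id smooth_map_at_const[OF M]] F] .

lemma smooth_near_partial_snd:
  assumes M: "smooth_manifold A" and N: "smooth_manifold B" and F: "smooth_near (product_atlas A B) (p, q) F"
  shows "smooth_near B q (\<lambda>q'. F (p, q'))"
  using smooth_map_atD[OF smooth_map_at_Pair[OF N M N smooth_map_at_const[OF N] smooth_map_at_id] F] .

context
  fixes A :: "('g::{t2_space,second_countable_topology}, 'e::real_inner) atlas"
    and B :: "('h::{t2_space,second_countable_topology}, 'f::real_inner) atlas"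
    and U \<phi> V \<psi>
  assumes M: "smooth_manifold A" and N: "smooth_manifold B" and c: "(U, \<phi>) \<in> A" and d: "(V, \<psi>) \<in> B"
begin

lemma smooth_near_product_chart:
  assumes "p \<in> U" "q \<in> V"
  shows "smooth_near (product_atlas A B) (p, q) F \<longleftrightarrow>
    smooth_at (F \<circ> inv_into (U \<times> V) (map_prod \<phi> \<psi>)) (\<phi> p, \<psi> q)"
  using smooth_near_chart[OF smooth_manifold_product[OF M N] product_atlas_chart[OF c d], of "(p, q)" F] assms
  by simp

lemma chart_inv_product:
  assumes "p \<in> U" "q \<in> V"
  shows "inv_into (U \<times> V) (map_prod \<phi> \<psi>) (\<phi> p, \<psi> q) = (p, q)"
  by (rule inv_into_map_prod[OF smooth_manifold_chart(6)[OF M c] smooth_manifold_chart(6)[OF N d] assms])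

lemma chart_vector_partial_fst:
  assumes p: "p \<in> U" "q \<in> V" and F: "smooth_near (product_atlas A B) (p, q) F"
  shows "chart_vector A U \<phi> p a (\<lambda>p'. F (p', q)) =
    frechet_derivative (F \<circ> inv_into (U \<times> V) (map_prod \<phi> \<psi>)) (at (\<phi> p, \<psi> q)) (a, 0)"
proof (rule chart_vector_eqI[OF M c p(1) smooth_near_partial_fst[OF M N F] open_UNIV UNIV_I])
  show "((\<lambda>x. (F \<circ> inv_into (U \<times> V) (map_prod \<phi> \<psi>)) (x, \<psi> q)) has_derivative
     (\<lambda>a. frechet_derivative (F \<circ> inv_into (U \<times> V) (map_prod \<phi> \<psi>)) (at (\<phi> p, \<psi> q)) (a, 0))) (at (\<phi> p))"
    using F smooth_near_product_chart[OF p] by (intro has_derivative_partial_fst smooth_at_has_derivative) blast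
  show "(F \<circ> inv_into (U \<times> V) (map_prod \<phi> \<psi>)) (x, \<psi> q) = F (inv_into U \<phi> x, q)" if "x \<in> \<phi> ` U" for x
    using that p chart_inv_product smooth_manifold_chart(5)[OF M c] by auto
qed

lemma chart_vector_partial_snd:
  assumes p: "p \<in> U" "q \<in> V" and F: "smooth_near (product_atlas A B) (p, q) F"
  shows "chart_vector B V \<psi> q b (\<lambda>q'. F (p, q')) =
    frechet_derivative (F \<circ> inv_into (U \<times> V) (map_prod \<phi> \<psi>)) (at (\<phi> p, \<psi> q)) (0, b)"
proof (rule chart_vector_eqI[OF N d p(2) smooth_near_partial_snd[OF M N F] open_UNIV UNIV_I])
  show "((\<lambda>y. (F \<circ> inv_into (U \<times> V) (map_prod \<phi> \<psi>)) (\<phi> p, y)) has_derivative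
     (\<lambda>b. frechet_derivative (F \<circ> inv_into (U \<times> V) (map_prod \<phi> \<psi>)) (at (\<phi> p, \<psi> q)) (0, b))) (at (\<psi> q))"
    using F smooth_near_product_chart[OF p] by (intro has_derivative_partial_snd smooth_at_has_derivative) blast
  show "(F \<circ> inv_into (U \<times> V) (map_prod \<phi> \<psi>)) (\<phi> p, y) = F (p, inv_into V \<psi> y)" if "y \<in> \<psi> ` V" for y
    using that p chart_inv_product smooth_manifold_chart(5)[OF N d] by auto
qed

text \<open>In the product chart the function is the derivative of H in the direction
  (\<open>\<omega>\<close>, 0), hence smooth jointly in the base point and the parameter.\<close>

lemma smooth_near_chart_vector_parametric:
  assumes p: "p \<in> U" "q \<in> V" and F: "smooth_near (product_atlas A B) (p, q) F"
    and w: "smooth_at (\<lambda>x. \<omega> (inv_into U \<phi> x)) (\<phi> p)"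
  shows "smooth_near (product_atlas A B) (p, q)
    (\<lambda>z. chart_vector A U \<phi> (fst z) (\<omega> (fst z)) (\<lambda>p'. F (p', snd z)))"
proof -
  note P = smooth_manifold_product[OF M N] and ch = product_atlas_chart[OF c d]
  obtain C :: "('e \<times> 'f) set" where C: "parseval_frame C" using smooth_manifold_frame[OF P] .
  obtain C' :: "'e set" where C': "parseval_frame C'" using smooth_manifold_frame[OF M] .
  define H where "H = F \<circ> inv_into (U \<times> V) (map_prod \<phi> \<psi>)"
  have H: "smooth_at H (\<phi> p, \<psi> q)" using F smooth_near_product_chart[OF p] H_def by blast
  obtain W where W: "open W" "(p, q) \<in> W" "\<And>z. z \<in> W \<Longrightarrow> smooth_near (product_atlas A B) z F"
    using smooth_near_open_nhd[OF F] by blast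
  have "smooth_at (\<lambda>x. \<omega> (inv_into U \<phi> x)) (fst (\<phi> p, \<psi> q))" using w by simp
  then have "smooth_at (\<lambda>z. \<omega> (inv_into U \<phi> (fst z))) (\<phi> p, \<psi> q)"
    by (rule smooth_at_compose[OF C' smooth_at_bounded_linear[OF bounded_linear_fst smooth_at_id]])
  then have "smooth_at (\<lambda>z. frechet_derivative H (at z) (\<omega> (inv_into U \<phi> (fst z)), 0)) (\<phi> p, \<psi> q)"
    by (intro smooth_at_frechet_derivative[OF C H] smooth_at_Pair smooth_at_const)
  then have "smooth_at ((\<lambda>z. chart_vector A U \<phi> (fst z) (\<omega> (fst z)) (\<lambda>p'. F (p', snd z)))
      \<circ> inv_into (U \<times> V) (map_prod \<phi> \<psi>)) (\<phi> p, \<psi> q)"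
  proof (rule smooth_at_cong_imp[OF _ open_chart_image[OF P ch W(1)]])
    show "(\<phi> p, \<psi> q) \<in> map_prod \<phi> \<psi> ` (U \<times> V \<inter> W)" using p W(2) by force
    fix z assume "z \<in> map_prod \<phi> \<psi> ` (U \<times> V \<inter> W)"
    then obtain a b where ab: "a \<in> U" "b \<in> V" "(a, b) \<in> W" "z = (\<phi> a, \<psi> b)" by auto
    then show "frechet_derivative H (at z) (\<omega> (inv_into U \<phi> (fst z)), 0) =
      ((\<lambda>z. chart_vector A U \<phi> (fst z) (\<omega> (fst z)) (\<lambda>p'. F (p', snd z)))
      \<circ> inv_into (U \<times> V) (map_prod \<phi> \<psi>)) z"
      using chart_vector_partial_fst[OF ab(1,2) W(3)[OF ab(3)]] chart_inv_product[OF ab(1,2)]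
        smooth_manifold_chart(5)[OF M c ab(1)] by (simp add: H_def)
  qed
  then show ?thesis using smooth_near_product_chart[OF p] by blast
qed

end

lemma smooth_near_vector_field_parametric:
  fixes A :: "('g::{t2_space,second_countable_topology}, 'e::real_inner) atlas"
    and B :: "('h::{t2_space,second_countable_topology}, 'f::real_inner) atlas"
  assumes M: "smooth_manifold A" and N: "smooth_manifold B" and X: "X \<in> vector_fields A"
    and F: "smooth_near (product_atlas A B) (p, q) F"
  shows "smooth_near (product_atlas A B) (p, q) (\<lambda>z. X (fst z) (\<lambda>p'. F (p', snd z)))"
proof -
  obtain U \<phi> where c: "(U, \<phi>) \<in> A" "p \<in> U" using smooth_manifold_chart_at[OF M] .
  obtain V \<psi> where d: "(V, \<psi>) \<in> B" "q \<in> V" using smooth_manifold_chart_at[OF N] .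
  obtain \<omega> where w: "\<And>p. p \<in> U \<Longrightarrow> X p = chart_vector A U \<phi> p (\<omega> p)"
    "\<And>p. p \<in> U \<Longrightarrow> smooth_at (\<lambda>x. \<omega> (inv_into U \<phi> x)) (\<phi> p)"
    using vector_field_chart[OF M X c(1)] by blast
  have o: "open (U \<times> (UNIV :: 'h set))" using smooth_manifold_chart(1)[OF M c(1)] by (simp add: open_Times)
  show ?thesis
    by (rule smooth_near_cong_imp[OF smooth_manifold_product[OF M N]
        smooth_near_chart_vector_parametric[OF M N c(1) d(1) c(2) d(2) F w(2)[OF c(2)]] o])
      (use c w in auto)
qed

text \<open>Extend v to the field with constant components in a chart, differentiate with a
  parameter, and restrict to the slice over p.\<close>

lemma smooth_near_tangent_vector_parametric:
  assumes M: "smooth_manifold A" and N: "smooth_manifold B" and v: "v \<in> tangent_space A p"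
    and F: "smooth_near (product_atlas A B) (p, q) F"
  shows "smooth_near B q (\<lambda>q. v (\<lambda>p'. F (p', q)))"
proof -
  obtain U \<phi> w where c: "(U, \<phi>) \<in> A" "p \<in> U" and w: "v = chart_vector A U \<phi> p w"
    using tangent_vector_chart[OF M v] .
  obtain V \<psi> where d: "(V, \<psi>) \<in> B" "q \<in> V" using smooth_manifold_chart_at[OF N] .
  have "smooth_near (product_atlas A B) (p, q) (\<lambda>z. chart_vector A U \<phi> (fst z) w (\<lambda>p'. F (p', snd z)))"
    using smooth_near_chart_vector_parametric[OF M N c(1) d(1) c(2) d(2) F, of "\<lambda>_. w"] by simp
  from smooth_near_partial_snd[OF M N this] show ?thesis by (simp add: w)
qed

text \<open>In a product chart v and w are partial derivatives in directions (a, 0) and (0, b), so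
  the claim is the symmetry of the second derivative of H.\<close>

lemma tangent_vectors_commute:
  assumes M: "smooth_manifold A" and N: "smooth_manifold B"
    and v: "v \<in> tangent_space A p" and w: "w \<in> tangent_space B q"
    and F: "smooth_near (product_atlas A B) (p, q) F"
  shows "w (\<lambda>y. v (\<lambda>x. F (x, y))) = v (\<lambda>x. w (\<lambda>y. F (x, y)))"
proof -
  note P = smooth_manifold_product[OF M N]
  obtain U \<phi> a where c: "(U, \<phi>) \<in> A" "p \<in> U" and a: "v = chart_vector A U \<phi> p a"
    using tangent_vector_chart[OF M v] .
  obtain V \<psi> b where d: "(V, \<psi>) \<in> B" "q \<in> V" and b: "w = chart_vector B V \<psi> q b"
    using tangent_vector_chart[OF N w] .
  note cd = M N c(1) d(1)
  define I where "I = inv_into (U \<times> V) (map_prod \<phi> \<psi>)"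
  define H where "H = F \<circ> I"
  have H: "smooth_at H (\<phi> p, \<psi> q)"
    using F smooth_near_product_chart[OF cd c(2) d(2)] by (simp add: H_def I_def)
  obtain W where W: "open W" "(p, q) \<in> W" "\<And>z. z \<in> W \<Longrightarrow> smooth_near (product_atlas A B) z F"
    using smooth_near_open_nhd[OF F] by blast
  \<comment> \<open>The inner derivatives are taken at points (p, y) and (x, q), where F must be
    smooth as well; a rectangle inside W contains these slices.\<close>
  obtain W1 W2 where W12: "open W1" "p \<in> W1" "open W2" "q \<in> W2" "W1 \<times> W2 \<subseteq> W"
    using open_prod_elim[OF W(1,2)] by (metis SigmaE2 mem_Sigma_iff)
  have Fn: "smooth_near (product_atlas A B) (x, y) F" if "x \<in> W1" "y \<in> W2" for x y
    using W12 W(3) that by blast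
  have D: "((\<lambda>z. frechet_derivative H (at z) u) has_derivative
      frechet_derivative (\<lambda>z. frechet_derivative H (at z) u) (at (\<phi> p, \<psi> q))) (at (\<phi> p, \<psi> q))" for u
    by (rule smooth_at_has_derivative[OF smooth_at_frechet_derivative_const[OF H]])
  \<comment> \<open>Smooth dependence on a parameter was shown for a vector acting in the first
    variable, so the factors are swapped.\<close>
  have sw: "smooth_near A p (\<lambda>x. w (\<lambda>y. F (x, y)))"
  proof -
    have "smooth_map_at (product_atlas B A) (product_atlas A B) (\<lambda>z. (snd z, fst z)) (q, p)"
      by (intro smooth_map_at_Pair smooth_manifold_product smooth_map_at_fst smooth_map_at_snd M N)
    then have "smooth_near (product_atlas B A) (q, p) (\<lambda>z. F (snd z, fst z))"
      using smooth_map_atD F by fastforce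
    from smooth_near_tangent_vector_parametric[OF N M w this] show ?thesis by simp
  qed
  have "w (\<lambda>y. v (\<lambda>x. F (x, y))) = frechet_derivative (\<lambda>z. frechet_derivative H (at z) (a, 0)) (at (\<phi> p, \<psi> q)) (0, b)"
    unfolding b
  proof (rule chart_vector_eqI[OF N d _ _ _ _ has_derivative_partial_snd[OF D]])
    show "smooth_near B q (\<lambda>y. v (\<lambda>x. F (x, y)))"
      by (rule smooth_near_tangent_vector_parametric[OF M N v F])
    show "open (\<psi> ` (V \<inter> W2))" by (rule open_chart_image[OF N d(1) W12(3)])
    show "\<psi> q \<in> \<psi> ` (V \<inter> W2)" using d W12 by blast
    fix y assume "y \<in> \<psi> ` (V \<inter> W2)"
    then obtain q' where "q' \<in> V" "q' \<in> W2" "y = \<psi> q'" by blast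
    then show "frechet_derivative H (at (\<phi> p, y)) (a, 0) = v (\<lambda>x. F (x, inv_into V \<psi> y))"
      using chart_vector_partial_fst[OF cd c(2) _ Fn] W12(2) smooth_manifold_chart(5)[OF N d(1)]
      by (simp add: a H_def I_def)
  qed
  also have "\<dots> = frechet_derivative (\<lambda>z. frechet_derivative H (at z) (0, b)) (at (\<phi> p, \<psi> q)) (a, 0)"
    by (rule frechet_derivative_commute_smooth_at[OF H])
  also have "\<dots> = v (\<lambda>x. w (\<lambda>y. F (x, y)))"
    unfolding a
  proof (rule chart_vector_eqI[OF M c _ _ _ _ has_derivative_partial_fst[OF D], symmetric])
    show "smooth_near A p (\<lambda>x. w (\<lambda>y. F (x, y)))" by (rule sw)
    show "open (\<phi> ` (U \<inter> W1))" by (rule open_chart_image[OF M c(1) W12(1)])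
    show "\<phi> p \<in> \<phi> ` (U \<inter> W1)" using c W12 by blast
    fix x assume "x \<in> \<phi> ` (U \<inter> W1)"
    then obtain p' where "p' \<in> U" "p' \<in> W1" "x = \<phi> p'" by blast
    then show "frechet_derivative H (at (x, \<psi> q)) (0, b) = w (\<lambda>y. F (inv_into U \<phi> x, y))"
      using chart_vector_partial_snd[OF cd _ d(2) Fn] W12(4) smooth_manifold_chart(5)[OF M c(1)]
      by (simp add: b H_def I_def)
  qed
  finally show ?thesis .
qed

lemma sum_fun_apply: "(\<Sum>i\<in>I. f i) x = (\<Sum>i\<in>I. f i x :: 'b::comm_monoid_add)"
  by (induction I rule: infinite_finite_induct) auto

lemma finite_dual_basis:
  fixes S :: "'a::real_vector set"
  assumes "finite S" "span S = UNIV"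
  obtains B :: "'a set" and \<delta> where "finite B" "\<And>b. linear (\<delta> b :: 'a \<Rightarrow> real)"
    "\<And>v. v = (\<Sum>b\<in>B. \<delta> b v *\<^sub>R b)"
proof -
  obtain B where B: "B \<subseteq> S" "independent B" "S \<subseteq> span B"
    using real_vector.maximal_independent_subset by blast
  have fin: "finite B" using B(1) assms(1) by (rule finite_subset)
  have "span S \<subseteq> span B" using B(3) by (rule span_minimal) (rule subspace_span)
  then have sp: "span B = UNIV" using assms(2) by auto
  define \<delta> where "\<delta> b v = real_vector.representation B v b" for b v
  have "linear (\<delta> b)" for b
    using B(2) sp by (intro linearI) (simp_all add: \<delta>_def real_vector.representation_add real_vector.representation_scale)
  moreover have "v = (\<Sum>b\<in>B. \<delta> b v *\<^sub>R b)" for v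
    using real_vector.sum_representation_eq[OF B(2) _ fin order_refl, of v] sp by (simp add: \<delta>_def)
  ultimately show ?thesis using that fin by blast
qed

section \<open>Operations on smooth functions and vector fields\<close>

lemma vf_scale_apply: "vf_scale f X p \<xi> = f p * X p \<xi>"
  by (simp add: vf_scale_def scaleR_fun_def)

lemma smooth_funs_mult: "smooth_manifold A \<Longrightarrow> f \<in> smooth_funs A \<Longrightarrow> g \<in> smooth_funs A \<Longrightarrow> f * g \<in> smooth_funs A"
  unfolding smooth_funs_iff_smooth_near times_fun_def by (blast intro: smooth_near_mult)

lemma smooth_funs_const: "smooth_manifold A \<Longrightarrow> (\<lambda>p. k) \<in> smooth_funs A"
  unfolding smooth_funs_iff_smooth_near by (blast intro: smooth_near_const)

lemma smooth_funs_uminus: "smooth_manifold A \<Longrightarrow> f \<in> smooth_funs A \<Longrightarrow> - f \<in> smooth_funs A"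
  using smooth_funs_mult[of A "\<lambda>_. -1" f] smooth_funs_const[of A "-1"] by (simp add: times_fun_def fun_Compl_def)

lemma vector_fieldsD:
  assumes "smooth_manifold A" "X \<in> vector_fields A"
  shows "X p \<in> tangent_space A p" and "smooth_near A p f \<Longrightarrow> smooth_near A p (\<lambda>q. X q f)"
  using assms vector_fields_iff by blast+

lemma deriv_along_smooth_funs:
  assumes M: "smooth_manifold A" and "X \<in> vector_fields A" "f \<in> smooth_funs A"
  shows "deriv_along X f \<in> smooth_funs A"
  using assms vector_fieldsD(2) unfolding smooth_funs_iff_smooth_near[OF M] deriv_along_def by blast

lemma vector_fields_add:
  assumes M: "smooth_manifold A" and "X \<in> vector_fields A" "Y \<in> vector_fields A"
  shows "X + Y \<in> vector_fields A"
  unfolding vector_fields_iff[OF M]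
  using vector_fieldsD[OF M assms(2)] vector_fieldsD[OF M assms(3)] tangent_space_add[OF M] smooth_near_add[OF M]
  by simp

lemma vector_fields_scale:
  assumes M: "smooth_manifold A" and "f \<in> smooth_funs A" "X \<in> vector_fields A"
  shows "vf_scale f X \<in> vector_fields A"
  unfolding vector_fields_iff[OF M]
proof (intro conjI allI impI)
  show "vf_scale f X p \<in> tangent_space A p" for p
    using vector_fieldsD(1)[OF M assms(3)] tangent_space_scaleR[OF M] by (simp add: vf_scale_def)
  show "smooth_near A p (\<lambda>q. vf_scale f X q g)" if "smooth_near A p g" for p g
    unfolding vf_scale_apply
    using vector_fieldsD(2)[OF M assms(3) that] assms(2) smooth_near_mult[OF M] smooth_funs_iff_smooth_near[OF M] by blast
qed

lemma vf_bracket_antisym: "vf_bracket A X Y = - vf_bracket A Y X"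
  by (intro ext) (simp add: vf_bracket_def)

lemma vf_bracket_add_left:
  assumes M: "smooth_manifold A" and X: "X \<in> vector_fields A" "X' \<in> vector_fields A" and Y: "Y \<in> vector_fields A"
  shows "vf_bracket A (X + X') Y = vf_bracket A X Y + vf_bracket A X' Y"
proof (intro ext)
  fix p f
  show "vf_bracket A (X + X') Y p f = (vf_bracket A X Y + vf_bracket A X' Y) p f"
  proof (cases "smooth_near A p f")
    case True
    have "Y p (\<lambda>q. X q f + X' q f) = Y p (\<lambda>q. X q f) + Y p (\<lambda>q. X' q f)"
      using True vector_fieldsD[OF M] X Y by (intro tangent_vector_add[OF M, of _ p]) auto
    then show ?thesis by (simp add: vf_bracket_def deriv_along_def)
  qed (simp add: vf_bracket_def)
qed

text \<open>The Leibniz rule for Y applied to the product of g and X f leaves the term (Y g) X,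
  which is what the curvature computation has to cancel.\<close>

lemma vf_bracket_scale_left:
  assumes M: "smooth_manifold A" and g: "g \<in> smooth_funs A" and X: "X \<in> vector_fields A" and Y: "Y \<in> vector_fields A"
  shows "vf_bracket A (vf_scale g X) Y = vf_scale g (vf_bracket A X Y) + vf_scale (- deriv_along Y g) X"
proof (intro ext)
  fix p f
  show "vf_bracket A (vf_scale g X) Y p f = (vf_scale g (vf_bracket A X Y) + vf_scale (- deriv_along Y g) X) p f"
  proof (cases "smooth_near A p f")
    case True
    have "Y p (\<lambda>q. g q * X q f) = g p * Y p (\<lambda>q. X q f) + X p f * Y p g"
      using True vector_fieldsD[OF M] X Y g smooth_funs_iff_smooth_near[OF M]
      by (intro tangent_vector_mult[OF M, of _ p]) auto
    then show ?thesis using True by (simp add: vf_bracket_def deriv_along_def vf_scale_apply algebra_simps)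
  next
    \<comment> \<open>Here the bracket is 0 by its default, and the remaining term vanishes because
      X p is 0 on such f.\<close>
    case False
    then show ?thesis using tangent_vector_not_smooth[OF vector_fieldsD(1)[OF M X] False]
      by (simp add: vf_bracket_def vf_scale_apply)
  qed
qed

section \<open>Right invariant vector fields on a Lie group\<close>

locale lie_group_with_lie_algebra =
  fixes A :: "('g::{t2_space,second_countable_topology}, 'e::real_inner) atlas"
    and mul :: "'g \<Rightarrow> 'g \<Rightarrow> 'g" and e :: 'g and ginv :: "'g \<Rightarrow> 'g"
    and br :: "'a::real_vector \<Rightarrow> 'a \<Rightarrow> 'a" and \<theta> :: "'a \<Rightarrow> 'g tangent_vector"
  assumes lie_group: "lie_group A mul e ginv"
    and identification: "lie_algebra_identification A mul e br \<theta>"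
    and finite_dimensional: "\<exists>B::'a set. finite B \<and> span B = UNIV"
begin

abbreviation right_field :: "'a \<Rightarrow> 'g vfield" where
  "right_field u \<equiv> right_invariant_field mul (\<theta> u)"

lemma manifold: "smooth_manifold A"
  using lie_group by (simp add: lie_group_def)

lemma group_laws [simp]:
  "mul (mul p q) s = mul p (mul q s)" "mul e p = p" "mul p e = p"
  "mul (ginv p) p = e" "mul p (ginv p) = e"
proof -
  interpret group mul e ginv using lie_group by (simp add: lie_group_def)
  show "mul (mul p q) s = mul p (mul q s)" by (rule assoc)
  show "mul e p = p" by (rule group_left_neutral)
  show "mul p e = p" by (rule right_neutral)
  show "mul (ginv p) p = e" by (rule left_inverse)
  show "mul p (ginv p) = e" by (rule right_inverse)
qed

lemma smooth_map_at_mul: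
  assumes N: "smooth_manifold B" and "smooth_map_at B A F p" "smooth_map_at B A G p"
  shows "smooth_map_at B A (\<lambda>q. mul (F q) (G q)) p"
proof -
  have "smooth_map_at (product_atlas A A) A (\<lambda>(x, y). mul x y) z" for z
    using lie_group smooth_map_imp_smooth_map_at[OF smooth_manifold_product[OF manifold manifold] manifold]
    unfolding lie_group_def by blast
  from smooth_map_at_compose[OF smooth_map_at_Pair[OF N manifold manifold assms(2,3)] this] show ?thesis by simp
qed

lemma smooth_map_at_ginv: "smooth_map_at A A ginv p"
  using lie_group smooth_map_imp_smooth_map_at[OF manifold manifold] unfolding lie_group_def by blast

lemma smooth_near_product_mul:
  "smooth_near A (mul p q) f \<Longrightarrow> smooth_near (product_atlas A A) (p, q) (\<lambda>z. f (mul (fst z) (snd z)))"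
  using smooth_map_atD[OF smooth_map_at_mul[OF smooth_manifold_product[OF manifold manifold]
    smooth_map_at_fst[OF manifold manifold] smooth_map_at_snd[OF manifold manifold]], of "(p, q)"] by simp

lemma smooth_map_at_right_translation: "smooth_map_at A A (\<lambda>q. mul q a) p"
  by (rule smooth_map_at_mul[OF manifold smooth_map_at_id smooth_map_at_const[OF manifold]])

text \<open>Translation by the inverse of a undoes translation by a. The equivalence, not just one
  implication, is what carries the default 0 of tangent vectors along a translation.\<close>

lemma smooth_near_right_translation: "smooth_near A p (\<lambda>q. f (mul q a)) \<longleftrightarrow> smooth_near A (mul p a) f"
proof
  assume "smooth_near A p (\<lambda>q. f (mul q a))"
  then have "smooth_near A (mul (mul p a) (ginv a)) (\<lambda>q. f (mul q a))" by simp
  from smooth_map_atD[OF smooth_map_at_right_translation this] show "smooth_near A (mul p a) f" by simp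
next
  show "smooth_near A (mul p a) f \<Longrightarrow> smooth_near A p (\<lambda>q. f (mul q a))"
    by (rule smooth_map_atD[OF smooth_map_at_right_translation])
qed

lemma tangent_space_right_translation:
  "v \<in> tangent_space A p \<Longrightarrow> (\<lambda>f. v (\<lambda>q. f (mul q a))) \<in> tangent_space A (mul p a)"
  by (rule tangent_space_pushforward[OF manifold manifold smooth_map_at_right_translation])
    (simp add: smooth_near_right_translation)

lemma \<theta>_linear: "linear \<theta>" and \<theta>_bij: "bij_betw \<theta> UNIV (tangent_space A e)"
  and \<theta>_bracket: "vf_bracket A (left_invariant_field mul (\<theta> u)) (left_invariant_field mul (\<theta> v)) =
    left_invariant_field mul (\<theta> (br u v))"
  using identification by (auto simp: lie_algebra_identification_def)

lemma \<theta>_tangent: "\<theta> u \<in> tangent_space A e"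
  using \<theta>_bij by (auto simp: bij_betw_def)

lemma \<theta>_eq_iff: "\<theta> u = \<theta> v \<longleftrightarrow> u = v"
  using \<theta>_bij by (auto simp: bij_betw_def inj_on_def)

lemma right_field_apply: "right_field u p f = \<theta> u (\<lambda>q. f (mul q p))"
  by (simp add: right_invariant_field_def)

lemma right_field_linear:
  "right_field (u + v) = right_field u + right_field v"
  "right_field (k *\<^sub>R u) = vf_scale (\<lambda>_. k) (right_field u)"
  "right_field (- u) = - right_field u" "right_field 0 = 0" "right_field (u - v) = right_field u - right_field v"
  by (intro ext, simp add: right_invariant_field_def linear_add[OF \<theta>_linear] linear_scale[OF \<theta>_linear]
    linear_neg[OF \<theta>_linear] linear_0[OF \<theta>_linear] linear_diff[OF \<theta>_linear] vf_scale_apply scaleR_fun_def)+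

lemma right_field_vector_field: "right_field u \<in> vector_fields A"
  unfolding vector_fields_iff[OF manifold]
proof (intro conjI allI impI)
  show "right_field u p \<in> tangent_space A p" for p
    using tangent_space_right_translation[OF \<theta>_tangent, of u p] by (simp add: right_invariant_field_def)
  show "smooth_near A p (\<lambda>q. right_field u q f)" if f: "smooth_near A p f" for p f
  proof -
    \<comment> \<open>Near (e, p) the function f (x y) is smooth; \<open>\<theta> u\<close> acts in
      x at e while y remains as a parameter.\<close>
    have "smooth_near (product_atlas A A) (e, p) (\<lambda>z. f (mul (fst z) (snd z)))"
      using f smooth_near_product_mul[of e p f] by simp
    from smooth_near_tangent_vector_parametric[OF manifold manifold \<theta>_tangent this]
    show ?thesis by (simp add: right_field_apply)
  qed
qed

text \<open>By symmetry of mixed partial derivatives, at the identity the bracket of right invariant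
  fields is opposite to that of left invariant fields; right invariance carries this to all points.\<close>

lemma vf_bracket_right_field: "vf_bracket A (right_field u) (right_field v) = - right_field (br u v)"
proof (intro ext)
  fix p f
  show "vf_bracket A (right_field u) (right_field v) p f = (- right_field (br u v)) p f"
  proof (cases "smooth_near A p f")
    case False
    then have "\<not> smooth_near A e (\<lambda>q. f (mul q p))" by (simp add: smooth_near_right_translation)
    then show ?thesis using False tangent_vector_not_smooth[OF \<theta>_tangent]
      by (simp add: vf_bracket_def right_field_apply)
  next
    case True
    define g where "g q = f (mul q p)" for q
    have g: "smooth_near A e g" unfolding g_def using True by (simp add: smooth_near_right_translation)
    have "\<theta> u (\<lambda>x. \<theta> v (\<lambda>y. g (mul x y))) - \<theta> v (\<lambda>x. \<theta> u (\<lambda>y. g (mul x y))) = \<theta> (br u v) g"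
      using g fun_cong[OF fun_cong[OF \<theta>_bracket[of u v], of e], of g]
      by (simp add: vf_bracket_def left_invariant_field_def deriv_along_def)
    moreover have comm: "\<theta> b (\<lambda>y. \<theta> a (\<lambda>x. g (mul x y))) = \<theta> a (\<lambda>x. \<theta> b (\<lambda>y. g (mul x y)))" for a b
      using tangent_vectors_commute[OF manifold manifold \<theta>_tangent[of a] \<theta>_tangent[of b], of "\<lambda>z. g (mul (fst z) (snd z))"]
        smooth_near_product_mul[of e e g] g by simp
    moreover have "vf_bracket A (right_field u) (right_field v) p f =
        \<theta> u (\<lambda>x. \<theta> v (\<lambda>y. g (mul y x))) - \<theta> v (\<lambda>x. \<theta> u (\<lambda>y. g (mul y x)))"
      using True by (simp add: vf_bracket_def right_field_apply deriv_along_def g_def)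
    moreover have "(- right_field (br u v)) p f = - \<theta> (br u v) g"
      by (simp add: right_field_apply g_def[abs_def])
    ultimately show ?thesis using comm[of u v] comm[of v u] by linarith
  qed
qed

section \<open>The right trivialisation of the tangent bundle\<close>

definition coord :: "'g vfield \<Rightarrow> 'g \<Rightarrow> 'a" where
  "coord X p = inv \<theta> (\<lambda>f. X p (\<lambda>q. f (mul q (ginv p))))"

lemma coord_eqI: "X p = right_field u p \<Longrightarrow> coord X p = u"
  using \<theta>_bij by (simp add: coord_def right_field_apply inv_f_f bij_betw_def)

lemma \<theta>_coord:
  assumes "X \<in> vector_fields A"
  shows "\<theta> (coord X p) = (\<lambda>f. X p (\<lambda>q. f (mul q (ginv p))))"
proof -
  have "(\<lambda>f. X p (\<lambda>q. f (mul q (ginv p)))) \<in> tangent_space A (mul p (ginv p))"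
    using vector_fieldsD(1)[OF manifold assms] by (rule tangent_space_right_translation)
  then show ?thesis unfolding coord_def using \<theta>_bij by (simp add: bij_betw_def f_inv_into_f)
qed

lemma right_field_coord: "X \<in> vector_fields A \<Longrightarrow> right_field (coord X p) p = X p"
  by (intro ext) (simp add: right_invariant_field_def \<theta>_coord)

lemma coord_right_field: "coord (right_field u) p = u"
  by (rule coord_eqI) simp

lemma coord_add:
  assumes "X \<in> vector_fields A" "Y \<in> vector_fields A"
  shows "coord (X + Y) p = coord X p + coord Y p"
  by (rule coord_eqI) (simp add: right_field_linear right_field_coord assms)

lemma coord_scale:
  assumes "X \<in> vector_fields A"
  shows "coord (vf_scale f X) p = f p *\<^sub>R coord X p"
  by (rule coord_eqI) (simp add: right_field_linear vf_scale_def right_field_coord assms)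

text \<open>Every functional on the Lie algebra is the differential at e of a function: compose a
  chart at e with the linear functional that k induces on the model space.\<close>

lemma linear_functional_as_test_function:
  fixes k :: "'a \<Rightarrow> real"
  assumes k: "linear k"
  obtains g where "smooth_near A e g" "\<And>u. k u = \<theta> u g"
proof -
  obtain U \<phi> where c: "(U, \<phi>) \<in> A" "e \<in> U" using smooth_manifold_chart_at[OF manifold] .
  obtain C :: "'e set" where C: "parseval_frame C" using smooth_manifold_frame[OF manifold] .
  \<comment> \<open>The map from the model space to the Lie algebra obtained by comparing two
    descriptions of the tangent space at e, chart components and \<open>\<theta>\<close>.\<close>
  define J where "J w = inv \<theta> (chart_vector A U \<phi> e w)" for w
  have J: "\<theta> (J w) = chart_vector A U \<phi> e w" for w
    unfolding J_def using \<theta>_bij chart_vector_in_tangent_space[OF c] by (simp add: bij_betw_def f_inv_into_f)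
  have "linear J"
    by (rule linearI; subst \<theta>_eq_iff[symmetric])
      (simp_all add: linear_add[OF \<theta>_linear] linear_scale[OF \<theta>_linear] J chart_vector_linear[OF manifold c])
  then have "linear (\<lambda>w. k (J w))" using linear_compose[OF _ k, of J] by (simp add: o_def)
  then have bl: "bounded_linear (\<lambda>w. k (J w))" by (rule bounded_linear_parseval_frame[OF C])
  have "k u = \<theta> u (\<lambda>q. k (J (\<phi> q)))" for u
  proof -
    obtain w where w: "\<theta> u = chart_vector A U \<phi> e w" using tangent_space_chart[OF manifold \<theta>_tangent c] .
    then have "J w = u" using J \<theta>_eq_iff by metis
    then show ?thesis using chart_vector_coordinate[OF manifold c bl, of w] w by simp
  qed
  then show ?thesis using that smooth_near_coordinate[OF manifold c bl] by blast
qed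

text \<open>For g with k u = \<open>\<theta> u g\<close> the value is X at p applied to q |-> g (q
  p^-1), where p occurs twice. Separate the two roles, apply X in the first variable of a function
  smooth near (p, p), and restrict to the diagonal.\<close>

lemma smooth_funs_coord:
  assumes X: "X \<in> vector_fields A" and k: "linear k"
  shows "(\<lambda>p. k (coord X p)) \<in> smooth_funs A"
  unfolding smooth_funs_iff_smooth_near[OF manifold]
proof
  fix p
  obtain g where g: "smooth_near A e g" "\<And>u. k u = \<theta> u g"
    using linear_functional_as_test_function[OF k] by blast
  note P = smooth_manifold_product[OF manifold manifold]
  have "smooth_map_at (product_atlas A A) A (\<lambda>z. mul (fst z) (ginv (snd z))) (p, p)"
    by (intro smooth_map_at_mul[OF P] smooth_map_at_fst manifold smooth_map_at_compose[OF smooth_map_at_snd[OF manifold manifold] smooth_map_at_ginv])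
  then have "smooth_near (product_atlas A A) (p, p) (\<lambda>z. g (mul (fst z) (ginv (snd z))))"
    using g(1) smooth_map_atD by fastforce
  from smooth_near_vector_field_parametric[OF manifold manifold X this]
  have "smooth_near (product_atlas A A) (p, p) (\<lambda>z. X (fst z) (\<lambda>q. g (mul q (ginv (snd z)))))" by simp
  from smooth_map_atD[OF smooth_map_at_Pair[OF manifold manifold manifold smooth_map_at_id smooth_map_at_id] this]
  show "smooth_near A p (\<lambda>p. k (coord X p))" by (simp add: g(2) \<theta>_coord[OF X])
qed

lemma vector_fields_sum:
  assumes "finite I" "\<And>i. i \<in> I \<Longrightarrow> X i \<in> vector_fields A"
  shows "(\<Sum>i\<in>I. X i) \<in> vector_fields A"
  using assms
proof (induction I rule: finite_induct)
  case empty
  show ?case using right_field_vector_field[of 0] unfolding right_field_linear(4) sum.empty .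
qed (simp add: vector_fields_add[OF manifold])

lemma right_field_expansion:
  assumes "finite B" "\<And>v. v = (\<Sum>b\<in>B. \<delta> b v *\<^sub>R b)"
  shows "(\<lambda>p. right_field (u p) p) = (\<Sum>b\<in>B. vf_scale (\<lambda>p. \<delta> b (u p)) (right_field b))"
proof (intro ext)
  fix p f
  have "right_field (u p) p f = \<theta> (\<Sum>b\<in>B. \<delta> b (u p) *\<^sub>R b) (\<lambda>q. f (mul q p))"
    using assms(2)[of "u p"] by (simp add: right_field_apply)
  also have "\<dots> = (\<Sum>b\<in>B. \<delta> b (u p) * \<theta> b (\<lambda>q. f (mul q p)))"
    by (simp add: linear_sum[OF \<theta>_linear] linear_scale[OF \<theta>_linear] sum_fun_apply scaleR_fun_def)
  finally show "right_field (u p) p f = (\<Sum>b\<in>B. vf_scale (\<lambda>p. \<delta> b (u p)) (right_field b)) p f"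
    by (simp add: sum_fun_apply vf_scale_apply right_field_apply)
qed

text \<open>Converse of \<open>smooth_funs_coord\<close>: an algebra-valued function with smooth
  coordinates is a finite combination of right invariant fields with smooth coefficients.\<close>

lemma right_field_combination:
  assumes u: "\<And>k. linear k \<Longrightarrow> (\<lambda>p. k (u p)) \<in> smooth_funs A"
  shows "(\<lambda>p. right_field (u p) p) \<in> vector_fields A"
proof -
  obtain S :: "'a set" where S: "finite S" "span S = UNIV" using finite_dimensional by blast
  obtain B :: "'a set" and \<delta> where B: "finite B" "\<And>b. linear (\<delta> b :: 'a \<Rightarrow> real)" "\<And>v. v = (\<Sum>b\<in>B. \<delta> b v *\<^sub>R b)"
    using finite_dual_basis[OF S] by blast
  have "(\<Sum>b\<in>B. vf_scale (\<lambda>p. \<delta> b (u p)) (right_field b)) \<in> vector_fields A"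
    by (intro vector_fields_sum B vector_fields_scale manifold u right_field_vector_field)
  then show ?thesis using right_field_expansion[OF B(1,3), of u] by (rule back_subst[OF _ sym])
qed

text \<open>A field is a finite combination of right invariant fields with coefficients smooth on
  the whole group. Hence a tensorial identity has to be checked only on right invariant fields,
  without localisation.\<close>

lemma vector_field_induct [consumes 1, case_names right_field add scale]:
  assumes X: "X \<in> vector_fields A"
    and base: "\<And>u. P (right_field u)"
    and add: "\<And>X Y. X \<in> vector_fields A \<Longrightarrow> Y \<in> vector_fields A \<Longrightarrow> P X \<Longrightarrow> P Y \<Longrightarrow> P (X + Y)"
    and scale: "\<And>f X. f \<in> smooth_funs A \<Longrightarrow> X \<in> vector_fields A \<Longrightarrow> P X \<Longrightarrow> P (vf_scale f X)"
  shows "P X"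
proof -
  obtain S :: "'a set" where S: "finite S" "span S = UNIV" using finite_dimensional by blast
  obtain B :: "'a set" and \<delta> where B: "finite B" "\<And>b. linear (\<delta> b :: 'a \<Rightarrow> real)" "\<And>v. v = (\<Sum>b\<in>B. \<delta> b v *\<^sub>R b)"
    using finite_dual_basis[OF S] by blast
  have sm: "(\<lambda>p. \<delta> b (coord X p)) \<in> smooth_funs A" for b by (rule smooth_funs_coord[OF X B(2)])
  have vf: "(\<Sum>b\<in>C. vf_scale (\<lambda>p. \<delta> b (coord X p)) (right_field b)) \<in> vector_fields A" if "finite C" for C
    by (intro vector_fields_sum that vector_fields_scale manifold sm right_field_vector_field)
  have "P (\<Sum>b\<in>C. vf_scale (\<lambda>p. \<delta> b (coord X p)) (right_field b))" if "finite C" for C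
    using that
  proof (induction C rule: finite_induct)
    \<comment> \<open>The empty combination is the right invariant field of 0, so the base case
      covers it.\<close>
    case empty
    show ?case using base[of 0] unfolding right_field_linear(4) sum.empty .
  next
    case (insert b C)
    have "P (vf_scale (\<lambda>p. \<delta> b (coord X p)) (right_field b))"
      by (intro scale sm base right_field_vector_field)
    then show ?case unfolding sum.insert[OF insert(1,2)]
      by (intro add insert vf vector_fields_scale[OF manifold] sm right_field_vector_field)
  qed
  then have "P (\<Sum>b\<in>B. vf_scale (\<lambda>p. \<delta> b (coord X p)) (right_field b))" using B(1) .
  then have "P (\<lambda>p. right_field (coord X p) p)"
    by (rule back_subst[OF _ right_field_expansion[OF B(1,3), symmetric]])
  then show ?thesis using right_field_coord[OF X] by simp
qed

end

section \<open>Symmetric tensors on a left symmetric algebra\<close>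

lemma left_symmetric_algebra_onD:
  assumes "left_symmetric_algebra_on S m"
  shows "subspace S" "x \<in> S \<Longrightarrow> y \<in> S \<Longrightarrow> m x y \<in> S"
    "x \<in> S \<Longrightarrow> y \<in> S \<Longrightarrow> z \<in> S \<Longrightarrow> m (x + y) z = m x z + m y z"
    "x \<in> S \<Longrightarrow> y \<in> S \<Longrightarrow> z \<in> S \<Longrightarrow> m z (x + y) = m z x + m z y"
    "x \<in> S \<Longrightarrow> y \<in> S \<Longrightarrow> m (c *\<^sub>R x) y = c *\<^sub>R m x y"
    "x \<in> S \<Longrightarrow> y \<in> S \<Longrightarrow> m x (c *\<^sub>R y) = c *\<^sub>R m x y"
    "x \<in> S \<Longrightarrow> y \<in> S \<Longrightarrow> z \<in> S \<Longrightarrow> m (m x y) z - m x (m y z) = m (m y x) z - m y (m x z)"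
  using assms by (simp_all add: left_symmetric_algebra_on_def algebra_on_def associator_def)

lemma left_symmetric_algebra_on_diff:
  assumes "left_symmetric_algebra_on S m" "x \<in> S" "y \<in> S" "z \<in> S"
  shows "m (x - y) z = m x z - m y z" "m z (x - y) = m z x - m z y"
proof -
  note L = left_symmetric_algebra_onD[OF assms(1)]
  have d: "x - y \<in> S" by (rule subspace_diff[OF L(1) assms(2,3)])
  show "m (x - y) z = m x z - m y z" using L(3)[OF d assms(3,4)] by simp
  show "m z (x - y) = m z x - m z y" using L(4)[OF d assms(3,4)] by simp
qed

text \<open>The Jacobi sum regroups into three differences of associators with their first two
  arguments exchanged. It serves the dual product, whose commutator is the dual bracket.\<close>

lemma lie_algebra_on_commutator:
  assumes "left_symmetric_algebra_on S m"
  shows "lie_algebra_on S (commutator m)"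
proof -
  note L = left_symmetric_algebra_onD[OF assms] and Ld = left_symmetric_algebra_on_diff[OF assms]
  have "commutator m x (commutator m y z) + commutator m y (commutator m z x) + commutator m z (commutator m x y) = 0"
    if S: "x \<in> S" "y \<in> S" "z \<in> S" for x y z
  proof -
    have "commutator m x (commutator m y z) + commutator m y (commutator m z x) + commutator m z (commutator m x y) =
      - ((m (m x y) z - m x (m y z)) - (m (m y x) z - m y (m x z)))
      - ((m (m y z) x - m y (m z x)) - (m (m z y) x - m z (m y x)))
      - ((m (m z x) y - m z (m x y)) - (m (m x z) y - m x (m z y)))"
      by (simp add: commutator_def L(2) Ld S)
    then show ?thesis by (simp only: L(7)[OF S] L(7)[OF S(2,3,1)] L(7)[OF S(3,1,2)]) simp
  qed
  moreover have "algebra_on S (commutator m)"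
    unfolding algebra_on_def commutator_def
    by (auto simp: L subspace_diff algebra_simps scaleR_diff_right)
  ultimately show ?thesis by (simp add: lie_algebra_on_def commutator_def)
qed

lemma dual_space_iff: "\<alpha> \<in> dual_space \<longleftrightarrow> linear \<alpha>"
  by (simp add: dual_space_def)

lemma subspace_dual_space: "subspace (dual_space :: ('a::real_vector \<Rightarrow> real) set)"
  by (auto simp: subspace_def dual_space_iff linear_iff scaleR_fun_def algebra_simps)

locale symmetric_tensor_space =
  fixes r :: "('a::real_vector \<Rightarrow> real) \<Rightarrow> ('a \<Rightarrow> real) \<Rightarrow> real"
  assumes fin_dim: "\<exists>B::'a set. finite B \<and> span B = UNIV"
    and symmetric: "symmetric_tensor r"
begin

lemma dual_basis:
  obtains B :: "'a set" and \<delta> where "finite B" "\<And>b. linear (\<delta> b :: 'a \<Rightarrow> real)"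
    "\<And>v. v = (\<Sum>b\<in>B. \<delta> b v *\<^sub>R b)"
proof -
  obtain S :: "'a set" where "finite S" "span S = UNIV" using fin_dim by blast
  from finite_dual_basis[OF this] show ?thesis using that by blast
qed

lemma linear_functional_separates: "(\<And>k. linear k \<Longrightarrow> (k u :: real) = k v) \<Longrightarrow> u = (v :: 'a)"
proof -
  assume eq: "\<And>k. linear k \<Longrightarrow> (k u :: real) = k v"
  obtain B :: "'a set" and \<delta> where B: "finite B" "\<And>b. linear (\<delta> b :: 'a \<Rightarrow> real)" "\<And>v. v = (\<Sum>b\<in>B. \<delta> b v *\<^sub>R b)"
    using dual_basis by blast
  show "u = v" using B(3)[of u] B(3)[of v] eq[OF B(2)] by simp
qed

lemma r_sym: "linear \<alpha> \<Longrightarrow> linear \<beta> \<Longrightarrow> r \<alpha> \<beta> = r \<beta> \<alpha>"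
  using symmetric by (simp add: symmetric_tensor_def dual_space_iff)

lemma r_add_left: "linear \<alpha> \<Longrightarrow> linear \<alpha>' \<Longrightarrow> linear \<beta> \<Longrightarrow> r (\<lambda>u. \<alpha> u + \<alpha>' u) \<beta> = r \<alpha> \<beta> + r \<alpha>' \<beta>"
  using symmetric by (simp add: symmetric_tensor_def dual_space_iff plus_fun_def)

lemma r_scale_left: "linear \<alpha> \<Longrightarrow> linear \<beta> \<Longrightarrow> r (\<lambda>u. c * \<alpha> u) \<beta> = c * r \<alpha> \<beta>"
  using symmetric by (simp add: symmetric_tensor_def dual_space_iff scaleR_fun_def)

lemma r_add_right:
  assumes "linear \<alpha>" "linear \<beta>" "linear \<beta>'"
  shows "r \<alpha> (\<lambda>u. \<beta> u + \<beta>' u) = r \<alpha> \<beta> + r \<alpha> \<beta>'"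
  using assms r_sym[OF assms(1) linear_compose_add[OF assms(2,3)]] r_sym[OF assms(1)] by (simp add: r_add_left)

lemma linear_cmult: "linear \<alpha> \<Longrightarrow> linear (\<lambda>u. c * \<alpha> u :: real)"
  using linear_compose_scale_right[of \<alpha> c] by simp

lemma r_scale_right:
  assumes "linear \<alpha>" "linear \<beta>"
  shows "r \<alpha> (\<lambda>u. c * \<beta> u) = c * r \<alpha> \<beta>"
  using assms r_sym[OF assms(1) linear_cmult[OF assms(2)]] r_sym[OF assms] by (simp add: r_scale_left)

lemma r_zero_right: "linear \<alpha> \<Longrightarrow> r \<alpha> (\<lambda>u. 0) = 0"
  using r_scale_right[of \<alpha> \<alpha> 0] by simp

lemma r_sum_right:
  assumes "finite B" "linear \<alpha>" "\<And>b. linear (\<beta> b)"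
  shows "r \<alpha> (\<lambda>u. \<Sum>b\<in>B. c b * \<beta> b u) = (\<Sum>b\<in>B. c b * r \<alpha> (\<beta> b))"
  using assms(1)
proof (induction B rule: finite_induct)
  case empty
  then show ?case using r_zero_right[OF assms(2)] by simp
next
  case (insert b B)
  have "linear (\<lambda>u. \<Sum>b\<in>B. c b * \<beta> b u)" by (intro linear_compose_sum ballI linear_cmult assms)
  from r_add_right[OF assms(2) linear_cmult[OF assms(3)] this] show ?case
    using insert by (simp add: r_scale_right assms)
qed

lemma functional_expansion:
  assumes "linear k" "\<And>v. v = (\<Sum>b\<in>B. \<delta> b v *\<^sub>R b)"
  shows "k v = (\<Sum>b\<in>B. k b * \<delta> b v :: real)"
proof -
  have "k v = k (\<Sum>b\<in>B. \<delta> b v *\<^sub>R b)" using assms(2)[of v] by simp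
  then show ?thesis using assms(1) by (simp add: linear_sum linear_scale mult.commute)
qed

text \<open>Makes r a polynomial with constant coefficients in the values of its arguments on a
  basis, so smoothness and derivatives of r with varying arguments reduce to finitely many real
  functions.\<close>

lemma r_expansion:
  assumes B: "finite B" "\<And>b. linear (\<delta> b :: 'a \<Rightarrow> real)" "\<And>v. v = (\<Sum>b\<in>B. \<delta> b v *\<^sub>R b)"
    and \<alpha>: "linear \<alpha>" and \<beta>: "linear \<beta>"
  shows "r \<alpha> \<beta> = (\<Sum>b\<in>B. \<beta> b * (\<Sum>c\<in>B. \<alpha> c * r (\<delta> c) (\<delta> b)))"
proof -
  have "r \<alpha> (\<delta> b) = (\<Sum>c\<in>B. \<alpha> c * r (\<delta> c) (\<delta> b))" for b
  proof -
    have "r \<alpha> (\<delta> b) = r (\<delta> b) \<alpha>" by (rule r_sym[OF \<alpha> B(2)])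
    also have "\<dots> = r (\<delta> b) (\<lambda>v. \<Sum>c\<in>B. \<alpha> c * \<delta> c v)"
      by (rule arg_cong[of \<alpha> _ "r (\<delta> b)"], rule ext, rule functional_expansion[OF \<alpha> B(3)])
    also have "\<dots> = (\<Sum>c\<in>B. \<alpha> c * r (\<delta> b) (\<delta> c))" by (rule r_sum_right[OF B(1,2,2)])
    finally show ?thesis using r_sym[OF B(2) B(2)] by simp
  qed
  moreover have "r \<alpha> \<beta> = (\<Sum>b\<in>B. \<beta> b * r \<alpha> (\<delta> b))"
  proof -
    have "r \<alpha> \<beta> = r \<alpha> (\<lambda>v. \<Sum>b\<in>B. \<beta> b * \<delta> b v)" 
      by (rule arg_cong[of \<beta> _ "r \<alpha>"], rule ext, rule functional_expansion[OF \<beta> B(3)])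
    then show ?thesis using r_sum_right[OF B(1) \<alpha> B(2)] by simp
  qed
  ultimately show ?thesis by simp
qed

text \<open>Justifies the definite description: finite dimension gives existence, and functionals
  separating vectors gives uniqueness.\<close>

lemma tensor_sharp:
  assumes \<alpha>: "linear \<alpha>" and k: "linear k"
  shows "k (tensor_sharp r \<alpha>) = r \<alpha> k"
proof -
  obtain B :: "'a set" and \<delta> where B: "finite B" "\<And>b. linear (\<delta> b :: 'a \<Rightarrow> real)" "\<And>v. v = (\<Sum>b\<in>B. \<delta> b v *\<^sub>R b)"
    using dual_basis by blast
  \<comment> \<open>The vector whose coordinates in the basis are forced by testing against the dual
    functionals.\<close>
  define u where "u = (\<Sum>b\<in>B. r \<alpha> (\<delta> b) *\<^sub>R b)"
  have u: "\<beta> u = r \<alpha> \<beta>" if \<beta>: "linear \<beta>" for \<beta>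
  proof -
    have "r \<alpha> \<beta> = r \<alpha> (\<lambda>v. \<Sum>b\<in>B. \<beta> b * \<delta> b v)" 
      by (rule arg_cong[of \<beta> _ "r \<alpha>"], rule ext, rule functional_expansion[OF \<beta> B(3)])
    also have "\<dots> = (\<Sum>b\<in>B. \<beta> b * r \<alpha> (\<delta> b))" by (rule r_sum_right[OF B(1) \<alpha> B(2)])
    finally show ?thesis using \<beta> by (simp add: u_def linear_sum linear_scale mult.commute)
  qed
  have "\<forall>\<beta>\<in>dual_space. \<beta> (tensor_sharp r \<alpha>) = r \<alpha> \<beta>" unfolding tensor_sharp_def
  proof (rule theI)
    show "\<forall>\<beta>\<in>dual_space. \<beta> u = r \<alpha> \<beta>" using u by (simp add: dual_space_iff)
    show "v = u" if "\<forall>\<beta>\<in>dual_space. \<beta> v = r \<alpha> \<beta>" for v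
      using that u by (intro linear_functional_separates) (simp add: dual_space_iff)
  qed
  then show ?thesis using k by (simp add: dual_space_iff)
qed

lemma tensor_sharp_eqI: "linear \<alpha> \<Longrightarrow> (\<And>k. linear k \<Longrightarrow> k u = r \<alpha> k) \<Longrightarrow> tensor_sharp r \<alpha> = u"
  by (intro linear_functional_separates) (simp add: tensor_sharp)

lemma tensor_sharp_add:
  "linear \<alpha> \<Longrightarrow> linear \<beta> \<Longrightarrow> tensor_sharp r (\<alpha> + \<beta>) = tensor_sharp r \<alpha> + tensor_sharp r \<beta>"
  unfolding plus_fun_def
  by (intro tensor_sharp_eqI) (simp_all add: linear_compose_add linear_add tensor_sharp r_add_left)

lemma tensor_sharp_scale: "linear \<alpha> \<Longrightarrow> tensor_sharp r (c *\<^sub>R \<alpha>) = c *\<^sub>R tensor_sharp r \<alpha>"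
  unfolding scaleR_fun_def real_scaleR_def
  by (intro tensor_sharp_eqI) (simp_all add: linear_cmult linear_scale tensor_sharp r_scale_left)

context
  fixes m :: "'a \<Rightarrow> 'a \<Rightarrow> 'a"
  assumes lsa: "left_symmetric_algebra_on UNIV m"
begin

section \<open>The product and bracket on the dual space\<close>

lemma m_linear: "linear (m u)" "linear (\<lambda>u. m u v)"
  using left_symmetric_algebra_onD(3-6)[OF lsa] by (auto simp: linear_iff)

lemma L_star_linear: "linear \<alpha> \<Longrightarrow> linear (L_star m u \<alpha>)"
  using linear_compose_neg[OF linear_compose[OF m_linear(1)[of u], of \<alpha>]] by (simp add: L_star_def[abs_def] o_def)

lemma dual_bracket_commutator: "dual_bracket m r = commutator (dual_product m r)"
  by (intro ext) (simp add: dual_bracket_def commutator_def dual_product_def)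

lemma dual_bracket_linear: "linear \<alpha> \<Longrightarrow> linear \<beta> \<Longrightarrow> linear (dual_bracket m r \<alpha> \<beta>)"
  unfolding dual_bracket_def fun_diff_def by (intro linear_compose_sub L_star_linear)

text \<open>Every sharp that is not inside a left multiplication is removed by k (sharp x) = r x k.
  The result has the shape in which the covariant derivative of the bivector field appears.\<close>

lemma double_bracket_expansion:
  assumes "linear \<alpha>" "linear \<beta>" "linear \<gamma>"
  shows "double_bracket m r \<alpha> \<beta> \<gamma> =
    - r (\<lambda>v. \<beta> (m (tensor_sharp r \<alpha>) v)) \<gamma> + r (\<lambda>v. \<alpha> (m (tensor_sharp r \<beta>) v)) \<gamma>
    - r \<beta> (\<lambda>v. \<gamma> (m (tensor_sharp r \<alpha>) v)) + r \<alpha> (\<lambda>v. \<gamma> (m (tensor_sharp r \<beta>) v))"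
proof -
  have lin: "linear (\<lambda>v. k (m u v) :: real)" if "linear k" for u k
    using linear_compose[OF m_linear(1)[of u] that] by (simp add: o_def)
  have "dual_bracket m r \<alpha> \<beta> = (\<lambda>v. (- 1) * \<beta> (m (tensor_sharp r \<alpha>) v) + \<alpha> (m (tensor_sharp r \<beta>) v))"
    by (intro ext) (simp add: dual_bracket_def L_star_def)
  then have 1: "r (dual_bracket m r \<alpha> \<beta>) \<gamma> =
      - r (\<lambda>v. \<beta> (m (tensor_sharp r \<alpha>) v)) \<gamma> + r (\<lambda>v. \<alpha> (m (tensor_sharp r \<beta>) v)) \<gamma>"
    using assms lin by (simp only: r_add_left r_scale_left linear_cmult)
  have 2: "\<gamma> (m (tensor_sharp r \<alpha>) (tensor_sharp r \<beta>)) = r \<beta> (\<lambda>v. \<gamma> (m (tensor_sharp r \<alpha>) v))"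
    by (rule tensor_sharp[OF assms(2) lin[OF assms(3)]])
  have 3: "\<gamma> (m (tensor_sharp r \<beta>) (tensor_sharp r \<alpha>)) = r \<alpha> (\<lambda>v. \<gamma> (m (tensor_sharp r \<beta>) v))"
    by (rule tensor_sharp[OF assms(1) lin[OF assms(3)]])
  show ?thesis
    using tensor_sharp[OF dual_bracket_linear[OF assms(1,2)] assms(3)] 1 2 3
    by (simp add: double_bracket_def commutator_def linear_diff[OF assms(3)])
qed

context
  assumes double_bracket_zero:
    "\<forall>\<alpha>\<in>dual_space. \<forall>\<beta>\<in>dual_space. \<forall>\<gamma>\<in>dual_space. double_bracket m r \<alpha> \<beta> \<gamma> = 0"
begin

text \<open>Vanishing against all functionals \<open>\<gamma>\<close> is an identity of vectors,
  since functionals separate points.\<close>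

lemma tensor_sharp_dual_bracket:
  assumes "linear \<alpha>" "linear \<beta>"
  shows "tensor_sharp r (dual_bracket m r \<alpha> \<beta>) = commutator m (tensor_sharp r \<alpha>) (tensor_sharp r \<beta>)"
proof (rule linear_functional_separates)
  fix k :: "'a \<Rightarrow> real" assume "linear k"
  then show "k (tensor_sharp r (dual_bracket m r \<alpha> \<beta>)) = k (commutator m (tensor_sharp r \<alpha>) (tensor_sharp r \<beta>))"
    using double_bracket_zero assms by (simp add: dual_space_iff double_bracket_def linear_diff)
qed

text \<open>Left symmetry of the dual product says that \<open>L\<^sup>*\<close>, composed with the sharp map, is a
  representation of the bracket; this reduces to \<open>L\<close> being one.\<close>

lemma dual_product_left_symmetric: "left_symmetric_algebra_on dual_space (dual_product m r)"
proof -
  note L = left_symmetric_algebra_onD[OF lsa]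
  have "algebra_on dual_space (dual_product m r)"
    unfolding algebra_on_def
  proof (intro conjI ballI allI subspace_dual_space)
    show "dual_product m r x y \<in> dual_space" if "x \<in> dual_space" "y \<in> dual_space" for x y
      using that by (simp add: dual_space_iff dual_product_def L_star_linear)
  next
    fix x y z :: "'a \<Rightarrow> real" assume "x \<in> dual_space" "y \<in> dual_space" "z \<in> dual_space"
    then show "dual_product m r (x + y) z = dual_product m r x z + dual_product m r y z"
      by (intro ext) (simp add: dual_space_iff dual_product_def L_star_def tensor_sharp_add L linear_add)
    show "dual_product m r z (x + y) = dual_product m r z x + dual_product m r z y"
      by (intro ext) (simp add: dual_product_def L_star_def)
  next
    fix c and x y :: "'a \<Rightarrow> real" assume "x \<in> dual_space" "y \<in> dual_space"
    then show "dual_product m r (c *\<^sub>R x) y = c *\<^sub>R dual_product m r x y"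
      by (intro ext) (simp add: dual_space_iff dual_product_def L_star_def tensor_sharp_scale L linear_scale scaleR_fun_def[of c "\<lambda>v. - y (m (tensor_sharp r x) v)"])
    show "dual_product m r x (c *\<^sub>R y) = c *\<^sub>R dual_product m r x y"
      by (intro ext) (simp add: dual_product_def L_star_def scaleR_fun_def)
  qed
  moreover have "associator (dual_product m r) \<alpha> \<beta> \<gamma> = associator (dual_product m r) \<beta> \<alpha> \<gamma>"
    if lin: "linear \<alpha>" "linear \<beta>" "linear \<gamma>" for \<alpha> \<beta> \<gamma>
  proof
    fix v
    define a b where "a = tensor_sharp r \<alpha>" and "b = tensor_sharp r \<beta>"
    have lp: "linear (dual_product m r \<alpha> \<beta>)" "linear (dual_product m r \<beta> \<alpha>)"
      unfolding dual_product_def by (intro L_star_linear lin)+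
    \<comment> \<open>The two products differ by the dual bracket, so their sharps differ by the
      commutator of a and b; this is where the vanishing double bracket enters.\<close>
    have "tensor_sharp r (dual_product m r \<alpha> \<beta>) = tensor_sharp r (dual_bracket m r \<alpha> \<beta> + dual_product m r \<beta> \<alpha>)"
      by (simp add: dual_bracket_def dual_product_def)
    also have "\<dots> = (m a b - m b a) + tensor_sharp r (dual_product m r \<beta> \<alpha>)"
      using tensor_sharp_add[OF dual_bracket_linear[OF lin(1,2)] lp(2)] tensor_sharp_dual_bracket[OF lin(1,2)]
      by (simp add: commutator_def a_def b_def)
    finally have s: "tensor_sharp r (dual_product m r \<alpha> \<beta>) = (m a b - m b a) + tensor_sharp r (dual_product m r \<beta> \<alpha>)" .
    have "m (m a b - m b a) v = m a (m b v) - m b (m a v)"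
    proof -
      have "m (m a b - m b a) v = m (m a b) v - m (m b a) v"
        by (rule left_symmetric_algebra_on_diff(1)[OF lsa]) simp_all
      also have "\<dots> = m a (m b v) - m b (m a v)" using L(7)[of a b v] by (simp add: algebra_simps)
      finally show ?thesis .
    qed
    then show "associator (dual_product m r) \<alpha> \<beta> \<gamma> v = associator (dual_product m r) \<beta> \<alpha> \<gamma> v"
      using s by (simp add: associator_def dual_product_def[of m r _ \<gamma>] L_star_def a_def[symmetric] b_def[symmetric]
          L linear_add[OF lin(3)] linear_diff[OF lin(3)])
         (simp add: dual_product_def L_star_def a_def[symmetric] b_def[symmetric])
  qed
  ultimately show ?thesis by (simp add: left_symmetric_algebra_on_def dual_space_iff)
qed

lemma dual_bracket_lie_algebra: "lie_algebra_on dual_space (dual_bracket m r)"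
  unfolding dual_bracket_commutator by (rule lie_algebra_on_commutator[OF dual_product_left_symmetric])

lemma tensor_sharp_lie_morphism: "lie_morphism_on dual_space (dual_bracket m r) UNIV (commutator m) (tensor_sharp r)"
  by (simp add: lie_morphism_on_def dual_space_iff tensor_sharp_add tensor_sharp_scale tensor_sharp_dual_bracket)

end

end

end

section \<open>The right invariant connection and bivector field\<close>

lemma vf_scale_zero: "vf_scale f 0 = 0"
  by (intro ext) (simp add: vf_scale_apply)

locale right_invariant_connection =
  lie_group_with_lie_algebra A mul e ginv "commutator m" \<theta> + symmetric_tensor_space r
  for A :: "('g::{t2_space,second_countable_topology}, 'e::real_inner) atlas"
    and mul :: "'g \<Rightarrow> 'g \<Rightarrow> 'g" and e :: 'g and ginv :: "'g \<Rightarrow> 'g"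
    and m :: "'a::real_vector \<Rightarrow> 'a \<Rightarrow> 'a" and \<theta> :: "'a \<Rightarrow> 'g tangent_vector"
    and r :: "('a \<Rightarrow> real) \<Rightarrow> ('a \<Rightarrow> real) \<Rightarrow> real" +
  fixes D :: "'g vfield \<Rightarrow> 'g vfield \<Rightarrow> 'g vfield"
  assumes lsa: "left_symmetric_algebra_on UNIV m"
    and connection: "connection A D"
    and D_right_field: "D (right_field u) (right_field v) = - right_field (m u v)"
begin

lemmas vf_simps [simp] = vector_fields_add[OF manifold] vector_fields_scale[OF manifold] right_field_vector_field
  deriv_along_smooth_funs[OF manifold] smooth_funs_mult[OF manifold] smooth_funs_uminus[OF manifold] smooth_funs_const[OF manifold]

lemma D_vector_field [simp]: "X \<in> vector_fields A \<Longrightarrow> Y \<in> vector_fields A \<Longrightarrow> D X Y \<in> vector_fields A"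
  and D_add_left: "X \<in> vector_fields A \<Longrightarrow> X' \<in> vector_fields A \<Longrightarrow> Y \<in> vector_fields A \<Longrightarrow>
    D (X + X') Y = D X Y + D X' Y"
  and D_scale_left: "f \<in> smooth_funs A \<Longrightarrow> X \<in> vector_fields A \<Longrightarrow> Y \<in> vector_fields A \<Longrightarrow>
    D (vf_scale f X) Y = vf_scale f (D X Y)"
  and D_add_right: "X \<in> vector_fields A \<Longrightarrow> Y \<in> vector_fields A \<Longrightarrow> Y' \<in> vector_fields A \<Longrightarrow>
    D X (Y + Y') = D X Y + D X Y'"
  and D_scale_right: "f \<in> smooth_funs A \<Longrightarrow> X \<in> vector_fields A \<Longrightarrow> Y \<in> vector_fields A \<Longrightarrow>
    D X (vf_scale f Y) = vf_scale (deriv_along X f) Y + vf_scale f (D X Y)"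
  using connection unfolding connection_def by blast+

text \<open>With the sign moved inside, the result is again literally a right invariant field, so
  that D can be applied repeatedly.\<close>

lemma D_right_field': "D (right_field u) (right_field v) = right_field (- m u v)"
  by (simp only: D_right_field right_field_linear(3))

section \<open>Torsion\<close>

definition torsion :: "'g vfield \<Rightarrow> 'g vfield \<Rightarrow> 'g vfield" where
  "torsion X Y = D X Y - D Y X - vf_bracket A X Y"

lemma torsion_antisym: "torsion X Y = - torsion Y X"
  by (simp add: torsion_def vf_bracket_antisym[of A X Y])

lemma torsion_add: "X \<in> vector_fields A \<Longrightarrow> X' \<in> vector_fields A \<Longrightarrow> Y \<in> vector_fields A \<Longrightarrow>
  torsion (X + X') Y = torsion X Y + torsion X' Y"
  by (simp add: torsion_def D_add_left D_add_right vf_bracket_add_left[OF manifold] algebra_simps)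

lemma torsion_scale: "f \<in> smooth_funs A \<Longrightarrow> X \<in> vector_fields A \<Longrightarrow> Y \<in> vector_fields A \<Longrightarrow>
  torsion (vf_scale f X) Y = vf_scale f (torsion X Y)"
  by (intro ext) (simp add: torsion_def D_scale_left D_scale_right vf_bracket_scale_left[OF manifold] vf_scale_apply algebra_simps)

text \<open>Both the connection and the bracket carry a minus sign on right invariant fields, so the
  commutator of the product cancels. Antisymmetry then releases the other slot in
  \<open>torsion_zero\<close>.\<close>

lemma torsion_zero_right_field: "Y \<in> vector_fields A \<Longrightarrow> torsion Y (right_field u) = 0"
proof (induction Y rule: vector_field_induct)
  case (right_field v)
  have "torsion (right_field v) (right_field u) =
      right_field (- m v u) - right_field (- m u v) - - right_field (m v u - m u v)"
    by (simp only: torsion_def D_right_field' vf_bracket_right_field commutator_def)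
  also have "\<dots> = 0" by (simp only: right_field_linear(3,5)) simp
  finally show ?case .
qed (simp_all add: torsion_add torsion_scale vf_scale_zero del: plus_fun_apply zero_fun_apply)

lemma torsion_zero:
  assumes X: "X \<in> vector_fields A" and Y: "Y \<in> vector_fields A"
  shows "torsion X Y = 0"
  using X
proof (induction X rule: vector_field_induct)
  case (right_field u)
  then show ?case
    using torsion_antisym[of "right_field u" Y] torsion_zero_right_field[OF Y] by simp
qed (simp_all add: torsion_add torsion_scale vf_scale_zero Y del: plus_fun_apply zero_fun_apply)

lemma vf_bracket_eq: "X \<in> vector_fields A \<Longrightarrow> Y \<in> vector_fields A \<Longrightarrow> vf_bracket A X Y = D X Y - D Y X"
  using torsion_zero[of X Y] by (simp add: torsion_def)

lemma torsion_free: "torsion_free A D"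
  by (simp add: torsion_free_def vf_bracket_eq)

lemma vf_uminus: "- X = vf_scale (\<lambda>_. - 1) X"
  by (simp add: fun_eq_iff vf_scale_apply)

lemma vf_uminus_vector_field [simp]: "X \<in> vector_fields A \<Longrightarrow> - X \<in> vector_fields A"
  unfolding vf_uminus by simp

text \<open>Obtained from vanishing torsion rather than in charts: the bracket is a difference of
  covariant derivatives, which are fields by assumption on D.\<close>

lemma vf_bracket_vector_field [simp]:
  "X \<in> vector_fields A \<Longrightarrow> Y \<in> vector_fields A \<Longrightarrow> vf_bracket A X Y \<in> vector_fields A"
  using vector_fields_add[OF manifold, of "D X Y" "- D Y X"] by (simp add: vf_bracket_eq)

lemma D_uminus_left: "X \<in> vector_fields A \<Longrightarrow> Y \<in> vector_fields A \<Longrightarrow> D (- X) Y = - D X Y"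
  unfolding vf_uminus by (rule D_scale_left) simp_all

section \<open>Curvature\<close>

definition curvature :: "'g vfield \<Rightarrow> 'g vfield \<Rightarrow> 'g vfield \<Rightarrow> 'g vfield" where
  "curvature X Y Z = D X (D Y Z) - D Y (D X Z) - D (vf_bracket A X Y) Z"

lemma curvature_antisym:
  assumes "X \<in> vector_fields A" "Y \<in> vector_fields A" "Z \<in> vector_fields A"
  shows "curvature X Y Z = - curvature Y X Z"
  using assms by (simp add: curvature_def vf_bracket_antisym[of A X Y] D_uminus_left)

lemma curvature_add_left:
  assumes "X \<in> vector_fields A" "X' \<in> vector_fields A" "Y \<in> vector_fields A" "Z \<in> vector_fields A"
  shows "curvature (X + X') Y Z = curvature X Y Z + curvature X' Y Z"
  using assms by (simp add: curvature_def D_add_left D_add_right vf_bracket_add_left[OF manifold] algebra_simps)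

text \<open>The derivative of f along Y arises twice with opposite signs, from differentiating the
  product f D X Z and from the bracket.\<close>

lemma curvature_scale_left:
  assumes "f \<in> smooth_funs A" "X \<in> vector_fields A" "Y \<in> vector_fields A" "Z \<in> vector_fields A"
  shows "curvature (vf_scale f X) Y Z = vf_scale f (curvature X Y Z)"
proof -
  have "D (vf_bracket A (vf_scale f X) Y) Z = vf_scale f (D (vf_bracket A X Y) Z) + vf_scale (- deriv_along Y f) (D X Z)"
    using assms by (simp add: vf_bracket_scale_left[OF manifold] D_add_left D_scale_left)
  then show ?thesis using assms
    by (intro ext) (simp add: curvature_def D_scale_left D_scale_right vf_scale_apply algebra_simps)
qed

lemma curvature_add_right:
  assumes "X \<in> vector_fields A" "Y \<in> vector_fields A" "Z \<in> vector_fields A" "Z' \<in> vector_fields A"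
  shows "curvature X Y (Z + Z') = curvature X Y Z + curvature X Y Z'"
  using assms by (simp add: curvature_def D_add_right algebra_simps)

lemma deriv_along_vf_bracket:
  assumes "f \<in> smooth_funs A"
  shows "deriv_along (vf_bracket A X Y) f = deriv_along X (deriv_along Y f) - deriv_along Y (deriv_along X f)"
  using assms by (intro ext) (simp add: deriv_along_def[of "vf_bracket A X Y"] vf_bracket_def smooth_funs_iff_smooth_near[OF manifold] deriv_along_def)

text \<open>First derivatives of f cancel by symmetry between X and Y; the second derivatives
  combine to the bracket acting on f.\<close>

lemma curvature_scale_right:
  assumes "f \<in> smooth_funs A" "X \<in> vector_fields A" "Y \<in> vector_fields A" "Z \<in> vector_fields A"
  shows "curvature X Y (vf_scale f Z) = vf_scale f (curvature X Y Z)"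
  using assms
  by (intro ext) (simp add: curvature_def D_add_right D_scale_right deriv_along_vf_bracket vf_scale_apply algebra_simps)

lemma curvature_zero_right_fields: "curvature (right_field u) (right_field v) (right_field w) = 0"
proof -
  note L = left_symmetric_algebra_onD[OF lsa] and Ld = left_symmetric_algebra_on_diff[OF lsa]
  have neg: "m x (- y) = - m x y" "m (- x) y = - m x y" for x y
    using L(5)[of x y "-1"] L(6)[of x y "-1"] by simp_all
  \<comment> \<open>In every term two minus signs meet: those of two applications of D, or one from
    D and one from the bracket of right invariant fields.\<close>
  have "curvature (right_field u) (right_field v) (right_field w) =
      right_field (m u (m v w)) - right_field (m v (m u w)) - right_field (m (m u v - m v u) w)"
    by (simp only: curvature_def vf_bracket_right_field right_field_linear(3)[symmetric] D_right_field' commutator_def neg minus_minus)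
  also have "\<dots> = right_field (m u (m v w) - m v (m u w) - m (m u v - m v u) w)"
    by (simp only: right_field_linear(5))
  also have "m u (m v w) - m v (m u w) - m (m u v - m v u) w = 0"
  proof -
    have "m (m u v - m v u) w = m (m u v) w - m (m v u) w" by (rule Ld(1)) simp_all
    also have "\<dots> = m u (m v w) - m v (m u w)" using L(7)[of u v w] by (simp add: algebra_simps)
    finally show ?thesis by simp
  qed
  finally show ?thesis by (simp only: right_field_linear(4))
qed

text \<open>One slot at a time is released from right invariant to arbitrary fields: the third, then
  the first, and the second by antisymmetry.\<close>

lemma curvature_zero:
  assumes X: "X \<in> vector_fields A" and Y: "Y \<in> vector_fields A" and Z: "Z \<in> vector_fields A"
  shows "curvature X Y Z = 0"
proof -
  have 1: "curvature (right_field u) (right_field v) Z = 0" for u v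
    using Z
  proof (induction Z rule: vector_field_induct)
    case (right_field w)
    then show ?case by (rule curvature_zero_right_fields)
  qed (simp_all add: curvature_add_right curvature_scale_right vf_scale_zero del: plus_fun_apply zero_fun_apply)
  have 2: "curvature X (right_field v) Z = 0" for v
    using X
  proof (induction X rule: vector_field_induct)
    case (right_field w)
    then show ?case by (rule 1)
  qed (simp_all add: curvature_add_left curvature_scale_left vf_scale_zero Z del: plus_fun_apply zero_fun_apply)
  have "curvature Y X Z = 0"
    using Y
  proof (induction Y rule: vector_field_induct)
    case (right_field w)
    then show ?case using 2[of w] curvature_antisym[of "right_field w" X Z] X Z by simp
  qed (simp_all add: curvature_add_left curvature_scale_left vf_scale_zero X Z del: plus_fun_apply zero_fun_apply)
  then show ?thesis using curvature_antisym[OF X Y Z] by simp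
qed

lemma flat: "flat A D"
  using curvature_zero by (simp add: flat_def curvature_def)

text \<open>D is linear over smooth functions in X, so the value at p is the algebraic one with
  \<open>coord X p\<close> in place of u.\<close>

lemma coord_D_right_field: "X \<in> vector_fields A \<Longrightarrow> coord (D X (right_field v)) p = - m (coord X p) v"
proof (induction X rule: vector_field_induct)
  case (right_field u)
  then show ?case by (simp only: D_right_field' coord_right_field)
next
  case (add X Y)
  then show ?case using left_symmetric_algebra_onD(3)[OF lsa] by (simp add: D_add_left coord_add del: plus_fun_apply)
next
  case (scale f X)
  then show ?case using left_symmetric_algebra_onD(5)[OF lsa] by (simp add: D_scale_left coord_scale)
qed

section \<open>One-forms in the right trivialisation\<close>

definition form_at :: "'g form \<Rightarrow> 'g \<Rightarrow> 'a \<Rightarrow> real" where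
  "form_at \<alpha> p u = \<alpha> (right_field u) p"

lemma one_formsD:
  assumes "\<alpha> \<in> one_forms A"
  shows "X \<in> vector_fields A \<Longrightarrow> \<alpha> X \<in> smooth_funs A"
    "X \<in> vector_fields A \<Longrightarrow> Y \<in> vector_fields A \<Longrightarrow> \<alpha> (X + Y) = \<alpha> X + \<alpha> Y"
    "f \<in> smooth_funs A \<Longrightarrow> X \<in> vector_fields A \<Longrightarrow> \<alpha> (vf_scale f X) = f * \<alpha> X"
  using assms unfolding one_forms_def by blast+

lemma one_form_right_field_linear:
  assumes "\<alpha> \<in> one_forms A"
  shows "\<alpha> (right_field (u + v)) = \<alpha> (right_field u) + \<alpha> (right_field v)"
    "\<alpha> (right_field (c *\<^sub>R u)) = (\<lambda>_. c) * \<alpha> (right_field u)"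
  unfolding right_field_linear(1,2) by (simp_all only: one_formsD[OF assms] vf_simps)

lemma form_at_linear: "\<alpha> \<in> one_forms A \<Longrightarrow> linear (form_at \<alpha> p)"
  by (rule linearI) (simp_all only: form_at_def one_form_right_field_linear plus_fun_apply times_fun_apply real_scaleR_def)

text \<open>Forms are given as maps on global fields; linearity over smooth functions and the global
  frame show that they act pointwise.\<close>

lemma one_form_eq:
  assumes \<alpha>: "\<alpha> \<in> one_forms A"
  shows "X \<in> vector_fields A \<Longrightarrow> \<alpha> X p = form_at \<alpha> p (coord X p)"
proof (induction X rule: vector_field_induct)
  case (right_field u)
  then show ?case by (simp only: form_at_def coord_right_field)
next
  case (add X Y)
  then show ?case using one_formsD(2)[OF \<alpha>] form_at_linear[OF \<alpha>] by (simp add: coord_add linear_add del: plus_fun_apply) simp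
next
  case (scale f X)
  then show ?case using one_formsD(3)[OF \<alpha>] form_at_linear[OF \<alpha>] by (simp add: coord_scale linear_scale)
qed

text \<open>The right invariant 1-form with value k at the identity. These forms realise every
  functional at every point and test equality of fields.\<close>

definition invariant_form :: "('a \<Rightarrow> real) \<Rightarrow> 'g form" where
  "invariant_form k = (\<lambda>X. if X \<in> vector_fields A then (\<lambda>p. k (coord X p)) else 0)"

lemma invariant_form_one_form:
  assumes "linear k"
  shows "invariant_form k \<in> one_forms A"
  unfolding one_forms_def
  by (auto simp: invariant_form_def smooth_funs_coord assms coord_add coord_scale linear_add linear_scale fun_eq_iff)

lemma form_at_invariant_form: "form_at (invariant_form k) p = k"
  by (intro ext) (simp add: form_at_def invariant_form_def coord_right_field)

section \<open>The right invariant bivector field and its covariant derivative\<close>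

abbreviation bivector :: "'g form \<Rightarrow> 'g form \<Rightarrow> 'g \<Rightarrow> real" where
  "bivector \<equiv> right_invariant_bivector mul \<theta> r"

lemma bivector_apply: "bivector \<alpha> \<beta> p = r (form_at \<alpha> p) (form_at \<beta> p)"
  by (simp add: right_invariant_bivector_def form_at_def[abs_def])

lemma smooth_near_one_form: "\<alpha> \<in> one_forms A \<Longrightarrow> smooth_near A p (\<lambda>q. form_at \<alpha> q u)"
  using one_formsD(1) unfolding form_at_def smooth_funs_iff_smooth_near[OF manifold] by fastforce

lemma smooth_near_r:
  assumes "\<And>q. linear (a q)" "\<And>q. linear (b q)"
    and "\<And>u. smooth_near A p (\<lambda>q. a q u)" "\<And>u. smooth_near A p (\<lambda>q. b q u)"
  shows "smooth_near A p (\<lambda>q. r (a q) (b q))"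
proof -
  obtain B :: "'a set" and \<delta> where B: "finite B" "\<And>b. linear (\<delta> b :: 'a \<Rightarrow> real)" "\<And>v. v = (\<Sum>b\<in>B. \<delta> b v *\<^sub>R b)"
    using dual_basis by blast
  show ?thesis unfolding r_expansion[OF B assms(1,2)]
    by (intro smooth_near_sum smooth_near_mult smooth_near_const manifold B assms)
qed

lemma symmetric_bivector_field: "symmetric_bivector_field A bivector"
proof -
  have "bivector \<alpha> \<beta> \<in> smooth_funs A" if "\<alpha> \<in> one_forms A" "\<beta> \<in> one_forms A" for \<alpha> \<beta>
    using that unfolding smooth_funs_iff_smooth_near[OF manifold] bivector_apply
    by (blast intro: smooth_near_r form_at_linear smooth_near_one_form)
  moreover have "bivector \<alpha> \<beta> = bivector \<beta> \<alpha>" if "\<alpha> \<in> one_forms A" "\<beta> \<in> one_forms A" for \<alpha> \<beta>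
    using that by (intro ext) (simp add: bivector_apply r_sym form_at_linear)
  moreover have "bivector (\<alpha> + \<alpha>') \<beta> = bivector \<alpha> \<beta> + bivector \<alpha>' \<beta>"
    if "\<alpha> \<in> one_forms A" "\<alpha>' \<in> one_forms A" "\<beta> \<in> one_forms A" for \<alpha> \<alpha>' \<beta>
  proof
    fix p
    have "form_at (\<alpha> + \<alpha>') p = (\<lambda>u. form_at \<alpha> p u + form_at \<alpha>' p u)" by (intro ext) (simp add: form_at_def)
    then show "bivector (\<alpha> + \<alpha>') \<beta> p = (bivector \<alpha> \<beta> + bivector \<alpha>' \<beta>) p"
      using that by (simp add: bivector_apply r_add_left form_at_linear)
  qed
  moreover have "bivector (\<lambda>X. f * \<alpha> X) \<beta> = f * bivector \<alpha> \<beta>"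
    if "\<alpha> \<in> one_forms A" "\<beta> \<in> one_forms A" for f \<alpha> \<beta>
  proof
    fix p
    have "form_at (\<lambda>X. f * \<alpha> X) p = (\<lambda>u. f p * form_at \<alpha> p u)" by (intro ext) (simp add: form_at_def)
    then show "bivector (\<lambda>X. f * \<alpha> X) \<beta> p = (f * bivector \<alpha> \<beta>) p"
      using that by (simp add: bivector_apply r_scale_left form_at_linear)
  qed
  ultimately show ?thesis unfolding symmetric_bivector_field_def by blast
qed

text \<open>The pointwise sharp, transported back by right translations, is smooth and solves the
  defining equation of the description; invariant forms show that any other solution has the same
  coordinates.\<close>

lemma bivector_sharp:
  assumes \<alpha>: "\<alpha> \<in> one_forms A"
  shows "bivector_sharp A bivector \<alpha> \<in> vector_fields A"
    and "coord (bivector_sharp A bivector \<alpha>) p = tensor_sharp r (form_at \<alpha> p)"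
proof -
  define S where "S = (\<lambda>p. right_field (tensor_sharp r (form_at \<alpha> p)) p)"
  have S: "S \<in> vector_fields A" unfolding S_def
  proof (rule right_field_combination)
    fix k :: "'a \<Rightarrow> real" assume "linear k"
    then show "(\<lambda>p. k (tensor_sharp r (form_at \<alpha> p))) \<in> smooth_funs A"
      unfolding smooth_funs_iff_smooth_near[OF manifold]
      by (simp add: tensor_sharp form_at_linear[OF \<alpha>] smooth_near_r smooth_near_one_form[OF \<alpha>] smooth_near_const[OF manifold])
  qed
  have cS: "coord S p = tensor_sharp r (form_at \<alpha> p)" for p
    by (rule coord_eqI) (simp add: S_def)
  have "bivector_sharp A bivector \<alpha> = S" unfolding bivector_sharp_def
  proof (rule the_equality)
    show "S \<in> vector_fields A \<and> (\<forall>\<beta>\<in>one_forms A. \<beta> S = bivector \<alpha> \<beta>)"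
      using S \<alpha> by (auto simp: one_form_eq cS bivector_apply tensor_sharp form_at_linear)
    fix X assume X: "X \<in> vector_fields A \<and> (\<forall>\<beta>\<in>one_forms A. \<beta> X = bivector \<alpha> \<beta>)"
    have "coord X p = tensor_sharp r (form_at \<alpha> p)" for p
    proof (rule linear_functional_separates)
      fix k :: "'a \<Rightarrow> real" assume k: "linear k"
      have "invariant_form k X p = bivector \<alpha> (invariant_form k) p"
        using X invariant_form_one_form[OF k] by simp
      then show "k (coord X p) = k (tensor_sharp r (form_at \<alpha> p))"
        using X k \<alpha> by (simp add: invariant_form_def bivector_apply form_at_invariant_form[unfolded invariant_form_def]
            tensor_sharp form_at_linear)
    qed
    then show "X = S" using X right_field_coord[of X] by (simp add: fun_eq_iff S_def)
  qed
  then show "bivector_sharp A bivector \<alpha> \<in> vector_fields A"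
    "coord (bivector_sharp A bivector \<alpha>) p = tensor_sharp r (form_at \<alpha> p)" using S cS by simp_all
qed

text \<open>The product rule for the constant bilinear form r. Linearity of the differentiated
  arguments is part of the conclusion because r is known to be bilinear only on linear
  functionals.\<close>

lemma tangent_vector_r:
  assumes v: "v \<in> tangent_space A p"
    and lin: "\<And>q. linear (a q)" "\<And>q. linear (b q)"
    and sm: "\<And>u. smooth_near A p (\<lambda>q. a q u)" "\<And>u. smooth_near A p (\<lambda>q. b q u)"
  shows "v (\<lambda>q. r (a q) (b q)) = r (\<lambda>u. v (\<lambda>q. a q u)) (b p) + r (a p) (\<lambda>u. v (\<lambda>q. b q u))"
    and "linear (\<lambda>u. v (\<lambda>q. a q u))" "linear (\<lambda>u. v (\<lambda>q. b q u))"
proof -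
  have vl: "linear (\<lambda>u. v (\<lambda>q. c q u))"
    if "\<And>q. linear (c q)" "\<And>u. smooth_near A p (\<lambda>q. c q u)" for c :: "'g \<Rightarrow> 'a \<Rightarrow> real"
    by (rule linearI) (simp_all add: linear_add[OF that(1)] linear_scale[OF that(1)] that(2)
        tangent_vector_add[OF manifold v] tangent_vector_mult[OF manifold v smooth_near_const[OF manifold]] tangent_vector_const[OF manifold v])
  show la: "linear (\<lambda>u. v (\<lambda>q. a q u))" and lb: "linear (\<lambda>u. v (\<lambda>q. b q u))"
    by (rule vl[OF lin(1) sm(1)], rule vl[OF lin(2) sm(2)])
  obtain B :: "'a set" and \<delta> where B: "finite B" "\<And>b. linear (\<delta> b :: 'a \<Rightarrow> real)" "\<And>v. v = (\<Sum>b\<in>B. \<delta> b v *\<^sub>R b)"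
    using dual_basis by blast
  note ex = r_expansion[OF B]
  have s: "smooth_near A p (\<lambda>q. \<Sum>c\<in>B. a q c * r (\<delta> c) (\<delta> d))" for d
    by (intro smooth_near_sum smooth_near_mult smooth_near_const manifold B sm)
  have "v (\<lambda>q. \<Sum>c\<in>B. a q c * r (\<delta> c) (\<delta> d)) = (\<Sum>c\<in>B. v (\<lambda>q. a q c) * r (\<delta> c) (\<delta> d))" for d
    by (subst tangent_vector_sum[OF manifold v B(1)])
      (simp_all add: smooth_near_mult[OF manifold sm(1) smooth_near_const[OF manifold]]
        tangent_vector_mult[OF manifold v sm(1) smooth_near_const[OF manifold]] tangent_vector_const[OF manifold v] mult.commute)
  then have "v (\<lambda>q. b q d * (\<Sum>c\<in>B. a q c * r (\<delta> c) (\<delta> d))) =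
      b p d * (\<Sum>c\<in>B. v (\<lambda>q. a q c) * r (\<delta> c) (\<delta> d)) + v (\<lambda>q. b q d) * (\<Sum>c\<in>B. a p c * r (\<delta> c) (\<delta> d))" for d
    by (subst tangent_vector_mult[OF manifold v sm(2) s]) (simp add: mult.commute)
  then have "v (\<lambda>q. \<Sum>d\<in>B. b q d * (\<Sum>c\<in>B. a q c * r (\<delta> c) (\<delta> d))) =
      (\<Sum>d\<in>B. b p d * (\<Sum>c\<in>B. v (\<lambda>q. a q c) * r (\<delta> c) (\<delta> d))) +
      (\<Sum>d\<in>B. v (\<lambda>q. b q d) * (\<Sum>c\<in>B. a p c * r (\<delta> c) (\<delta> d)))"
    by (subst tangent_vector_sum[OF manifold v B(1)]) (simp_all add: smooth_near_mult[OF manifold sm(2) s] sum.distrib)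
  then show "v (\<lambda>q. r (a q) (b q)) = r (\<lambda>u. v (\<lambda>q. a q u)) (b p) + r (a p) (\<lambda>u. v (\<lambda>q. b q u))"
    unfolding ex[OF lin(1) lin(2)] ex[OF la lin(2)] ex[OF lin(1) lb] .
qed

text \<open>The terms that differentiate the coefficients of \<open>\<beta>\<close> and
  \<open>\<gamma>\<close> along X cancel against the product rule for r. What remains is algebraic
  in the values at p.\<close>

lemma nabla_bivector_apply:
  assumes X: "X \<in> vector_fields A" and \<beta>: "\<beta> \<in> one_forms A" and \<gamma>: "\<gamma> \<in> one_forms A"
  shows "nabla_bivector A D X bivector \<beta> \<gamma> p =
    - r (\<lambda>u. form_at \<beta> p (m (coord X p) u)) (form_at \<gamma> p) - r (form_at \<beta> p) (\<lambda>u. form_at \<gamma> p (m (coord X p) u))"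
proof -
  have v: "X p \<in> tangent_space A p" by (rule vector_fieldsD(1)[OF manifold X])
  \<comment> \<open>The plus sign comes from two minus signs, one in \<open>nabla_form\<close> and
    one in the connection on right invariant fields.\<close>
  have nf: "form_at (nabla_form A D X \<alpha>) p = (\<lambda>u. X p (\<lambda>q. form_at \<alpha> q u) + form_at \<alpha> p (m (coord X p) u))"
    if \<alpha>: "\<alpha> \<in> one_forms A" for \<alpha>
  proof
    fix u
    have "\<alpha> (D X (right_field u)) p = - form_at \<alpha> p (m (coord X p) u)"
      using one_form_eq[OF \<alpha>, of "D X (right_field u)" p] X
      by (simp add: coord_D_right_field linear_neg[OF form_at_linear[OF \<alpha>]])
    then show "form_at (nabla_form A D X \<alpha>) p u = X p (\<lambda>q. form_at \<alpha> q u) + form_at \<alpha> p (m (coord X p) u)"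
      by (simp add: form_at_def nabla_form_def deriv_along_def)
  qed
  note l = form_at_linear[OF \<beta>] form_at_linear[OF \<gamma>]
  have lm: "linear (\<lambda>u. k (m x u))" if "linear k" for k :: "'a \<Rightarrow> real" and x
    using linear_compose[OF m_linear(1)[OF lsa] that] by (simp add: o_def)
  note t = tangent_vector_r[OF v l smooth_near_one_form[OF \<beta>] smooth_near_one_form[OF \<gamma>]]
  show ?thesis
    using t(1)
    by (simp add: nabla_bivector_def bivector_apply nf[OF \<beta>] nf[OF \<gamma>] deriv_along_def
        r_add_left[OF t(2) lm[OF l(1)] l(2)] r_add_right[OF l(1) t(3) lm[OF l(2)]])
       (simp add: bivector_apply[abs_def])
qed

text \<open>After substituting the sharps for X, the left side minus the right side is term by term
  the expanded double bracket.\<close>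

lemma nabla_bivector_symmetric_iff:
  assumes \<alpha>: "\<alpha> \<in> one_forms A" and \<beta>: "\<beta> \<in> one_forms A" and \<gamma>: "\<gamma> \<in> one_forms A"
  shows "nabla_bivector A D (bivector_sharp A bivector \<alpha>) bivector \<beta> \<gamma> p =
      nabla_bivector A D (bivector_sharp A bivector \<beta>) bivector \<alpha> \<gamma> p \<longleftrightarrow>
    double_bracket m r (form_at \<alpha> p) (form_at \<beta> p) (form_at \<gamma> p) = 0"
  by (simp only: nabla_bivector_apply bivector_sharp assms
      double_bracket_expansion[OF lsa form_at_linear[OF \<alpha>] form_at_linear[OF \<beta>] form_at_linear[OF \<gamma>]])
    linarith

text \<open>Manifold, connection, torsion, curvature and bivector conditions hold in any case, so
  only the symmetry is at stake. It is tested on invariant forms at e in one direction and point by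
  point in the other.\<close>

lemma contravariant_pseudo_hessian_iff:
  "contravariant_pseudo_hessian A D bivector \<longleftrightarrow>
    (\<forall>\<alpha>\<in>dual_space. \<forall>\<beta>\<in>dual_space. \<forall>\<gamma>\<in>dual_space. double_bracket m r \<alpha> \<beta> \<gamma> = 0)"
proof
  assume H: "contravariant_pseudo_hessian A D bivector"
  show "\<forall>\<alpha>\<in>dual_space. \<forall>\<beta>\<in>dual_space. \<forall>\<gamma>\<in>dual_space. double_bracket m r \<alpha> \<beta> \<gamma> = 0"
  proof (intro ballI)
    fix \<alpha> \<beta> \<gamma> :: "'a \<Rightarrow> real" assume "\<alpha> \<in> dual_space" "\<beta> \<in> dual_space" "\<gamma> \<in> dual_space"
    then have i: "invariant_form \<alpha> \<in> one_forms A" "invariant_form \<beta> \<in> one_forms A" "invariant_form \<gamma> \<in> one_forms A"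
      by (simp_all add: dual_space_iff invariant_form_one_form)
    then have "nabla_bivector A D (bivector_sharp A bivector (invariant_form \<alpha>)) bivector (invariant_form \<beta>) (invariant_form \<gamma>) e =
        nabla_bivector A D (bivector_sharp A bivector (invariant_form \<beta>)) bivector (invariant_form \<alpha>) (invariant_form \<gamma>) e"
      using H unfolding contravariant_pseudo_hessian_def by metis
    then show "double_bracket m r \<alpha> \<beta> \<gamma> = 0"
      using nabla_bivector_symmetric_iff[OF i] by (simp only: form_at_invariant_form)
  qed
next
  assume "\<forall>\<alpha>\<in>dual_space. \<forall>\<beta>\<in>dual_space. \<forall>\<gamma>\<in>dual_space. double_bracket m r \<alpha> \<beta> \<gamma> = 0"
  then have "nabla_bivector A D (bivector_sharp A bivector \<alpha>) bivector \<beta> \<gamma> =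
      nabla_bivector A D (bivector_sharp A bivector \<beta>) bivector \<alpha> \<gamma>"
    if "\<alpha> \<in> one_forms A" "\<beta> \<in> one_forms A" "\<gamma> \<in> one_forms A" for \<alpha> \<beta> \<gamma>
    using nabla_bivector_symmetric_iff[OF that] form_at_linear that by (intro ext) (simp add: dual_space_iff)
  then show "contravariant_pseudo_hessian A D bivector"
    unfolding contravariant_pseudo_hessian_def
    using manifold connection torsion_free flat symmetric_bivector_field by blast
qed

end

theorem proposition6p1:
  fixes m :: "'a::real_vector \<Rightarrow> 'a \<Rightarrow> 'a"
    and A :: "('g::{t2_space,second_countable_topology}, 'e::real_inner) atlas"
    and mul :: "'g \<Rightarrow> 'g \<Rightarrow> 'g" and e :: 'g and ginv :: "'g \<Rightarrow> 'g"
    and \<theta> :: "'a \<Rightarrow> 'g tangent_vector"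
    and D :: "'g vfield \<Rightarrow> 'g vfield \<Rightarrow> 'g vfield"
    and r :: "('a \<Rightarrow> real) \<Rightarrow> ('a \<Rightarrow> real) \<Rightarrow> real"
  assumes "\<exists>B::'a set. finite B \<and> span B = UNIV"
    and "left_symmetric_algebra_on UNIV m"
    and "lie_group A mul e ginv"
    and "connected (UNIV :: 'g set)"
    and "lie_algebra_identification A mul e (commutator m) \<theta>"
    and "connection A D"
    and "\<And>u v. D (right_invariant_field mul (\<theta> u)) (right_invariant_field mul (\<theta> v)) =
               - right_invariant_field mul (\<theta> (m u v))"
    and "symmetric_tensor r"
  shows "(contravariant_pseudo_hessian A D (right_invariant_bivector mul \<theta> r) \<longleftrightarrow>
            (\<forall>\<alpha>\<in>dual_space. \<forall>\<beta>\<in>dual_space. \<forall>\<gamma>\<in>dual_space. double_bracket m r \<alpha> \<beta> \<gamma> = 0)) \<and>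
         (contravariant_pseudo_hessian A D (right_invariant_bivector mul \<theta> r) \<longrightarrow>
            left_symmetric_algebra_on dual_space (dual_product m r) \<and>
            lie_algebra_on dual_space (dual_bracket m r) \<and>
            lie_morphism_on dual_space (dual_bracket m r) UNIV (commutator m) (tensor_sharp r))"
proof -
  interpret right_invariant_connection A mul e ginv m \<theta> r D
    by unfold_locales (use assms in auto)
  show ?thesis
    using contravariant_pseudo_hessian_iff dual_product_left_symmetric[OF lsa]
      dual_bracket_lie_algebra[OF lsa] tensor_sharp_lie_morphism[OF lsa] by blast
qed

end
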